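(* There is a deterministic parallel algorithm (ParUF) which, given an $n$-vertex edge-weighted tree, correctly computes its single-linkage dendrogram (the parent of every edge node). It uses $O(n\log h)$ work and $O(h\log n)$ depth, where $h$ is the height of the output dendrogram.
   Context: Ties between equal edge weights are broken consistently, so each edge has a distinct rank. The single-linkage dendrogram (SLD) of a tree is defined by the following process. Start with each vertex as a singleton cluster and process the edges in increasing order of rank; processing $e=(u,v)$ merges the clusters of $u$ and $v$. The SLD is the rooted binary tree whose leaves are the vertices and whose internal nodes are the edges. The parent of edge node $e$ is the edge whose processing next merges the cluster created by $e$; the last edge processed is the root. The height $h$ is the maximum number of edge nodes on a root-to-leaf path. Costs are measured in the binary-forking work-depth model: work is the total number of operations, and depth is the longest chain of sequential dependencies. Concurrent reads, writes and atomic compare-and-swap and increment operations each cost $O(1)$. *)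

theory Defs
  imports Complex_Main
begin

section \<open>Edge-weighted trees\<close>

text \<open>
  Vertices are \<open>0, \<dots>, n - 1\<close>. A graph is given by the list of its edges \<open>(u, v, w)\<close>, and an edge is
  named by its position in that list. The two endpoints may be listed in either order.
\<close>

type_synonym edge_list = "(nat \<times> nat \<times> real) list"

definition end1 :: "edge_list \<Rightarrow> nat \<Rightarrow> nat" where
  "end1 es e = fst (es ! e)"

definition end2 :: "edge_list \<Rightarrow> nat \<Rightarrow> nat" where
  "end2 es e = fst (snd (es ! e))"

definition weight :: "edge_list \<Rightarrow> nat \<Rightarrow> real" where
  "weight es e = snd (snd (es ! e))"

definition joins :: "edge_list \<Rightarrow> nat \<Rightarrow> nat \<Rightarrow> nat \<Rightarrow> bool" where
  "joins es e x y \<longleftrightarrow> e < length es \<and>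
     (end1 es e = x \<and> end2 es e = y \<or> end1 es e = y \<and> end2 es e = x)"

definition connected_graph :: "nat \<Rightarrow> edge_list \<Rightarrow> bool" where
  "connected_graph n es \<longleftrightarrow> (\<forall>x<n. \<forall>y<n. (\<lambda>x y. \<exists>e. joins es e x y)\<^sup>*\<^sup>* x y)"

text \<open>Cycles of length 1 and 2 are self-loops and pairs of parallel edges.\<close>

definition is_cycle :: "edge_list \<Rightarrow> nat list \<Rightarrow> nat list \<Rightarrow> bool" where
  "is_cycle es xs fs \<longleftrightarrow> xs \<noteq> [] \<and> length fs = length xs \<and> distinct xs \<and> distinct fs \<and>
     (\<forall>i<length xs. joins es (fs ! i) (xs ! i) (xs ! (Suc i mod length xs)))"

definition weighted_tree :: "nat \<Rightarrow> edge_list \<Rightarrow> bool" where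
  "weighted_tree n es \<longleftrightarrow> n \<ge> 1 \<and>
     (\<forall>e<length es. end1 es e < n \<and> end2 es e < n) \<and>
     connected_graph n es \<and> \<not> (\<exists>xs fs. is_cycle es xs fs)"


section \<open>The single-linkage dendrogram\<close>

text \<open>Equal weights are ordered by edge name, and ranks count from 0.\<close>

definition precedes :: "edge_list \<Rightarrow> nat \<Rightarrow> nat \<Rightarrow> bool" where
  "precedes es f e \<longleftrightarrow> weight es f < weight es e \<or> weight es f = weight es e \<and> f < e"

definition rank :: "edge_list \<Rightarrow> nat \<Rightarrow> nat" where
  "rank es e = card {f. f < length es \<and> precedes es f e}"

definition ranked :: "edge_list \<Rightarrow> nat list" where
  "ranked es = sort_key (rank es) [0..<length es]"

definition cluster_of :: "nat set set \<Rightarrow> nat \<Rightarrow> nat set" where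
  "cluster_of P v = (THE C. C \<in> P \<and> v \<in> C)"

definition process_edge :: "edge_list \<Rightarrow> nat \<Rightarrow> nat set set \<Rightarrow> nat set set" where
  "process_edge es e P =
     (let A = cluster_of P (end1 es e); B = cluster_of P (end2 es e)
      in insert (A \<union> B) (P - {A, B}))"

text \<open>The clusters present after the \<open>i\<close> edges of smallest rank have been processed.\<close>

definition clusters :: "nat \<Rightarrow> edge_list \<Rightarrow> nat \<Rightarrow> nat set set" where
  "clusters n es i = fold (process_edge es) (take i (ranked es)) ((\<lambda>v. {v}) ` {..<n})"

datatype sld_node = Vertex nat | Edge nat

text \<open>
  Each node stands for a cluster: \<open>created\<close> is the number of processed edges from which on that
  cluster is present.
\<close>

fun created :: "edge_list \<Rightarrow> sld_node \<Rightarrow> nat" where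
  "created es (Vertex v) = 0"
| "created es (Edge e) = Suc (rank es e)"

fun node_cluster :: "nat \<Rightarrow> edge_list \<Rightarrow> sld_node \<Rightarrow> nat set" where
  "node_cluster n es (Vertex v) = {v}"
| "node_cluster n es (Edge e) = cluster_of (clusters n es (Suc (rank es e))) (end1 es e)"

definition merged_at :: "nat \<Rightarrow> edge_list \<Rightarrow> nat set \<Rightarrow> nat \<Rightarrow> bool" where
  "merged_at n es C j \<longleftrightarrow> j < length es \<and>
     (C = cluster_of (clusters n es j) (end1 es (ranked es ! j)) \<or>
      C = cluster_of (clusters n es j) (end2 es (ranked es ! j)))"

definition sld_parent :: "nat \<Rightarrow> edge_list \<Rightarrow> sld_node \<Rightarrow> nat option" where
  "sld_parent n es x =
     (let next = (\<lambda>j. created es x \<le> j \<and> merged_at n es (node_cluster n es x) j)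
      in if \<exists>j. next j then Some (ranked es ! (LEAST j. next j)) else None)"

definition sld_ancestors :: "nat \<Rightarrow> edge_list \<Rightarrow> sld_node \<Rightarrow> nat set" where
  "sld_ancestors n es x =
     {f. (\<lambda>y z. \<exists>g. sld_parent n es y = Some g \<and> z = Edge g)\<^sup>+\<^sup>+ x (Edge f)}"

text \<open>The edge nodes on the path between the root and a leaf are the ancestors of the leaf.\<close>

definition sld_height :: "nat \<Rightarrow> edge_list \<Rightarrow> nat" where
  "sld_height n es = Max ((\<lambda>v. card (sld_ancestors n es (Vertex v))) ` {..<n})"


section \<open>The binary-forking model\<close>

text \<open>
  A program is a finite list of procedures. A thread has natural-number registers (a program only
  names finitely many of them) and a control stack; all threads share one memory of
  natural numbers. The edge weights are accessible only through the comparison test \<open>Lighter\<close>,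
  where \<open>Lighter a b\<close> compares the weights of the edges named by \<open>a\<close> and \<open>b\<close>.
\<close>

datatype aexp =
    Lit nat | Reg nat
  | Plus aexp aexp | Minus aexp aexp | Times aexp aexp | Div aexp aexp | Mod aexp aexp

datatype bexp = Less aexp aexp | Lighter aexp aexp | Neg bexp | Conj bexp bexp

datatype com =
    Skip
  | Assign nat aexp
  | Load nat aexp
  | Store aexp aexp
  | Cas nat aexp aexp aexp
  | Fetch_Inc nat aexp
  | Seq com com
  | Cond bexp com com
  | While bexp com
  | Par com com
  | Call nat

type_synonym regs = "nat \<Rightarrow> nat"
type_synonym memory = "nat \<Rightarrow> nat"

primrec aval :: "regs \<Rightarrow> aexp \<Rightarrow> nat" where
  "aval s (Lit k) = k"
| "aval s (Reg r) = s r"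
| "aval s (Plus a b) = aval s a + aval s b"
| "aval s (Minus a b) = aval s a - aval s b"
| "aval s (Times a b) = aval s a * aval s b"
| "aval s (Div a b) = aval s a div aval s b"
| "aval s (Mod a b) = aval s a mod aval s b"

primrec bval :: "(nat \<Rightarrow> real) \<Rightarrow> regs \<Rightarrow> bexp \<Rightarrow> bool" where
  "bval w s (Less a b) \<longleftrightarrow> aval s a < aval s b"
| "bval w s (Lighter a b) \<longleftrightarrow> w (aval s a) < w (aval s b)"
| "bval w s (Neg p) \<longleftrightarrow> \<not> bval w s p"
| "bval w s (Conj p q) \<longleftrightarrow> bval w s p \<and> bval w s q"

text \<open>
  \<open>Run k s d\<close> is a thread with control stack \<open>k\<close> and registers \<open>s\<close>; it has ended when \<open>k = []\<close>. The
  counter \<open>d\<close> is the length of the longest chain of fork-join dependencies leading to its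
  current point. \<open>Join t u k s\<close> is a thread that has forked \<open>t\<close> and \<open>u\<close> and is suspended until both
  have ended; it then continues with its own registers, so that children report only through the
  shared memory.
\<close>

datatype thread = Run "com list" regs nat | Join thread thread "com list" regs

type_synonym config = "thread \<times> memory"

text \<open>
  One step performs one unit-cost operation, and any live thread may be the next to perform one.
  So every interleaving is an execution, and the work of an execution is its number of steps.
\<close>

inductive step :: "com list \<Rightarrow> (nat \<Rightarrow> real) \<Rightarrow> config \<Rightarrow> config \<Rightarrow> bool"
  for prog :: "com list" and w :: "nat \<Rightarrow> real" where
  Skip: "step prog w (Run (Skip # k) s d, m) (Run k s (Suc d), m)"
| Assign: "step prog w (Run (Assign r a # k) s d, m) (Run k (s(r := aval s a)) (Suc d), m)"
| Load: "step prog w (Run (Load r a # k) s d, m) (Run k (s(r := m (aval s a))) (Suc d), m)"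
| Store: "step prog w (Run (Store a b # k) s d, m) (Run k s (Suc d), m(aval s a := aval s b))"
| Cas_success: "m (aval s a) = aval s old \<Longrightarrow>
    step prog w (Run (Cas r a old new # k) s d, m)
      (Run k (s(r := 1)) (Suc d), m(aval s a := aval s new))"
| Cas_failure: "m (aval s a) \<noteq> aval s old \<Longrightarrow>
    step prog w (Run (Cas r a old new # k) s d, m) (Run k (s(r := 0)) (Suc d), m)"
| Fetch_Inc: "step prog w (Run (Fetch_Inc r a # k) s d, m)
    (Run k (s(r := m (aval s a))) (Suc d), m(aval s a := Suc (m (aval s a))))"
| Seq: "step prog w (Run (Seq p q # k) s d, m) (Run (p # q # k) s (Suc d), m)"
| Cond: "step prog w (Run (Cond b p q # k) s d, m)
    (Run ((if bval w s b then p else q) # k) s (Suc d), m)"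
| While_true: "bval w s b \<Longrightarrow>
    step prog w (Run (While b p # k) s d, m) (Run (p # While b p # k) s (Suc d), m)"
| While_false: "\<not> bval w s b \<Longrightarrow>
    step prog w (Run (While b p # k) s d, m) (Run k s (Suc d), m)"
| Call: "i < length prog \<Longrightarrow>
    step prog w (Run (Call i # k) s d, m) (Run (prog ! i # k) s (Suc d), m)"
| Fork: "step prog w (Run (Par p q # k) s d, m)
    (Join (Run [p] s (Suc d)) (Run [q] s (Suc d)) k s, m)"
| Left: "step prog w (t, m) (t', m') \<Longrightarrow> step prog w (Join t u k s, m) (Join t' u k s, m')"
| Right: "step prog w (u, m) (u', m') \<Longrightarrow> step prog w (Join t u k s, m) (Join t u' k s, m')"
| Join: "step prog w (Join (Run [] s1 d1) (Run [] s2 d2) k s, m) (Run k s (Suc (max d1 d2)), m)"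

fun finished :: "config \<Rightarrow> bool" where
  "finished (Run k s d, m) \<longleftrightarrow> k = []"
| "finished (Join t u k s, m) \<longleftrightarrow> False"

primrec thread_depth :: "thread \<Rightarrow> nat" where
  "thread_depth (Run k s d) = d"
| "thread_depth (Join t u k s) = max (thread_depth t) (thread_depth u)"

definition depth :: "config \<Rightarrow> nat" where
  "depth c = thread_depth (fst c)"

primrec thread_words :: "thread \<Rightarrow> nat set" where
  "thread_words (Run k s d) = range s"
| "thread_words (Join t u k s) = thread_words t \<union> thread_words u \<union> range s"

text \<open>
  All numbers held in registers or memory. A bound polynomial in \<open>n\<close> on them says that words of
  \<open>O(log n)\<close> bits suffice, so unit-cost arithmetic cannot be abused by packing data into large numbers.
\<close>

definition config_words :: "config \<Rightarrow> nat set" where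
  "config_words c = thread_words (fst c) \<union> range (snd c)"


section \<open>Input and output\<close>

text \<open>
  Register 0 holds \<open>n\<close>, and the endpoints of edge \<open>e\<close> are in cells \<open>2 e\<close> and \<open>2 e + 1\<close>; all else is 0.
\<close>

definition initial :: "nat \<Rightarrow> edge_list \<Rightarrow> config" where
  "initial n es =
     (Run [Call 0] ((\<lambda>_. 0)(0 := n)) 0,
      \<lambda>a. if a < 2 * length es
          then (if even a then end1 es (a div 2) else end2 es (a div 2)) else 0)"

text \<open>
  The parents are written right behind the input: cell \<open>2 (length es) + e\<close> holds 0 if \<open>e\<close> is the
  root and \<open>f + 1\<close> if \<open>f\<close> is the parent of \<open>e\<close>.
\<close>

definition outputs_sld :: "nat \<Rightarrow> edge_list \<Rightarrow> config \<Rightarrow> bool" where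
  "outputs_sld n es c \<longleftrightarrow> (\<forall>e<length es. snd c (2 * length es + e) =
     (case sld_parent n es (Edge e) of None \<Rightarrow> 0 | Some f \<Rightarrow> Suc f))"

end

theory Submission
  imports Defs "HOL-Library.Disjoint_Sets" "HOL-Library.Tree"
begin

text \<open>
  The algorithm is asynchronous. A first parallel loop over the half-edges collects them, by
  fetch-and-increment, in a list for every vertex. A second parallel loop over the vertices puts the
  half-edges of each vertex into a weight-biased leftist heap and then climbs the dendrogram: a thread
  that holds a cluster increments the counter of the lightest edge leaving it. The first thread to
  arrive at an edge stops; the second one melds the heaps of both clusters without the two nodes of the
  edge, and the new minimum is the parent. All edges leaving a cluster are ancestors of its dendrogram
  node, so heaps have size at most \<open>h\<close> and a meld costs \<open>O(log h)\<close>; a thread follows a path of the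
  dendrogram, so it makes at most \<open>h\<close> iterations. When all threads have ended, every vertex belongs to
  a cluster waiting at its lightest leaving edge or to the complete cluster; the former is impossible,
  because the lightest of the edges waited at would have both of its clusters waiting.

  The program is verified for all interleavings in a concurrent separation logic. Work is accounted for
  by credits: a cluster carries the credits for one meld, and the second thread to arrive at an edge
  receives those of the first.
\<close>

section \<open>A concurrent separation logic with credits\<close>

\<comment> \<open>The dendrogram is defined by a global order of the edges, while threads advance in
  any order. The two are reconciled because the parent of a node depends on its cluster alone: it is
  the lightest edge leaving it. Acyclicity does the rest: two disjoint clusters with the same
  lightest edge have no other edge between them, so removing the two nodes of that edge from their
  heaps leaves exactly the half-edges of the union. No thread spins, so depth is governed by a
  thread's own path: at most \<open>h\<close> insertions and \<open>h\<close> merges of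
  \<open>O(log h)\<close> steps each, below two fork trees of logarithmic height. Work is the harder
  bound, since a surviving thread performs many merges. Passing on credits reduces it to one prepaid
  merge per vertex and one insertion per half-edge. The bounds are required of every reachable
  configuration, finished or not. Hence credits, depth and word size are all carried by a single
  notion of safety. Registers of children are lost at a join, so results reach the parent only as
  ownership of cells together with what is known about their contents.\<close>
inductive_simps step_Nil: "step prog w (Run [] s d, m) cfg"
inductive_simps step_Skip: "step prog w (Run (Skip # k) s d, m) cfg"
inductive_simps step_Assign: "step prog w (Run (Assign r a # k) s d, m) cfg"
inductive_simps step_Load: "step prog w (Run (Load r a # k) s d, m) cfg"
inductive_simps step_Store: "step prog w (Run (Store a b # k) s d, m) cfg"
inductive_simps step_Cas: "step prog w (Run (Cas r a b e # k) s d, m) cfg"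
inductive_simps step_Fetch_Inc: "step prog w (Run (Fetch_Inc r a # k) s d, m) cfg"
inductive_simps step_Seq: "step prog w (Run (Seq p q # k) s d, m) cfg"
inductive_simps step_Cond: "step prog w (Run (Cond b p q # k) s d, m) cfg"
inductive_simps step_While: "step prog w (Run (While b p # k) s d, m) cfg"
inductive_simps step_Par: "step prog w (Run (Par p q # k) s d, m) cfg"
inductive_simps step_Call: "step prog w (Run (Call i # k) s d, m) cfg"
inductive_simps step_Join: "step prog w (Join t u k s, m) cfg"

lemmas step_Run = step_Nil step_Skip step_Assign step_Load step_Store step_Cas step_Fetch_Inc
  step_Seq step_Cond step_While step_Par step_Call

definition agree :: "nat set \<Rightarrow> memory \<Rightarrow> memory \<Rightarrow> bool" where
  "agree X m m' \<longleftrightarrow> (\<forall>a\<in>X. m a = m' a)"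

lemma agree_refl [simp]: "agree X m m"
  by (simp add: agree_def)

lemma agree_trans: "agree X m m' \<Longrightarrow> agree X m' m'' \<Longrightarrow> agree X m m''"
  by (simp add: agree_def)

lemma agree_mono: "agree X m m' \<Longrightarrow> Y \<subseteq> X \<Longrightarrow> agree Y m m'"
  by (auto simp: agree_def)

type_synonym inv = "memory \<Rightarrow> nat set \<Rightarrow> nat \<Rightarrow> bool"
type_synonym post = "regs \<Rightarrow> nat \<Rightarrow> memory \<Rightarrow> nat set \<Rightarrow> nat \<Rightarrow> bool"

text \<open>Lets a thread write to its own cells without proving the invariant anew: a change
  elsewhere cannot affect it.\<close>

definition local_inv :: "inv \<Rightarrow> bool" where
  "local_inv I \<longleftrightarrow> (\<forall>m m' Y c. agree Y m m' \<longrightarrow> I m Y c \<longrightarrow> I m' Y c)"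

text \<open>The invariant of a closed system, in which the main thread owns all of memory.\<close>

definition emp :: inv where
  "emp m Y c \<longleftrightarrow> Y = {} \<and> c = 0"

text \<open>
  What a step may do with the resources: the thread's cells \<open>X\<close> and credits \<open>c\<close> and the shared cells
  \<open>Y\<close> and credits \<open>e\<close> are redistributed, at least one credit is used up, and no cell outside
  \<open>X \<union> Y\<close> changes.
\<close>

definition transfers :: "nat \<Rightarrow> inv \<Rightarrow> nat set \<Rightarrow> nat \<Rightarrow> nat set \<Rightarrow> nat \<Rightarrow> memory \<Rightarrow> memory \<Rightarrow>
    thread \<Rightarrow> (nat set \<Rightarrow> nat \<Rightarrow> bool) \<Rightarrow> bool" where
  "transfers W I X c Y e m0 m1 t' R \<longleftrightarrow> (\<exists>X' c' Y' e'. X' \<union> Y' = X \<union> Y \<and> X' \<inter> Y' = {} \<and>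
     c' + e' < c + e \<and> agree (- (X \<union> Y)) m0 m1 \<and> range m1 \<subseteq> {..W} \<and> thread_words t' \<subseteq> {..W} \<and>
     I m1 Y' e' \<and> R X' c')"

lemma transfersI:
  "X' \<union> Y' = X \<union> Y \<Longrightarrow> X' \<inter> Y' = {} \<Longrightarrow> c' + e' < c + e \<Longrightarrow> agree (- (X \<union> Y)) m0 m1 \<Longrightarrow>
   range m1 \<subseteq> {..W} \<Longrightarrow> thread_words t' \<subseteq> {..W} \<Longrightarrow> I m1 Y' e' \<Longrightarrow> R X' c' \<Longrightarrow>
   transfers W I X c Y e m0 m1 t' R"
  unfolding transfers_def by (intro exI conjI)

lemma transfersE:
  assumes "transfers W I X c Y e m0 m1 t' R"
  obtains X' c' Y' e' where "X' \<union> Y' = X \<union> Y" "X' \<inter> Y' = {}" "c' + e' < c + e"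
    "agree (- (X \<union> Y)) m0 m1" "range m1 \<subseteq> {..W}" "thread_words t' \<subseteq> {..W}" "I m1 Y' e'" "R X' c'"
  using assms unfolding transfers_def by (elim exE conjE)

lemma transfers_mono [mono]:
  "(\<And>X c. R X c \<longrightarrow> R' X c) \<Longrightarrow>
   transfers W I X c Y e m0 m1 t' R \<longrightarrow> transfers W I X c Y e m0 m1 t' R'"
  by (intro impI, elim transfersE, rule transfersI) blast+

text \<open>
  \<open>safe\<close> is concurrent separation logic in semantic form: the thread owns the cells \<open>X\<close> and \<open>c\<close>
  credits, and everything that it shares with other threads satisfies the invariant \<open>I\<close>. Other threads
  may change all cells outside \<open>X\<close>. No number above \<open>W\<close> is ever produced.
\<close>

definition safe_body :: "com list \<Rightarrow> (nat \<Rightarrow> real) \<Rightarrow> nat \<Rightarrow> inv \<Rightarrow> post \<Rightarrow>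
    (thread \<Rightarrow> memory \<Rightarrow> nat set \<Rightarrow> nat \<Rightarrow> bool) \<Rightarrow> thread \<Rightarrow> memory \<Rightarrow> nat set \<Rightarrow> nat \<Rightarrow> bool" where
  "safe_body prog w W I Q R t m X c \<longleftrightarrow>
     (\<forall>s d m'. thread_words t \<subseteq> {..W} \<longrightarrow> m ` X \<subseteq> {..W} \<longrightarrow> t = Run [] s d \<longrightarrow> agree X m m' \<longrightarrow> Q s d m' X c) \<and>
     (\<forall>m'. thread_words t \<subseteq> {..W} \<longrightarrow> m ` X \<subseteq> {..W} \<longrightarrow> finished (t, m') \<or> (\<exists>cfg. step prog w (t, m') cfg)) \<and>
     (\<forall>m0 Y e t' m1. thread_words t \<subseteq> {..W} \<longrightarrow> range m0 \<subseteq> {..W} \<longrightarrow> agree X m m0 \<longrightarrow>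
        X \<inter> Y = {} \<longrightarrow> I m0 Y e \<longrightarrow> step prog w (t, m0) (t', m1) \<longrightarrow>
        transfers W I X c Y e m0 m1 t' (R t' m1))"

lemma safe_bodyI:
  assumes "\<And>s d m'. thread_words t \<subseteq> {..W} \<Longrightarrow> m ` X \<subseteq> {..W} \<Longrightarrow> t = Run [] s d \<Longrightarrow> agree X m m' \<Longrightarrow> Q s d m' X c"
    and "\<And>m'. thread_words t \<subseteq> {..W} \<Longrightarrow> m ` X \<subseteq> {..W} \<Longrightarrow> finished (t, m') \<or> (\<exists>cfg. step prog w (t, m') cfg)"
    and "\<And>m0 Y e t' m1. thread_words t \<subseteq> {..W} \<Longrightarrow> range m0 \<subseteq> {..W} \<Longrightarrow> agree X m m0 \<Longrightarrow>
        X \<inter> Y = {} \<Longrightarrow> I m0 Y e \<Longrightarrow> step prog w (t, m0) (t', m1) \<Longrightarrow>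
        transfers W I X c Y e m0 m1 t' (R t' m1)"
  shows "safe_body prog w W I Q R t m X c"
  unfolding safe_body_def by (intro conjI allI impI; (rule assms; assumption))

lemma safe_body_endD:
  assumes "safe_body prog w W I Q R t m X c" "thread_words t \<subseteq> {..W}"
    "m ` X \<subseteq> {..W}" "t = Run [] s d" "agree X m m'"
  shows "Q s d m' X c"
  by (rule assms(1)[unfolded safe_body_def, THEN conjunct1, rule_format, OF assms(2-)])

lemma safe_body_progressD:
  assumes "safe_body prog w W I Q R t m X c" "thread_words t \<subseteq> {..W}" "m ` X \<subseteq> {..W}"
  shows "finished (t, m') \<or> (\<exists>cfg. step prog w (t, m') cfg)"
  by (rule assms(1)[unfolded safe_body_def, THEN conjunct2, THEN conjunct1, rule_format, OF assms(2-)])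

lemma safe_body_stepD:
  assumes "safe_body prog w W I Q R t m X c" "thread_words t \<subseteq> {..W}" "range m0 \<subseteq> {..W}"
    "agree X m m0" "X \<inter> Y = {}" "I m0 Y e" "step prog w (t, m0) (t', m1)"
  shows "transfers W I X c Y e m0 m1 t' (R t' m1)"
  by (rule assms(1)[unfolded safe_body_def, THEN conjunct2, THEN conjunct2, rule_format, OF assms(2-)])

lemmas safe_bodyD = safe_body_endD safe_body_progressD safe_body_stepD

lemma safe_body_mono [mono]:
  assumes "\<And>t m X c. R t m X c \<longrightarrow> R' t m X c"
  shows "safe_body prog w W I Q R t m X c \<longrightarrow> safe_body prog w W I Q R' t m X c"
proof
  have mono: "transfers W I X c Y e m0 m1 t' (R t' m1) \<Longrightarrow> transfers W I X c Y e m0 m1 t' (R' t' m1)"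
    for Y e m0 m1 t'
    using transfers_mono[of "R t' m1" "R' t' m1"] assms by blast
  assume *: "safe_body prog w W I Q R t m X c"
  show "safe_body prog w W I Q R' t m X c"
    by (rule safe_bodyI) (rule safe_body_endD[OF *] safe_body_progressD[OF *]
        mono[OF safe_body_stepD[OF *]]; assumption)+
qed

inductive safe :: "com list \<Rightarrow> (nat \<Rightarrow> real) \<Rightarrow> nat \<Rightarrow> inv \<Rightarrow> post \<Rightarrow> thread \<Rightarrow> memory \<Rightarrow> nat set \<Rightarrow> nat \<Rightarrow> bool"
  for prog w W I Q where
  safe_intro: "safe_body prog w W I Q (safe prog w W I Q) t m X c \<Longrightarrow> safe prog w W I Q t m X c"

lemmas safeI = safe_intro[OF safe_bodyI]

text \<open>Available because \<open>safe\<close> is a least fixed point: under interference that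
  respects the invariant, a thread makes only finitely many steps of its own. The induction
  hypothesis sits inside \<open>transfers\<close>, where the new resources are chosen.\<close>

lemma safe_induct [consumes 1, case_names safe]:
  assumes "safe prog w W I Q t m X c"
    and step: "\<And>t m X c.
      (\<And>s d m'. thread_words t \<subseteq> {..W} \<Longrightarrow> m ` X \<subseteq> {..W} \<Longrightarrow> t = Run [] s d \<Longrightarrow> agree X m m' \<Longrightarrow> Q s d m' X c) \<Longrightarrow>
      (\<And>m'. thread_words t \<subseteq> {..W} \<Longrightarrow> m ` X \<subseteq> {..W} \<Longrightarrow> finished (t, m') \<or> (\<exists>cfg. step prog w (t, m') cfg)) \<Longrightarrow>
      (\<And>m0 Y e t' m1. thread_words t \<subseteq> {..W} \<Longrightarrow> range m0 \<subseteq> {..W} \<Longrightarrow> agree X m m0 \<Longrightarrow>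
        X \<inter> Y = {} \<Longrightarrow> I m0 Y e \<Longrightarrow> step prog w (t, m0) (t', m1) \<Longrightarrow>
        transfers W I X c Y e m0 m1 t' (\<lambda>X c. safe prog w W I Q t' m1 X c \<and> P t' m1 X c)) \<Longrightarrow>
      P t m X c"
  shows "P t m X c"
  using assms(1)
proof induction
  case (safe_intro t m X c)
  show ?case
    by (rule step) (rule safe_bodyD[OF safe_intro]; assumption)+
qed

context
  fixes prog :: "com list" and w :: "nat \<Rightarrow> real" and W :: nat
begin

abbreviation saf where "saf \<equiv> safe prog w W"

lemma agree_image: "agree X m m' \<Longrightarrow> m ` X = m' ` X"
  by (auto simp: agree_def image_def)

lemma agree_bounded: "agree X m m0 \<Longrightarrow> range m0 \<subseteq> {..W} \<Longrightarrow> m ` X \<subseteq> {..W::nat}"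
  by (auto simp: agree_def)

lemma safe_body: "saf I Q t m X c \<Longrightarrow> safe_body prog w W I Q (saf I Q) t m X c"
  by (erule safe.cases) (simp only:)

lemma safe_endD:
  assumes "saf I Q (Run [] s d) m X c" "range s \<subseteq> {..W}" "m ` X \<subseteq> {..W}" "agree X m m'"
  shows "Q s d m' X c"
  using safe_body_endD[OF safe_body[OF assms(1)] _ assms(3) refl assms(4)] assms(2) by simp

lemmas safe_progressD = safe_body_progressD[OF safe_body]
lemmas safe_stepD = safe_body_stepD[OF safe_body]

text \<open>Of the memory argument only the owned cells matter, which is stability under the steps
  of other threads.\<close>

lemma safe_agree:
  assumes "saf I Q t m X c" "agree X m m'"
  shows "saf I Q t m' X c"
proof (rule safeI)
  fix s d m''
  assume b: "thread_words t \<subseteq> {..W}" "m' ` X \<subseteq> {..W}" "t = Run [] s d" "agree X m' m''"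
  show "Q s d m'' X c"
    by (rule safe_endD[OF assms(1)[unfolded b(3)] _ _ agree_trans[OF assms(2) b(4)]])
      (use b agree_image[OF assms(2)] in simp_all)
next
  fix m''
  assume "thread_words t \<subseteq> {..W}" "m' ` X \<subseteq> {..W}"
  then show "finished (t, m'') \<or> (\<exists>cfg. step prog w (t, m'') cfg)"
    using safe_progressD[OF assms(1)] agree_image[OF assms(2)] by simp
next
  fix m0 Y e t' m1
  assume "thread_words t \<subseteq> {..W}" "range m0 \<subseteq> {..W}" "agree X m' m0" "X \<inter> Y = {}" "I m0 Y e"
      "step prog w (t, m0) (t', m1)"
  then show "transfers W I X c Y e m0 m1 t' (saf I Q t' m1)"
    using safe_stepD[OF assms(1)] agree_trans[OF assms(2)] by simp
qed

text \<open>All clauses of \<open>safe_body\<close> are guarded by the word bounds, so these may be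
  assumed in any proof of safety and need not be recorded in postconditions.\<close>

lemma safe_bounded:
  assumes "thread_words t \<subseteq> {..W} \<Longrightarrow> m ` X \<subseteq> {..W} \<Longrightarrow> saf I Q t m X c"
  shows "saf I Q t m X c"
proof (rule safeI)
  fix s d m''
  assume b: "thread_words t \<subseteq> {..W}" "m ` X \<subseteq> {..W}" "t = Run [] s d" "agree X m m''"
  show "Q s d m'' X c"
    by (rule safe_endD[OF assms[OF b(1,2), unfolded b(3)] _ b(2,4)]) (use b(1,3) in simp)
next
  fix m''
  assume b: "thread_words t \<subseteq> {..W}" "m ` X \<subseteq> {..W}"
  show "finished (t, m'') \<or> (\<exists>cfg. step prog w (t, m'') cfg)"
    using safe_progressD[OF assms[OF b] b] .
next
  fix m0 Y e t' m1
  assume b: "thread_words t \<subseteq> {..W}" "range m0 \<subseteq> {..W}" "agree X m m0" "X \<inter> Y = {}" "I m0 Y e"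
      "step prog w (t, m0) (t', m1)"
  show "transfers W I X c Y e m0 m1 t' (saf I Q t' m1)"
    using safe_stepD[OF assms[OF b(1) agree_bounded[OF b(3,2)]] b] .
qed

lemma safe_conseq:
  assumes "saf I Q t m X c"
    and "\<And>s d m X c. Q s d m X c \<Longrightarrow> Q' s d m X c"
  shows "saf I Q' t m X c"
  using assms(1)
proof (induction rule: safe_induct)
  case (safe t m X c)
  show ?case
  proof (rule safeI)
    fix s d m'
    assume b: "thread_words t \<subseteq> {..W}" "m ` X \<subseteq> {..W}" "t = Run [] s d" "agree X m m'"
    show "Q' s d m' X c"
      by (rule assms(2)[OF safe(1)[OF b]])
  next
    fix m'
    assume b: "thread_words t \<subseteq> {..W}" "m ` X \<subseteq> {..W}"
    show "finished (t, m') \<or> (\<exists>cfg. step prog w (t, m') cfg)"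
      by (rule safe(2)[OF b])
  next
    fix m0 Y e t' m1
    assume b: "thread_words t \<subseteq> {..W}" "range m0 \<subseteq> {..W}" "agree X m m0" "X \<inter> Y = {}" "I m0 Y e"
      "step prog w (t, m0) (t', m1)"
    show "transfers W I X c Y e m0 m1 t' (saf I Q' t' m1)"
      by (rule transfers_mono[rule_format, OF _ safe(3)[OF b]], erule conjunct2)
  qed
qed

lemma safe_more_credits:
  assumes "saf I Q t m X c" and "c \<le> c2"
    and "\<And>s d m X c c'. Q s d m X c \<Longrightarrow> c \<le> c' \<Longrightarrow> Q s d m X c'"
  shows "saf I Q t m X c2"
  using assms(1,2)
proof (induction arbitrary: c2 rule: safe_induct)
  case (safe t m X c)
  show ?case
  proof (rule safeI)
    fix s d m'
    assume b: "thread_words t \<subseteq> {..W}" "m ` X \<subseteq> {..W}" "t = Run [] s d" "agree X m m'"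
    show "Q s d m' X c2"
      by (rule assms(3)[OF safe(1)[OF b] safe(4)])
  next
    fix m'
    assume b: "thread_words t \<subseteq> {..W}" "m ` X \<subseteq> {..W}"
    show "finished (t, m') \<or> (\<exists>cfg. step prog w (t, m') cfg)"
      by (rule safe(2)[OF b])
  next
    fix m0 Y e t' m1
    assume b: "thread_words t \<subseteq> {..W}" "range m0 \<subseteq> {..W}" "agree X m m0" "X \<inter> Y = {}" "I m0 Y e"
      "step prog w (t, m0) (t', m1)"
    show "transfers W I X c2 Y e m0 m1 t' (saf I Q t' m1)"
      using safe(3)[OF b]
    proof (rule transfersE)
      fix X' c' Y' e'
      assume *: "X' \<union> Y' = X \<union> Y" "X' \<inter> Y' = {}" "c' + e' < c + e"
        "agree (- (X \<union> Y)) m0 m1" "range m1 \<subseteq> {..W}" "thread_words t' \<subseteq> {..W}" "I m1 Y' e'"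
        and IH: "saf I Q t' m1 X' c' \<and> (\<forall>x\<ge>c'. saf I Q t' m1 X' x)"
      have "c' + (c2 - c) + e' < c2 + e" using *(3) safe(4) by linarith
      with * IH show ?thesis by (intro transfersI[where c' = "c' + (c2 - c)"]) auto
    qed
  qed
qed

text \<open>Nothing can flow into or out of an empty invariant, so the footprint is constant. After
  a parallel phase this gives the whole memory back to the main thread.\<close>

lemma safe_conserve:
  assumes "saf emp Q t m X c"
  shows "saf emp (\<lambda>s d m' X' c'. X' = X \<and> Q s d m' X' c') t m X c"
  using assms
proof (induction rule: safe_induct)
  case (safe t m X c)
  show ?case
  proof (rule safeI)
    fix s d m'
    assume b: "thread_words t \<subseteq> {..W}" "m ` X \<subseteq> {..W}" "t = Run [] s d" "agree X m m'"
    show "X = X \<and> Q s d m' X c"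
      by (rule conjI[OF refl safe(1)[OF b]])
  next
    fix m'
    assume b: "thread_words t \<subseteq> {..W}" "m ` X \<subseteq> {..W}"
    show "finished (t, m') \<or> (\<exists>cfg. step prog w (t, m') cfg)"
      by (rule safe(2)[OF b])
  next
    fix m0 Y e t' m1
    assume b: "thread_words t \<subseteq> {..W}" "range m0 \<subseteq> {..W}" "agree X m m0" "X \<inter> Y = {}" "emp m0 Y e"
      "step prog w (t, m0) (t', m1)"
    show "transfers W emp X c Y e m0 m1 t' (saf emp (\<lambda>s d m' X' c'. X' = X \<and> Q s d m' X' c') t' m1)"
      using safe(3)[OF b]
    proof (rule transfersE)
      fix X' c' Y' e'
      assume *: "X' \<union> Y' = X \<union> Y" "X' \<inter> Y' = {}" "c' + e' < c + e"
        "agree (- (X \<union> Y)) m0 m1" "range m1 \<subseteq> {..W}" "thread_words t' \<subseteq> {..W}" "emp m1 Y' e'"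
        and IH: "saf emp Q t' m1 X' c' \<and> saf emp (\<lambda>s d m' X'' c'. X'' = X' \<and> Q s d m' X'' c') t' m1 X' c'"
      have "X' = X" using * b(5) by (auto simp: emp_def)
      with * IH show ?thesis by (intro transfersI) auto
    qed
  qed
qed

text \<open>What the children share among themselves is private to their parent. This allows each
  parallel phase to have an invariant of its own, set up before the fork and dissolved after the
  last join.\<close>

lemma safe_hide:
  assumes "saf J Q t m X c" "local_inv J" "X \<inter> Y = {}" "J m Y e"
  shows "saf emp (\<lambda>s d m' Z c'. \<exists>X' Y' c1 c2. Z = X' \<union> Y' \<and> X' \<inter> Y' = {} \<and> c' = c1 + c2 \<and> Q s d m' X' c1 \<and> J m' Y' c2)
           t m (X \<union> Y) (c + e)"
  using assms(1,3,4)
proof (induction arbitrary: Y e rule: safe_induct)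
  case (safe t m X c Y e)
  let ?Q = "\<lambda>s d m' Z c'. \<exists>X' Y' c1 c2. Z = X' \<union> Y' \<and> X' \<inter> Y' = {} \<and> c' = c1 + c2 \<and> Q s d m' X' c1 \<and> J m' Y' c2"
  show ?case
  proof (rule safeI)
    fix s d m'
    assume b: "thread_words t \<subseteq> {..W}" "m ` (X \<union> Y) \<subseteq> {..W}" "t = Run [] s d" "agree (X \<union> Y) m m'"
    have "J m' Y e"
      using assms(2)[unfolded local_inv_def] safe.prems(2) agree_mono[OF b(4), of Y] by blast
    moreover have "Q s d m' X c"
      by (rule safe(1)) (use b agree_mono[OF b(4), of X] in \<open>auto simp: image_Un\<close>)
    ultimately show "?Q s d m' (X \<union> Y) (c + e)"
      using safe.prems(1) by (intro exI[of _ X] exI[of _ Y] exI[of _ c] exI[of _ e]) simp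
  next
    fix m'
    assume b: "thread_words t \<subseteq> {..W}" "m ` (X \<union> Y) \<subseteq> {..W}"
    show "finished (t, m') \<or> (\<exists>cfg. step prog w (t, m') cfg)"
      by (rule safe(2)) (use b in \<open>simp_all add: image_Un\<close>)
  next
    fix m0 Y0 cY t' m1
    assume b: "thread_words t \<subseteq> {..W}" "range m0 \<subseteq> {..W}" "agree (X \<union> Y) m m0" "(X \<union> Y) \<inter> Y0 = {}" "emp m0 Y0 cY"
      "step prog w (t, m0) (t', m1)"
    have y0: "Y0 = {}" "cY = 0" using b(5) by (auto simp: emp_def)
    have J0: "J m0 Y e" using b(3) safe.prems assms(2)[unfolded local_inv_def] agree_mono[of "X \<union> Y" m m0 Y] by blast
    obtain X' c' Y' e' where *: "X' \<union> Y' = X \<union> Y" "X' \<inter> Y' = {}" "c' + e' < c + e"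
        "agree (- (X \<union> Y)) m0 m1" "range m1 \<subseteq> {..W}" "thread_words t' \<subseteq> {..W}" "J m1 Y' e'"
      and IH: "\<And>Y e. X' \<inter> Y = {} \<Longrightarrow> J m1 Y e \<Longrightarrow> saf emp ?Q t' m1 (X' \<union> Y) (c' + e)"
      using safe(3)[OF b(1,2) agree_mono[OF b(3)] safe.prems(1) J0 b(6)] by (rule transfersE) auto
    show "transfers W emp (X \<union> Y) (c + e) Y0 cY m0 m1 t' (saf emp ?Q t' m1)"
      using * y0 IH[OF *(2,7)]
      by (intro transfersI[where X' = "X \<union> Y" and c' = "c' + e'" and Y' = "{}" and e' = 0]) (simp_all add: emp_def)
  qed
qed

section \<open>Sequential and parallel composition of threads\<close>

fun app_stack :: "thread \<Rightarrow> com list \<Rightarrow> thread" where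
  "app_stack (Run k s d) k2 = Run (k @ k2) s d"
| "app_stack (Join t u k s) k2 = Join t u (k @ k2) s"

lemma thread_words_app_stack [simp]: "thread_words (app_stack t k2) = thread_words t"
  by (cases t) auto

lemma step_app_stack_fwd:
  "step prog w (t, m) (t', m') \<Longrightarrow> step prog w (app_stack t k2, m) (app_stack t' k2, m')"
  proof (cases t)
  case (Run k s d)
  assume st: "step prog w (t, m) (t', m')"
  show ?thesis
  proof (cases k)
    case (Cons p ks)
    show ?thesis using st unfolding Run Cons by (cases p) (auto simp: step_Run)
  qed (use st Run in \<open>simp add: step_Nil\<close>)
next
  case (Join t1 t2 k s)
  assume "step prog w (t, m) (t', m')"
  then show ?thesis unfolding Join by (auto simp: step_Join)
qed

lemma step_app_stack:
  assumes "step prog w (app_stack t k2, m) cfg" "\<nexists>s d. t = Run [] s d"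
  obtains t' m' where "step prog w (t, m) (t', m')" "cfg = (app_stack t' k2, m')"
proof (cases t)
  case (Run k s d)
  then obtain p ks where k: "k = p # ks" using assms(2) by (cases k) auto
  have st: "step prog w (Run (p # ks @ k2) s d, m) cfg"
    using assms(1) unfolding Run k by simp
  have "\<exists>t' m'. step prog w (Run (p # ks) s d, m) (t', m') \<and> cfg = (app_stack t' k2, m')"
  proof (cases p)
    case Skip
    show ?thesis using st
      by (intro exI[of _ "Run ks s (Suc d)"] exI[of _ "m"]) (auto simp: Skip step_Run)
  next
    case (Assign r a)
    show ?thesis using st
      by (intro exI[of _ "Run ks (s(r := aval s a)) (Suc d)"] exI[of _ "m"]) (auto simp: Assign step_Run)
  next
    case (Load r a)
    show ?thesis using st
      by (intro exI[of _ "Run ks (s(r := m (aval s a))) (Suc d)"] exI[of _ "m"]) (auto simp: Load step_Run)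
  next
    case (Store a b)
    show ?thesis using st
      by (intro exI[of _ "Run ks s (Suc d)"] exI[of _ "m(aval s a := aval s b)"]) (auto simp: Store step_Run)
  next
    case (Cas r a b e)
    show ?thesis using st
      by (intro exI[of _ "Run ks (s(r := if m (aval s a) = aval s b then 1 else 0)) (Suc d)"] exI[of _ "if m (aval s a) = aval s b then m(aval s a := aval s e) else m"]) (auto simp: Cas step_Run)
  next
    case (Fetch_Inc r a)
    show ?thesis using st
      by (intro exI[of _ "Run ks (s(r := m (aval s a))) (Suc d)"] exI[of _ "m(aval s a := Suc (m (aval s a)))"]) (auto simp: Fetch_Inc step_Run)
  next
    case (Seq q r)
    show ?thesis using st
      by (intro exI[of _ "Run (q # r # ks) s (Suc d)"] exI[of _ "m"]) (auto simp: Seq step_Run)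
  next
    case (Cond b q r)
    show ?thesis using st
      by (intro exI[of _ "Run ((if bval w s b then q else r) # ks) s (Suc d)"] exI[of _ "m"]) (auto simp: Cond step_Run)
  next
    case (While b q)
    show ?thesis using st
      by (intro exI[of _ "Run (if bval w s b then q # While b q # ks else ks) s (Suc d)"] exI[of _ "m"]) (auto simp: While step_Run)
  next
    case (Par q r)
    show ?thesis using st
      by (intro exI[of _ "Join (Run [q] s (Suc d)) (Run [r] s (Suc d)) ks s"] exI[of _ "m"]) (auto simp: Par step_Run)
  next
    case (Call q)
    show ?thesis using st
      by (intro exI[of _ "Run (prog ! q # ks) s (Suc d)"] exI[of _ "m"]) (auto simp: Call step_Run)
  qed
  with that show ?thesis unfolding Run k by blast
next
  case (Join t1 t2 k s)
  have st: "step prog w (Join t1 t2 (k @ k2) s, m) cfg"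
    using assms(1) unfolding Join by simp
  have "\<exists>t' m'. step prog w (Join t1 t2 k s, m) (t', m') \<and> cfg = (app_stack t' k2, m')"
    using st
  proof cases
    case (Left t' m')
    then show ?thesis by (intro exI[of _ "Join t' t2 k s"] exI[of _ m']) (simp add: step.Left)
  next
    case (Right u' m')
    then show ?thesis by (intro exI[of _ "Join t1 u' k s"] exI[of _ m']) (simp add: step.Right)
  next
    case (Join s1 d1 s2 d2)
    then show ?thesis by (intro exI[of _ "Run k s (Suc (max d1 d2))"] exI[of _ m]) (simp add: step.Join)
  qed
  with that show ?thesis unfolding Join by blast
qed

text \<open>The running part never inspects the frames below it, so every step of the composite is a
  step of \<open>t\<close> until its stack is empty. Then the postcondition passes to the
  continuation, at no cost.\<close>

lemma safe_bind:
  assumes "saf I Q1 t m X c" and "\<And>s d m X c. Q1 s d m X c \<Longrightarrow> saf I Q (Run k2 s d) m X c"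
  shows "saf I Q (app_stack t k2) m X c"
  using assms(1)
proof (induction rule: safe_induct)
  case (safe t m X c)
  show ?case
  proof (cases "\<exists>s d. t = Run [] s d")
    case True
    then obtain s d where t: "t = Run [] s d" by blast
    show ?thesis
    proof (rule safe_bounded)
      assume b: "thread_words (app_stack t k2) \<subseteq> {..W}" "m ` X \<subseteq> {..W}"
      have "Q1 s d m X c" by (rule safe(1)[OF _ b(2) t]) (use b in simp_all)
      then show "saf I Q (app_stack t k2) m X c" unfolding t using assms(2) by simp
    qed
  next
    case False
    show ?thesis
    proof (rule safeI)
      fix s d m'
      assume "app_stack t k2 = Run [] s d"
      then have False using False by (cases t) auto
      then show "Q s d m' X c" ..
    next
      fix m'
      assume b: "thread_words (app_stack t k2) \<subseteq> {..W}" "m ` X \<subseteq> {..W}"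
      have "\<not> finished (t, m')" using False by (cases t) auto
      then obtain t' m1 where "step prog w (t, m') (t', m1)"
        using safe(2)[of m'] b by auto
      then show "finished (app_stack t k2, m') \<or> (\<exists>cfg. step prog w (app_stack t k2, m') cfg)"
        using step_app_stack_fwd by blast
    next
      fix m0 Y e t' m1
      assume b: "thread_words (app_stack t k2) \<subseteq> {..W}" "range m0 \<subseteq> {..W}" "agree X m m0" "X \<inter> Y = {}" "I m0 Y e"
        "step prog w (app_stack t k2, m0) (t', m1)"
      obtain t1 where t1: "step prog w (t, m0) (t1, m1)" "t' = app_stack t1 k2"
        using step_app_stack[OF b(6)] False by blast
      have "transfers W I X c Y e m0 m1 t1 (\<lambda>X c. saf I Q1 t1 m1 X c \<and> saf I Q (app_stack t1 k2) m1 X c)"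
        by (rule safe(3)[OF _ b(2-5) t1(1)]) (use b in simp)
      then show "transfers W I X c Y e m0 m1 t' (saf I Q t' m1)"
        unfolding t1(2) by (elim transfersE, intro transfersI) auto
    qed
  qed
qed

text \<open>Each child regards the other as part of the environment: a step of one leaves the
  private cells of the other alone, and its exchange with the invariant keeps the footprints
  disjoint. The nested induction follows both executions at once. The additional credit pays for the
  join.\<close>

lemma safe_join:
  assumes "saf I Q1 t1 m1 X1 c1" and "saf I Q2 t2 m2 X2 c2"
    and "X1 \<inter> X2 = {}" "agree X1 m1 m" "agree X2 m2 m" and "Suc (c1 + c2) \<le> c"
    and cont: "\<And>s1 d1 X1 c1 s2 d2 X2 c2 m c. Q1 s1 d1 m X1 c1 \<Longrightarrow> Q2 s2 d2 m X2 c2 \<Longrightarrow> X1 \<inter> X2 = {} \<Longrightarrow>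
      c1 + c2 \<le> c \<Longrightarrow> saf I Q (Run k s (Suc (max d1 d2))) m (X1 \<union> X2) c"
  shows "saf I Q (Join t1 t2 k s) m (X1 \<union> X2) c"
  using assms(1-6)
proof (induction arbitrary: t2 m2 X2 c2 m c rule: safe_induct)
  case (safe t1 m1 X1 c1)
  note out = safe
  show ?case
    using out(4-8)
  proof (induction arbitrary: m c rule: safe_induct)
    case (safe t2 m2 X2 c2)
    \<comment> \<open>The inner induction has unfolded the safety of \<open>t2\<close>, which the
      outer hypothesis needs in folded form.\<close>
    have sf2: "saf I Q2 t2 m2 X2 c2"
      by (rule safeI) (use safe(1) in assumption, rule safe(2), assumption+,
         rule transfers_mono[rule_format, OF _ safe(3)], erule conjunct1, assumption+)
    have ag: "agree X1 m1 m'" "agree X2 m2 m'" if "agree (X1 \<union> X2) m m'" for m'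
      using that safe.prems(2,3) by (auto simp: agree_def)
    have img: "m1 ` X1 \<subseteq> {..W}" "m2 ` X2 \<subseteq> {..W}" if "m ` (X1 \<union> X2) \<subseteq> {..W}"
      using that safe.prems(2,3) by (auto simp: agree_def)
    show ?case
    proof (rule safeI)
      fix m'
      assume b: "thread_words (Join t1 t2 k s) \<subseteq> {..W}" "m ` (X1 \<union> X2) \<subseteq> {..W}"
      have p1: "finished (t1, m') \<or> (\<exists>cfg. step prog w (t1, m') cfg)"
        by (rule out(2)) (use b img in simp_all)
      have p2: "finished (t2, m') \<or> (\<exists>cfg. step prog w (t2, m') cfg)"
        by (rule safe(2)) (use b img in simp_all)
      show "finished (Join t1 t2 k s, m') \<or> (\<exists>cfg. step prog w (Join t1 t2 k s, m') cfg)"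
      proof (cases "finished (t1, m') \<and> finished (t2, m')")
        case True
        then obtain s1 d1 s2 d2 where "t1 = Run [] s1 d1" "t2 = Run [] s2 d2"
          by (cases t1; cases t2) auto
        then show ?thesis by (auto simp: step_Join)
      next
        case False
        then show ?thesis using p1 p2 step.Left step.Right by (metis surj_pair)
      qed
    next
      fix m0 Y e t' m3
      assume b: "thread_words (Join t1 t2 k s) \<subseteq> {..W}" "range m0 \<subseteq> {..W}" "agree (X1 \<union> X2) m m0"
        "(X1 \<union> X2) \<inter> Y = {}" "I m0 Y e" "step prog w (Join t1 t2 k s, m0) (t', m3)"
      have w: "thread_words t1 \<subseteq> {..W}" "thread_words t2 \<subseteq> {..W}" "range s \<subseteq> {..W}" using b(1) by auto
      from b(6) show "transfers W I (X1 \<union> X2) c Y e m0 m3 t' (saf I Q t' m3)"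
      proof cases
        case (Left t1')
        have "X1 \<inter> Y = {}" using b(4) by blast
        from out(3)[OF w(1) b(2) ag(1)[OF b(3)] this b(5) Left(2)]
        obtain X' c' Y' e' where *: "X' \<union> Y' = X1 \<union> Y" "X' \<inter> Y' = {}" "c' + e' < c1 + e"
           "agree (- (X1 \<union> Y)) m0 m3" "range m3 \<subseteq> {..W}" "thread_words t1' \<subseteq> {..W}" "I m3 Y' e'"
          and IH: "\<And>t2 m2 X2 c2 m c. saf I Q2 t2 m2 X2 c2 \<Longrightarrow> X' \<inter> X2 = {} \<Longrightarrow> agree X' m3 m \<Longrightarrow> agree X2 m2 m \<Longrightarrow>
             Suc (c' + c2) \<le> c \<Longrightarrow> saf I Q (Join t1' t2 k s) m (X' \<union> X2) c"
          by (rule transfersE) auto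
        have d: "X' \<inter> X2 = {}" using *(1) safe.prems(1) b(4) by blast
        have a2: "agree X2 m2 m3"
          using ag(2)[OF b(3)] *(4) safe.prems(1) b(4) by (auto simp: agree_def)
        have "saf I Q (Join t1' t2 k s) m3 (X' \<union> X2) (Suc (c' + c2))"
          by (rule IH[OF sf2 d agree_refl a2]) simp
        then show ?thesis unfolding Left(1)
          using * d b(4) safe.prems(1,4) w
          by (intro transfersI[where X' = "X' \<union> X2" and Y' = Y' and c' = "Suc (c' + c2)" and e' = e'])
            (auto simp: agree_def)
      next
        case (Right t2')
        have "X2 \<inter> Y = {}" using b(4) by blast
        from safe(3)[OF w(2) b(2) ag(2)[OF b(3)] this b(5) Right(2)]
        obtain X' c' Y' e' where *: "X' \<union> Y' = X2 \<union> Y" "X' \<inter> Y' = {}" "c' + e' < c2 + e"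
           "agree (- (X2 \<union> Y)) m0 m3" "range m3 \<subseteq> {..W}" "thread_words t2' \<subseteq> {..W}" "I m3 Y' e'"
          and IH: "\<And>m c. X1 \<inter> X' = {} \<Longrightarrow> agree X1 m1 m \<Longrightarrow> agree X' m3 m \<Longrightarrow>
             Suc (c1 + c') \<le> c \<Longrightarrow> saf I Q (Join t1 t2' k s) m (X1 \<union> X') c"
          by (rule transfersE) auto
        have d: "X1 \<inter> X' = {}" using *(1) safe.prems(1) b(4) by blast
        have a1: "agree X1 m1 m3"
          using ag(1)[OF b(3)] *(4) safe.prems(1) b(4) by (auto simp: agree_def)
        have "saf I Q (Join t1 t2' k s) m3 (X1 \<union> X') (Suc (c1 + c'))"
          by (rule IH[OF d a1 agree_refl]) simp
        then show ?thesis unfolding Right(1)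
          using * d b(4) safe.prems(1,4) w
          by (intro transfersI[where X' = "X1 \<union> X'" and Y' = Y' and c' = "Suc (c1 + c')" and e' = e'])
            (auto simp: agree_def)
      next
        case (Join s1 d1 s2 d2)
        have q1: "Q1 s1 d1 m0 X1 c1"
          by (rule out(1)[OF w(1) _ Join(1) ag(1)[OF b(3)]]) (use b(2) ag(1)[OF b(3)] agree_bounded in blast)
        have q2: "Q2 s2 d2 m0 X2 c2"
          by (rule safe(1)[OF w(2) _ Join(2) ag(2)[OF b(3)]]) (use b(2) ag(2)[OF b(3)] agree_bounded in blast)
        have "saf I Q (Run k s (Suc (max d1 d2))) m0 (X1 \<union> X2) (c1 + c2)"
          by (rule cont[OF q1 q2 safe.prems(1)]) simp
        then show ?thesis unfolding Join(3,4)
          using b safe.prems(4) w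
          by (intro transfersI[where X' = "X1 \<union> X2" and Y' = Y and c' = "c1 + c2" and e' = e]) auto
      qed
    qed simp
  qed
qed

section \<open>Proof rules for single operations\<close>

lemma safe_pure:
  assumes st: "\<And>m0 cfg. agree X m m0 \<Longrightarrow> step prog w (Run (p # k) s d, m0) cfg \<longleftrightarrow> cfg = (t', m0)"
    and words: "range s \<subseteq> {..W} \<Longrightarrow> m ` X \<subseteq> {..W} \<Longrightarrow> thread_words t' \<subseteq> {..W}"
    and cont: "saf I Q t' m X c"
  shows "saf I Q (Run (p # k) s d) m X (Suc c)"
proof (rule safeI)
  fix m'
  \<comment> \<open>Progress is asked for in an arbitrary memory, whereas \<open>st\<close> speaks
    of memories that agree with \<open>m\<close> on \<open>X\<close>. The patched memory
    \<open>m2\<close> serves to read off from \<open>st\<close> that a called procedure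
    exists.\<close>
  define m2 where "m2 a = (if a \<in> X then m a else m' a)" for a
  have "agree X m m2" by (simp add: agree_def m2_def)
  have "\<exists>cfg. step prog w (Run (p # k) s d, m') cfg"
  proof (cases p)
    case (Call i)
    have "i < length prog" using st[OF \<open>agree X m m2\<close>] unfolding Call step_Call by blast
    then show ?thesis unfolding Call by (intro exI) (rule step.Call)
  next
    case (While b q)
    then show ?thesis by (cases "bval w s b") (auto intro: step.While_true step.While_false)
  next
    case (Cas r a b e)
    then show ?thesis by (cases "m' (aval s a) = aval s b") (auto intro: step.Cas_success step.Cas_failure)
  qed (simp_all add: step_Run)
  then show "finished (Run (p # k) s d, m') \<or> (\<exists>cfg. step prog w (Run (p # k) s d, m') cfg)" ..
next
  fix m0 Y e t1 m1
  assume b: "thread_words (Run (p # k) s d) \<subseteq> {..W}" "range m0 \<subseteq> {..W}" "agree X m m0" "X \<inter> Y = {}" "I m0 Y e"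
        "step prog w (Run (p # k) s d, m0) (t1, m1)"
  have eq: "t1 = t'" "m1 = m0" using st[OF b(3)] b(6) by auto
  show "transfers W I X (Suc c) Y e m0 m1 t1 (saf I Q t1 m1)"
    unfolding eq using b words agree_bounded[OF b(3,2)] safe_agree[OF cont b(3)]
    by (intro transfersI[where X' = X and Y' = Y and c' = c and e' = e]) auto
qed simp

lemma safe_Skip: "saf I Q (Run k s (Suc d)) m X c \<Longrightarrow> saf I Q (Run (Skip # k) s d) m X (Suc c)"
  by (rule safe_pure) (auto simp: step_Skip)

lemma safe_Assign: "aval s a \<le> W \<Longrightarrow> saf I Q (Run k (s(r := aval s a)) (Suc d)) m X c \<Longrightarrow>
    saf I Q (Run (Assign r a # k) s d) m X (Suc c)"
  by (rule safe_pure) (auto simp: step_Assign)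

lemma safe_Load: "aval s a \<in> X \<Longrightarrow> saf I Q (Run k (s(r := m (aval s a))) (Suc d)) m X c \<Longrightarrow>
    saf I Q (Run (Load r a # k) s d) m X (Suc c)"
  by (rule safe_pure[where t' = "Run k (s(r := m (aval s a))) (Suc d)"])
    (auto simp: step_Load agree_def)

lemma safe_Seq: "saf I Q (Run (p # q # k) s (Suc d)) m X c \<Longrightarrow> saf I Q (Run (Seq p q # k) s d) m X (Suc c)"
  by (rule safe_pure) (auto simp: step_Seq)

lemma safe_Assign_Seq: "aval s a \<le> W \<Longrightarrow> saf I Q (Run (p # k) (s(r := aval s a)) (Suc (Suc d))) m X c \<Longrightarrow>
    saf I Q (Run (Seq (Assign r a) p # k) s d) m X (c + 2)"
  by (simp add: safe_Seq safe_Assign)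

lemma safe_Cond: "saf I Q (Run ((if bval w s b then p else q) # k) s (Suc d)) m X c \<Longrightarrow>
    saf I Q (Run (Cond b p q # k) s d) m X (Suc c)"
  by (rule safe_pure[where t' = "Run ((if bval w s b then p else q) # k) s (Suc d)"])
    (simp_all add: step_Cond)

lemma safe_While: "saf I Q (Run (if bval w s b then p # While b p # k else k) s (Suc d)) m X c \<Longrightarrow>
    saf I Q (Run (While b p # k) s d) m X (Suc c)"
  by (rule safe_pure[where t' = "Run (if bval w s b then p # While b p # k else k) s (Suc d)"])
    (simp_all add: step_While)

lemma safe_Call: "i < length prog \<Longrightarrow> saf I Q (Run (prog ! i # k) s (Suc d)) m X c \<Longrightarrow>
    saf I Q (Run (Call i # k) s d) m X (Suc c)"
  by (rule safe_pure[where t' = "Run (prog ! i # k) s (Suc d)"]) (simp_all add: step_Call)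

lemma safe_Fork: "saf I Q (Join (Run [p] s (Suc d)) (Run [q] s (Suc d)) k s) m X c \<Longrightarrow>
    saf I Q (Run (Par p q # k) s d) m X (Suc c)"
  by (rule safe_pure[where t' = "Join (Run [p] s (Suc d)) (Run [q] s (Suc d)) k s"])
    (simp_all add: step_Par)

lemma safe_Store:
  assumes "local_inv I" "aval s a \<in> X" "aval s b \<le> W"
    and cont: "saf I Q (Run k s (Suc d)) (m(aval s a := aval s b)) X c"
  shows "saf I Q (Run (Store a b # k) s d) m X (Suc c)"
proof (rule safeI)
  fix m0 Y e t1 m1
  assume b: "thread_words (Run (Store a b # k) s d) \<subseteq> {..W}" "range m0 \<subseteq> {..W}" "agree X m m0" "X \<inter> Y = {}" "I m0 Y e"
        "step prog w (Run (Store a b # k) s d, m0) (t1, m1)"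
  have eq: "t1 = Run k s (Suc d)" "m1 = m0(aval s a := aval s b)" using b(6) by (auto simp: step_Store)
  have "agree Y m0 m1" using b(4) assms(2) unfolding eq agree_def by auto
  then have "I m1 Y e" using assms(1)[unfolded local_inv_def] b(5) by blast
  moreover have "saf I Q t1 m1 X c"
    unfolding eq by (rule safe_agree[OF cont]) (use b(3) in \<open>auto simp: agree_def\<close>)
  ultimately show "transfers W I X (Suc c) Y e m0 m1 t1 (saf I Q t1 m1)"
    using b assms(2,3) unfolding eq
    by (intro transfersI[where X' = X and Y' = Y and c' = c and e' = e]) (auto simp: agree_def)
qed (auto simp: step_Store)

text \<open>Among the rules for single operations, only this one lets resources change hands: the
  thread may trade cells and credits with the invariant, provided that the invariant holds again
  after the increment. The premise ranges over all shared states, because the environment decides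
  which value is read.\<close>

lemma safe_Fetch_Inc:
  assumes "\<And>m0 Y e. range s \<subseteq> {..W} \<Longrightarrow> range m0 \<subseteq> {..W} \<Longrightarrow> agree X m m0 \<Longrightarrow> X \<inter> Y = {} \<Longrightarrow> I m0 Y e \<Longrightarrow>
      aval s a \<in> X \<union> Y \<and> Suc (m0 (aval s a)) \<le> W \<and> (\<exists>X' c' Y' e'. X' \<union> Y' = X \<union> Y \<and> X' \<inter> Y' = {} \<and>
        c' + e' < c + e \<and> I (m0(aval s a := Suc (m0 (aval s a)))) Y' e' \<and>
        saf I Q (Run k (s(r := m0 (aval s a))) (Suc d)) (m0(aval s a := Suc (m0 (aval s a)))) X' c')"
  shows "saf I Q (Run (Fetch_Inc r a # k) s d) m X c"
proof (rule safeI)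
  fix m0 Y e t1 m1
  assume b: "thread_words (Run (Fetch_Inc r a # k) s d) \<subseteq> {..W}" "range m0 \<subseteq> {..W}" "agree X m m0" "X \<inter> Y = {}" "I m0 Y e"
        "step prog w (Run (Fetch_Inc r a # k) s d, m0) (t1, m1)"
  have eq: "t1 = Run k (s(r := m0 (aval s a))) (Suc d)" "m1 = m0(aval s a := Suc (m0 (aval s a)))"
    using b(6) by (auto simp: step_Fetch_Inc)
  have rs: "range s \<subseteq> {..W}" using b(1) by simp
  from assms[OF rs b(2-5)] obtain X' c' Y' e' where *: "X' \<union> Y' = X \<union> Y" "X' \<inter> Y' = {}" "c' + e' < c + e"
     "I m1 Y' e'" "saf I Q t1 m1 X' c'" "aval s a \<in> X \<union> Y" "Suc (m0 (aval s a)) \<le> W"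
    unfolding eq by blast
  have "range (s(r := m0 (aval s a))) \<subseteq> {..W}" using rs b(2) by (auto split: if_splits)
  moreover have "range m1 \<subseteq> {..W}"
    using b(2) *(7) unfolding eq by (intro image_subsetI) (auto simp: image_subset_iff)
  ultimately show "transfers W I X c Y e m0 m1 t1 (saf I Q t1 m1)"
    using * by (intro transfersI[where X' = X' and Y' = Y' and c' = c' and e' = e']) (auto simp: eq agree_def)
qed (auto simp: step_Fetch_Inc)

text \<open>
  Sequential execution: \<open>runs A p s m K s' m'\<close> says that in \<open>K\<close> steps that touch only the cells \<open>A\<close>
  the command \<open>p\<close> leads from \<open>s\<close>, \<open>m\<close> to \<open>s'\<close>, \<open>m'\<close>, whatever the rest of the system does.
\<close>

definition runs :: "nat set \<Rightarrow> com \<Rightarrow> regs \<Rightarrow> memory \<Rightarrow> nat \<Rightarrow> regs \<Rightarrow> memory \<Rightarrow> bool" where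
  "runs A p s m K s' m' \<longleftrightarrow> (\<forall>I Q ks d X c. local_inv I \<longrightarrow> A \<subseteq> X \<longrightarrow>
     saf I Q (Run ks s' (d + K)) m' X c \<longrightarrow> saf I Q (Run (p # ks) s d) m X (c + K))"

text \<open>The postcondition receives the step count \<open>K\<close>, so that one sequential proof
  yields both the credits spent and the growth of the depth counter. Without forks the two are the
  same number.\<close>

definition wp :: "nat set \<Rightarrow> com \<Rightarrow> (nat \<Rightarrow> regs \<Rightarrow> memory \<Rightarrow> bool) \<Rightarrow> regs \<Rightarrow> memory \<Rightarrow> bool" where
  "wp A p Q s m \<longleftrightarrow> (\<exists>K s' m'. runs A p s m K s' m' \<and> Q K s' m')"

lemma wpI: "runs A p s m K s' m' \<Longrightarrow> Q K s' m' \<Longrightarrow> wp A p Q s m"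
  unfolding wp_def by blast

lemma wp_conseq: "wp A p Q s m \<Longrightarrow> (\<And>K s' m'. Q K s' m' \<Longrightarrow> Q' K s' m') \<Longrightarrow> wp A p Q' s m"
  unfolding wp_def by blast

lemma wp_Skip: "Q 1 s m \<Longrightarrow> wp A Skip Q s m"
  by (rule wpI[where K = 1]) (auto simp: runs_def intro: safe_Skip)

lemma wp_Assign: "aval s a \<le> W \<Longrightarrow> Q 1 (s(r := aval s a)) m \<Longrightarrow> wp A (Assign r a) Q s m"
  by (rule wpI[where K = 1]) (auto simp: runs_def intro: safe_Assign)

lemma wp_Load: "aval s a \<in> A \<Longrightarrow> Q 1 (s(r := m (aval s a))) m \<Longrightarrow> wp A (Load r a) Q s m"
  by (rule wpI[where K = 1]) (auto simp: runs_def intro!: safe_Load)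

lemma wp_Store: "aval s a \<in> A \<Longrightarrow> aval s b \<le> W \<Longrightarrow> Q 1 s (m(aval s a := aval s b)) \<Longrightarrow> wp A (Store a b) Q s m"
  by (rule wpI[where K = 1]) (auto simp: runs_def intro!: safe_Store)

lemma runs_Seq:
  assumes "runs A p s m K1 s1 m1" "runs A q s1 m1 K2 s2 m2"
  shows "runs A (Seq p q) s m (Suc (K1 + K2)) s2 m2"
  unfolding runs_def
proof (intro allI impI)
  fix I Q ks d X c
  assume a: "local_inv I" "A \<subseteq> X" "saf I Q (Run ks s2 (d + Suc (K1 + K2))) m2 X c"
  have "saf I Q (Run ks s2 (Suc d + K1 + K2)) m2 X c" using a(3) by (simp add: ac_simps)
  from assms(1)[unfolded runs_def, rule_format, OF a(1,2) assms(2)[unfolded runs_def, rule_format, OF a(1,2) this]]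
  show "saf I Q (Run (Seq p q # ks) s d) m X (c + Suc (K1 + K2))"
    using safe_Seq[of I Q p q ks s d m X "c + (K2 + K1)"] by (simp add: ac_simps)
qed

lemma wp_Seq: "wp A p (\<lambda>K s' m'. wp A q (\<lambda>K'. Q (Suc (K + K'))) s' m') s m \<Longrightarrow> wp A (Seq p q) Q s m"
  unfolding wp_def using runs_Seq by meson

lemma runs_Cond:
  assumes "runs A (if bval w s b then p else q) s m K s' m'"
  shows "runs A (Cond b p q) s m (Suc K) s' m'"
  unfolding runs_def
proof (intro allI impI)
  fix I Q ks d X c
  assume a: "local_inv I" "A \<subseteq> X" "saf I Q (Run ks s' (d + Suc K)) m' X c"
  have "saf I Q (Run ks s' (Suc d + K)) m' X c" using a(3) by (simp add: ac_simps)
  from safe_Cond[OF assms[unfolded runs_def, rule_format, OF a(1,2) this]]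
  show "saf I Q (Run (Cond b p q # ks) s d) m X (c + Suc K)" by simp
qed

lemma wp_Cond: "wp A (if bval w s b then p else q) (\<lambda>K. Q (Suc K)) s m \<Longrightarrow> wp A (Cond b p q) Q s m"
  unfolding wp_def using runs_Cond by meson

lemma wp_While_false: "\<not> bval w s b \<Longrightarrow> Q 1 s m \<Longrightarrow> wp A (While b p) Q s m"
  by (rule wpI[where K = 1]) (auto simp: runs_def intro!: safe_While)

lemma runs_While_true:
  assumes "bval w s b" "runs A p s m K1 s1 m1" "runs A (While b p) s1 m1 K2 s2 m2"
  shows "runs A (While b p) s m (Suc (K1 + K2)) s2 m2"
  unfolding runs_def
proof (intro allI impI)
  fix I Q ks d X c
  assume a: "local_inv I" "A \<subseteq> X" "saf I Q (Run ks s2 (d + Suc (K1 + K2))) m2 X c"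
  have "saf I Q (Run ks s2 (Suc d + K1 + K2)) m2 X c" using a(3) by (simp add: ac_simps)
  from assms(2)[unfolded runs_def, rule_format, OF a(1,2) assms(3)[unfolded runs_def, rule_format, OF a(1,2) this]]
  show "saf I Q (Run (While b p # ks) s d) m X (c + Suc (K1 + K2))"
    using safe_While[of I Q s b p ks d m X "c + (K2 + K1)"] assms(1) by (simp add: ac_simps)
qed

lemma wp_While_true:
  "bval w s b \<Longrightarrow> wp A p (\<lambda>K s' m'. wp A (While b p) (\<lambda>K'. Q (Suc (K + K'))) s' m') s m \<Longrightarrow> wp A (While b p) Q s m"
  unfolding wp_def using runs_While_true by meson

lemma safe_wp:
  assumes "local_inv I" "wp A p (\<lambda>K s' m'. K \<le> c \<and> saf I Q (Run ks s' (d + K)) m' X (c - K)) s m" "A \<subseteq> X"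
  shows "saf I Q (Run (p # ks) s d) m X c"
proof -
  obtain K s' m' where *: "runs A p s m K s' m'" "K \<le> c" "saf I Q (Run ks s' (d + K)) m' X (c - K)"
    using assms(2) unfolding wp_def by blast
  from *(1)[unfolded runs_def, rule_format, OF assms(1,3) *(3)] *(2) show ?thesis by simp
qed

lemma safe_end:
  assumes "\<And>m'. agree X m m' \<Longrightarrow> m' ` X \<subseteq> {..W} \<Longrightarrow> Q s d m' X c"
  shows "saf I Q (Run [] s d) m X c"
proof (rule safeI)
  fix s' d' m'
  assume "m ` X \<subseteq> {..W}" "Run [] s d = Run [] s' d'" "agree X m m'"
  then show "Q s' d' m' X c" using assms[of m'] agree_image[of X m m'] by simp
qed (simp_all add: step_Nil)

section \<open>From safety to bounds on all executions\<close>

lemma safe_run: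
  assumes "saf emp Q t m UNIV c" "thread_words t \<subseteq> {..W}" "range m \<subseteq> {..W}" "(step prog w ^^ k) (t, m) (t', m')"
  shows "\<exists>c'. c' + k \<le> c \<and> saf emp Q t' m' UNIV c' \<and> thread_words t' \<subseteq> {..W} \<and> range m' \<subseteq> {..W}"
  using assms(4)
proof (induction k arbitrary: t' m')
  case 0
  then show ?case using assms by auto
next
  case (Suc k)
  then obtain t1 m1 where t1: "(step prog w ^^ k) (t, m) (t1, m1)" "step prog w (t1, m1) (t', m')"
    by auto
  then obtain c' where c': "c' + k \<le> c" "saf emp Q t1 m1 UNIV c'" "thread_words t1 \<subseteq> {..W}" "range m1 \<subseteq> {..W}"
    using Suc.IH by blast
  have "transfers W emp UNIV c' {} 0 m1 m' t' (saf emp Q t' m')"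
    by (rule safe_stepD[OF c'(2-4)]) (use t1 in \<open>auto simp: emp_def\<close>)
  then obtain X' c'' Y' e' where "X' \<union> Y' = UNIV" "c'' + e' < c' + 0" "range m' \<subseteq> {..W}" "thread_words t' \<subseteq> {..W}"
    "emp m' Y' e'" "saf emp Q t' m' X' c''" by (rule transfersE) simp
  moreover from this have "X' = UNIV" "e' = 0" by (auto simp: emp_def)
  ultimately show ?case using c'(1) by (intro exI[of _ c'']) auto
qed

lemma thread_depth_mono: "step prog w c c' \<Longrightarrow> depth c \<le> depth c'"
  by (induction rule: step.induct) (auto simp: depth_def)

text \<open>A postcondition bounds the depth of final states only. Since depth never decreases along
  a step, an arbitrary configuration is bounded by running it to an end, which exists because
  credits decrease.\<close>

lemma safe_terminates:
  assumes "saf emp Q t m UNIV c" "thread_words t \<subseteq> {..W}" "range m \<subseteq> {..W}"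
  shows "\<exists>s d m' c'. depth (t, m) \<le> d \<and> Q s d m' UNIV c'"
  using assms
proof (induction c arbitrary: t m rule: less_induct)
  case (less c)
  consider "finished (t, m)" | t' m' where "step prog w (t, m) (t', m')"
    using safe_progressD[OF less.prems(1,2), of m] less.prems(3) by (auto 0 0)
  then show ?case
  proof cases
    case 1
    then obtain s d where t: "t = Run [] s d" by (cases t) auto
    have "Q s d m UNIV c"
      by (rule safe_endD[OF less.prems(1)[unfolded t]]) (use less.prems t in auto)
    then show ?thesis unfolding t depth_def by auto
  next
    case 2
    then have "(step prog w ^^ 1) (t, m) (t', m')" unfolding relpowp_1 .
    from safe_run[OF less.prems this] obtain c' where c': "c' + 1 \<le> c"
      "saf emp Q t' m' UNIV c'" "thread_words t' \<subseteq> {..W}" "range m' \<subseteq> {..W}" by blast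
    have "c' < c" using c'(1) by simp
    from less.IH[OF this c'(2-4)] thread_depth_mono[OF 2] show ?thesis
      using order_trans by blast
  qed
qed

lemma safe_adequate:
  assumes "saf emp Q t m UNIV c" "thread_words t \<subseteq> {..W}" "range m \<subseteq> {..W}" "(step prog w ^^ k) (t, m) cfg"
  shows "k \<le> c" "\<exists>s d m' c'. depth cfg \<le> d \<and> Q s d m' UNIV c'" "config_words cfg \<subseteq> {..W}"
    "\<nexists>cfg'. step prog w cfg cfg' \<Longrightarrow> finished cfg \<and> (\<exists>s d c'. Q s d (snd cfg) UNIV c')"
proof -
  obtain t' m' where cfg: "cfg = (t', m')" by (cases cfg)
  obtain c' where c': "c' + k \<le> c" "saf emp Q t' m' UNIV c'" "thread_words t' \<subseteq> {..W}" "range m' \<subseteq> {..W}"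
    using safe_run[OF assms(1-3) assms(4)[unfolded cfg]] by blast
  show "k \<le> c" using c' by simp
  show "\<exists>s d m' c'. depth cfg \<le> d \<and> Q s d m' UNIV c'" unfolding cfg by (rule safe_terminates[OF c'(2-4)])
  show "config_words cfg \<subseteq> {..W}" using c' by (auto simp: config_words_def cfg)
  assume "\<nexists>cfg'. step prog w cfg cfg'"
  then have f: "finished (t', m')"
    using safe_progressD[OF c'(2,3), of m'] c'(4) cfg by auto
  then obtain s d where t: "t' = Run [] s d" by (cases t') auto
  have "Q s d m' UNIV c'"
    by (rule safe_endD[OF c'(2)[unfolded t]]) (use c' t in auto)
  then show "finished cfg \<and> (\<exists>s d c'. Q s d (snd cfg) UNIV c')" using f cfg by auto
qed

end

section \<open>Parallel loops by halving an index range\<close>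

definition par_for :: "nat \<Rightarrow> com \<Rightarrow> com" where
  "par_for j body =
     Cond (Less (Plus (Reg 1) (Lit 1)) (Reg 2))
       (Par (Seq (Assign 2 (Div (Plus (Reg 1) (Reg 2)) (Lit 2))) (Call j))
            (Seq (Assign 1 (Div (Plus (Reg 1) (Reg 2)) (Lit 2))) (Call j)))
       (Cond (Less (Reg 1) (Reg 2)) body Skip)"

text \<open>The parts \<open>F i\<close> are chosen existentially, because an iteration may end with
  other cells than it started with, such as a slot in place of an input cell.\<close>

definition split_post :: "nat \<Rightarrow> (nat \<Rightarrow> memory \<Rightarrow> nat set \<Rightarrow> bool) \<Rightarrow> nat set \<Rightarrow> nat \<Rightarrow> post" where
  "split_post n P J D s d m X c \<longleftrightarrow> s 0 = n \<and> d \<le> D \<and>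
     (\<exists>F. X = (\<Union>i\<in>J. F i) \<and> disjoint_family_on F J \<and> (\<forall>i\<in>J. P i m (F i)))"

text \<open>For a range of \<open>N > 0\<close> indices the overhead \<open>12 * N - 8\<close>
  consists of at most \<open>4\<close> for each of the \<open>N\<close> leaves of the recursion tree
  and \<open>8\<close> for each of its \<open>N - 1\<close> inner nodes: a call, a test, a fork, a
  join, and a sequence with an assignment in both halves. An empty range costs \<open>4\<close>. A
  level of the recursion adds at most \<open>8\<close> to the depth. The body may start in any
  memory that agrees with \<open>m\<close> on its own part, since other iterations may already have
  run.\<close>

lemma safe_par_for:
  assumes j: "j < length prog" "prog ! j = par_for j body"
    and P: "\<And>i m m' X. agree X m m' \<Longrightarrow> P i m X \<Longrightarrow> P i m' X"
    and body: "\<And>s d m0 i. i \<in> {lo..<hi} \<Longrightarrow> s 0 = n \<Longrightarrow> s 1 = i \<Longrightarrow> agree (X i) m m0 \<Longrightarrow>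
      safe prog w W I (\<lambda>s' d' m' X' c'. s' 0 = n \<and> d' \<le> d + D \<and> P i m' X') (Run [body] s d) m0 (X i) (cr i)"
    and "disjoint_family_on X {lo..<hi}" "hi \<le> W"
    and "hi - lo \<le> 2 ^ L" "lo \<le> hi" "s 0 = n" "s 1 = lo" "s 2 = hi" "agree (\<Union>i\<in>{lo..<hi}. X i) m m0"
    and "(\<Sum>i\<in>{lo..<hi}. cr i) + (if lo = hi then 4 else 12 * (hi - lo) - 8) \<le> c"
  shows "safe prog w W I (split_post n P {lo..<hi} (d + D + 8 * L + 5)) (Run [Call j] s d) m0 (\<Union>i\<in>{lo..<hi}. X i) c"
  using assms(4-)
proof (induction L arbitrary: lo hi s d c m0)
  case (0 lo hi s d c m0)
  have le: "hi \<le> Suc lo" using 0 by simp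
  show ?case
  proof (cases "lo = hi")
    case True
    have "safe prog w W I (split_post n P {lo..<hi} (d + D + 8 * 0 + 5)) (Run [] s (Suc (Suc (Suc (Suc d))))) m0
            (\<Union>i\<in>{lo..<hi}. X i) (c - 4)"
      by (rule safe_end) (use 0 True in \<open>auto simp: split_post_def disjoint_family_on_def\<close>)
    from safe_Skip[OF this]
    have "safe prog w W I (split_post n P {lo..<hi} (d + D + 8 * 0 + 5)) (Run [Call j] s d) m0
            (\<Union>i\<in>{lo..<hi}. X i) (Suc (Suc (Suc (Suc (c - 4)))))"
      using True 0 by (intro safe_Call[OF j(1)]) (simp add: j par_for_def safe_Cond)
    moreover have "Suc (Suc (Suc (Suc (c - 4)))) = c" using 0 True by simp
    ultimately show ?thesis by simp
  next
    case False
    then have hi: "hi = Suc lo" using le 0 by simp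
    have eq: "(\<Union>i\<in>{lo..<hi}. X i) = X lo" by (simp add: hi)
    have "safe prog w W I (\<lambda>s' d' m' X' c'. s' 0 = n \<and> d' \<le> Suc (Suc (Suc d)) + D \<and> P lo m' X')
      (Run [body] s (Suc (Suc (Suc d)))) m0 (X lo) (cr lo)"
      using 0 hi by (intro 0(1)) auto
    then have "safe prog w W I (split_post n P {lo..<hi} (d + D + 8 * 0 + 5))
      (Run [body] s (Suc (Suc (Suc d)))) m0 (X lo) (cr lo)"
    proof (rule safe_conseq)
      fix s :: regs and d' m X' c
      assume "s 0 = n \<and> d' \<le> Suc (Suc (Suc d)) + D \<and> P lo m X'"
      then show "split_post n P {lo..<hi} (d + D + 8 * 0 + 5) s d' m X' c"
        unfolding split_post_def by (auto simp: hi disjoint_family_on_def intro!: exI[of _ "\<lambda>_. X'"])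
    qed
    then have "safe prog w W I (split_post n P {lo..<hi} (d + D + 8 * 0 + 5))
      (Run [body] s (Suc (Suc (Suc d)))) m0 (X lo) (c - 3)"
      by (rule safe_more_credits) (use 0 hi in \<open>auto simp: split_post_def\<close>)
    then have "safe prog w W I (split_post n P {lo..<hi} (d + D + 8 * 0 + 5)) (Run [Call j] s d) m0
            (\<Union>i\<in>{lo..<hi}. X i) (Suc (Suc (Suc (c - 3))))"
      using hi 0 unfolding eq
      by (intro safe_Call[OF j(1)]) (simp add: j par_for_def safe_Cond)
    moreover have "Suc (Suc (Suc (c - 3))) = c" using 0 hi by simp
    ultimately show ?thesis by simp
  qed
next
  case (Suc L lo hi s d c m0)
  show ?case
  proof (cases "Suc lo < hi")
    case False
    have "hi - lo \<le> 2 ^ L" using False by (metis One_nat_def diff_le_self le_diff_conv linorder_not_less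
          one_le_numeral one_le_power order_trans plus_1_eq_Suc)
    from Suc.IH[OF Suc.prems(1) Suc.prems(2,3) this Suc.prems(5-10)]
    show ?thesis by (rule safe_conseq) (auto simp: split_post_def)
  next
    case True
    define mid where "mid = (lo + hi) div 2"
    have mid: "lo < mid" "mid < hi" "mid - lo \<le> 2 ^ L" "hi - mid \<le> 2 ^ L"
      using True Suc.prems(4) unfolding mid_def by auto
    have un: "{lo..<hi} = {lo..<mid} \<union> {mid..<hi}" using mid by auto
    define c1 where "c1 = (\<Sum>i\<in>{lo..<mid}. cr i) + (12 * (mid - lo) - 8)"
    define c2 where "c2 = (\<Sum>i\<in>{mid..<hi}. cr i) + (12 * (hi - mid) - 8)"
    have "(\<Sum>i\<in>{lo..<hi}. cr i) = (\<Sum>i\<in>{lo..<mid}. cr i) + (\<Sum>i\<in>{mid..<hi}. cr i)"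
      using mid by (simp add: sum.atLeastLessThan_concat)
    then have c: "Suc (c1 + 2 + (c2 + 2)) \<le> c - 3" "c \<ge> 3"
      using Suc.prems(10) mid unfolding c1_def c2_def by auto
    have dis: "disjoint_family_on X {lo..<mid}" "disjoint_family_on X {mid..<hi}"
      by (rule disjoint_family_on_mono[OF _ Suc.prems(2)]; use mid in force)+
    have disX: "(\<Union>i\<in>{lo..<mid}. X i) \<inter> (\<Union>i\<in>{mid..<hi}. X i) = {}"
    proof (rule ccontr)
      assume "(\<Union>i\<in>{lo..<mid}. X i) \<inter> (\<Union>i\<in>{mid..<hi}. X i) \<noteq> {}"
      then obtain x i i' where "i \<in> {lo..<mid}" "i' \<in> {mid..<hi}" "x \<in> X i" "x \<in> X i'" by blast
      then show False using disjoint_family_onD[OF Suc.prems(2), of i i'] un by auto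
    qed
    have ag: "agree (\<Union>i\<in>{lo..<mid}. X i) m m0" "agree (\<Union>i\<in>{mid..<hi}. X i) m m0"
      by (rule agree_mono[OF Suc.prems(9)]; use un in blast)+
    let ?D = "d + 5 + D + 8 * L + 5"
    have 1: "safe prog w W I (split_post n P {lo..<mid} ?D) (Run [Call j] (s(2 := mid)) (d + 5)) m0 (\<Union>i\<in>{lo..<mid}. X i) c1"
    proof (rule Suc.IH[OF _ dis(1) _ _ _ _ _ _ ag(1)])
      fix s d m0 i
      assume "i \<in> {lo..<mid}" "s (0 :: nat) = n" "s 1 = i" "agree (X i) m m0"
      then show "safe prog w W I (\<lambda>s' d' m' X' c'. s' 0 = n \<and> d' \<le> d + D \<and> P i m' X') (Run [body] s d) m0 (X i) (cr i)"
        using mid by (intro Suc.prems(1)) auto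
    qed (use Suc.prems(3-8) mid in \<open>simp_all add: c1_def\<close>)
    have 2: "safe prog w W I (split_post n P {mid..<hi} ?D) (Run [Call j] (s(1 := mid)) (d + 5)) m0 (\<Union>i\<in>{mid..<hi}. X i) c2"
    proof (rule Suc.IH[OF _ dis(2) _ _ _ _ _ _ ag(2)])
      fix s d m0 i
      assume "i \<in> {mid..<hi}" "s (0 :: nat) = n" "s 1 = i" "agree (X i) m m0"
      then show "safe prog w W I (\<lambda>s' d' m' X' c'. s' 0 = n \<and> d' \<le> d + D \<and> P i m' X') (Run [body] s d) m0 (X i) (cr i)"
        using mid by (intro Suc.prems(1)) auto
    qed (use Suc.prems(3-8) mid in \<open>simp_all add: c2_def\<close>)
    have mW: "mid \<le> W" using mid Suc.prems(3) by simp
    have av: "aval s (Div (Plus (Reg 1) (Reg 2)) (Lit 2)) = mid" using Suc.prems by (simp add: mid_def)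
    let ?mid = "Div (Plus (Reg 1) (Reg 2)) (Lit 2)"
    have 11: "safe prog w W I (split_post n P {lo..<mid} ?D) (Run [Seq (Assign 2 ?mid) (Call j)] s (Suc (Suc (Suc d)))) m0
        (\<Union>i\<in>{lo..<mid}. X i) (c1 + 2)"
      by (rule safe_Assign_Seq) (use 1 av mW in \<open>simp_all add: numeral_eq_Suc\<close>)
    have 22: "safe prog w W I (split_post n P {mid..<hi} ?D) (Run [Seq (Assign 1 ?mid) (Call j)] s (Suc (Suc (Suc d)))) m0
        (\<Union>i\<in>{mid..<hi}. X i) (c2 + 2)"
      by (rule safe_Assign_Seq) (use 2 av mW in \<open>simp_all add: numeral_eq_Suc\<close>)
    have "safe prog w W I (split_post n P {lo..<hi} (d + D + 8 * Suc L + 5))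
       (Join (Run [Seq (Assign 2 (Div (Plus (Reg 1) (Reg 2)) (Lit 2))) (Call j)] s (Suc (Suc (Suc d))))
             (Run [Seq (Assign 1 (Div (Plus (Reg 1) (Reg 2)) (Lit 2))) (Call j)] s (Suc (Suc (Suc d)))) [] s)
       m0 ((\<Union>i\<in>{lo..<mid}. X i) \<union> (\<Union>i\<in>{mid..<hi}. X i)) (c - 3)"
    proof (rule safe_join[OF 11 22 disX agree_refl agree_refl c(1)])
      fix s1 d1 X1 c1 s2 d2 X2 c2 m c
      assume q: "split_post n P {lo..<mid} ?D s1 d1 m X1 c1" "split_post n P {mid..<hi} ?D s2 d2 m X2 c2"
        "X1 \<inter> X2 = {}"
      show "safe prog w W I (split_post n P {lo..<hi} (d + D + 8 * Suc L + 5)) (Run [] s (Suc (max d1 d2))) m (X1 \<union> X2) c"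
      proof (rule safe_bounded, rule safeI)
        fix s' d' m'
        assume "Run [] s (Suc (max d1 d2)) = Run [] s' d'" and a: "agree (X1 \<union> X2) m m'"
        then have s': "s' = s" "d' = Suc (max d1 d2)" by auto
        show "split_post n P {lo..<hi} (d + D + 8 * Suc L + 5) s' d' m' (X1 \<union> X2) c"
        proof -
          obtain F1 where F1: "X1 = (\<Union>i\<in>{lo..<mid}. F1 i)" "disjoint_family_on F1 {lo..<mid}"
              "\<forall>i\<in>{lo..<mid}. P i m (F1 i)" and d1: "d1 \<le> ?D"
            using q(1) unfolding split_post_def by blast
          obtain F2 where F2: "X2 = (\<Union>i\<in>{mid..<hi}. F2 i)" "disjoint_family_on F2 {mid..<hi}"
              "\<forall>i\<in>{mid..<hi}. P i m (F2 i)" and d2: "d2 \<le> ?D"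
            using q(2) unfolding split_post_def by blast
          define F where "F i = (if i < mid then F1 i else F2 i)" for i
          have F: "F i = F1 i" if "i \<in> {lo..<mid}" for i using that by (simp add: F_def)
          have F': "F i = F2 i" if "i \<in> {mid..<hi}" for i using that by (simp add: F_def)
          have "X1 \<union> X2 = (\<Union>i\<in>{lo..<hi}. F i)"
            unfolding un UN_Un F1(1) F2(1) using F F' by (intro arg_cong2[of _ _ _ _ "(\<union>)"] SUP_cong) auto
          moreover have "disjoint_family_on F {lo..<hi}"
            unfolding disjoint_family_on_def
          proof (intro ballI impI)
            fix x y assume xy: "x \<in> {lo..<hi}" "y \<in> {lo..<hi}" "x \<noteq> y"
            consider "x \<in> {lo..<mid}" "y \<in> {lo..<mid}" | "x \<in> {mid..<hi}" "y \<in> {mid..<hi}"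
              | "x \<in> {lo..<mid}" "y \<in> {mid..<hi}" | "x \<in> {mid..<hi}" "y \<in> {lo..<mid}"
              using xy un by blast
            then show "F x \<inter> F y = {}"
            proof cases
              case 1 then show ?thesis using F F1(2) xy(3) unfolding disjoint_family_on_def by simp
            next
              case 2 then show ?thesis using F' F2(2) xy(3) unfolding disjoint_family_on_def by simp
            next
              case 3 then show ?thesis using F F' q(3) unfolding F1(1) F2(1) by blast
            next
              case 4 then show ?thesis using F F' q(3) unfolding F1(1) F2(1) by blast
            qed
          qed
          moreover have "P i m' (F i)" if i: "i \<in> {lo..<hi}" for i
          proof (rule P)
            show "P i m (F i)" using i F1(3) F2(3) F F' unfolding un by auto
            have "F i \<subseteq> X1 \<union> X2" using i F F' unfolding F1(1) F2(1) un by auto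
            then show "agree (F i) m m'" using a agree_mono by blast
          qed
          ultimately show ?thesis
            using d1 d2 Suc.prems(6) unfolding split_post_def s' by (intro conjI exI[of _ F]) auto
        qed
      qed (simp_all add: step_Nil)
    qed
    from safe_Fork[OF this]
    have "safe prog w W I (split_post n P {lo..<hi} (d + D + 8 * Suc L + 5)) (Run [Call j] s d) m0
            (\<Union>i\<in>{lo..<hi}. X i) (Suc (Suc (Suc (c - 3))))"
      using True Suc.prems by (intro safe_Call[OF j(1)]) (simp add: j par_for_def safe_Cond un UN_Un)
    moreover have "Suc (Suc (Suc (c - 3))) = c" using c(2) by simp
    ultimately show ?thesis by simp
  qed
qed

section \<open>Single-linkage dendrograms as components\<close>

lemma precedes_irrefl: "\<not> precedes es e e"
  by (simp add: precedes_def)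

lemma precedes_trans: "precedes es e f \<Longrightarrow> precedes es f g \<Longrightarrow> precedes es e g"
  by (auto simp: precedes_def)

lemma precedes_total: "e \<noteq> f \<Longrightarrow> precedes es e f \<or> precedes es f e"
  by (auto simp: precedes_def)

lemma rank_less_iff:
  assumes "e < length es" "f < length es"
  shows "rank es e < rank es f \<longleftrightarrow> precedes es e f"
proof -
  have mono: "rank es e < rank es f" if "precedes es e f" "e < length es" for e f
    unfolding rank_def
  proof (rule psubset_card_mono)
    show "{g. g < length es \<and> precedes es g e} \<subset> {g. g < length es \<and> precedes es g f}"
      using that precedes_trans precedes_irrefl by blast
  qed simp
  show ?thesis
    using mono[of e f] mono[of f e] assms precedes_total[of e f es] by (cases "e = f") auto
qed

lemma rank_less_length: "e < length es \<Longrightarrow> rank es e < length es"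
proof -
  assume e: "e < length es"
  have "{f. f < length es \<and> precedes es f e} \<subset> {..<length es}"
    using e precedes_irrefl[of es e] by auto
  from psubset_card_mono[OF _ this] show ?thesis by (simp add: rank_def)
qed

lemma rank_inj: "e < length es \<Longrightarrow> f < length es \<Longrightarrow> rank es e = rank es f \<Longrightarrow> e = f"
  using rank_less_iff[of e es f] rank_less_iff[of f es e] precedes_total[of e f es] by auto

lemma map_rank_ranked: "map (rank es) (ranked es) = [0..<length es]"
proof (rule sorted_distinct_set_unique)
  show "sorted (map (rank es) (ranked es))" by (simp add: ranked_def)
next
  have inj: "inj_on (rank es) {0..<length es}" by (rule inj_onI, rule rank_inj[of _ es]) simp_all
  show "distinct (map (rank es) (ranked es))"
    using inj by (simp add: ranked_def distinct_map)
  have "rank es ` {0..<length es} = {0..<length es}"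
    by (rule endo_inj_surj[OF _ _ inj]) (use rank_less_length[of _ es] in auto)
  then show "set (map (rank es) (ranked es)) = set [0..<length es]"
    by (simp add: ranked_def)
qed simp_all

lemma length_ranked [simp]: "length (ranked es) = length es"
  by (simp add: ranked_def)

lemma ranked_nth:
  assumes "i < length es"
  shows "ranked es ! i < length es" "rank es (ranked es ! i) = i"
proof -
  have "ranked es ! i \<in> set (ranked es)" using assms by simp
  then show "ranked es ! i < length es" by (simp add: ranked_def)
  have "map (rank es) (ranked es) ! i = i" using assms by (simp add: map_rank_ranked)
  then show "rank es (ranked es ! i) = i" using assms by simp
qed

lemma ranked_rank: "e < length es \<Longrightarrow> ranked es ! rank es e = e"
  using ranked_nth[OF rank_less_length] rank_inj by blast

text \<open>A walk that returns to a vertex is cut back to the first visit. Simplicity is needed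
  because \<open>is_cycle\<close> asks for distinct vertices.\<close>

lemma rtranclp_simple_path:
  assumes "R\<^sup>*\<^sup>* a b"
  shows "\<exists>xs. xs \<noteq> [] \<and> hd xs = a \<and> last xs = b \<and> distinct xs \<and> (\<forall>k. Suc k < length xs \<longrightarrow> R (xs ! k) (xs ! Suc k))"
  using assms
proof (induction rule: rtranclp_induct)
  case base
  show ?case by (rule exI[of _ "[a]"]) simp
next
  case (step y z)
  then obtain xs where xs: "xs \<noteq> []" "hd xs = a" "last xs = y" "distinct xs"
    "\<And>k. Suc k < length xs \<Longrightarrow> R (xs ! k) (xs ! Suc k)" by blast
  show ?case
  proof (cases "z \<in> set xs")
    case True
    then obtain j where j: "j < length xs" "xs ! j = z" by (meson in_set_conv_nth)
    have "last (take (Suc j) xs) = z" using j by (simp add: take_Suc_conv_app_nth)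
    then show ?thesis using xs j by (intro exI[of _ "take (Suc j) xs"]) (simp add: hd_take)
  next
    case False
    have "R ((xs @ [z]) ! k) ((xs @ [z]) ! Suc k)" if "Suc k < length (xs @ [z])" for k
    proof (cases "Suc k < length xs")
      case True
      then show ?thesis using xs(5)[of k] by (simp add: nth_append)
    next
      case False
      then have "k = length xs - 1" "Suc k = length xs" using that xs(1) by auto
      then show ?thesis using step(2) xs(1,3) by (simp add: nth_append last_conv_nth)
    qed
    then show ?thesis using xs False by (intro exI[of _ "xs @ [z]"]) simp
  qed
qed

text \<open>\<open>linked es i\<close> and \<open>component es i x\<close> are adjacency and components in the forest of the \<open>i\<close> edges of smallest rank.\<close>

definition linked :: "edge_list \<Rightarrow> nat \<Rightarrow> nat \<Rightarrow> nat \<Rightarrow> bool" where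
  "linked es i x y \<longleftrightarrow> (\<exists>e. joins es e x y \<and> rank es e < i)"

definition component :: "edge_list \<Rightarrow> nat \<Rightarrow> nat \<Rightarrow> nat set" where
  "component es i x = {y. (linked es i)\<^sup>*\<^sup>* x y}"

lemma linked_sym: "linked es i x y \<Longrightarrow> linked es i y x"
  by (auto simp: linked_def joins_def)

lemma component_self [simp]: "x \<in> component es i x"
  by (simp add: component_def)

lemma component_sym: "y \<in> component es i x \<Longrightarrow> x \<in> component es i y"
  using symp_rtranclp[OF sympI[of "linked es i"]] linked_sym by (auto simp: component_def dest: sympD)

lemma component_trans: "y \<in> component es i x \<Longrightarrow> z \<in> component es i y \<Longrightarrow> z \<in> component es i x"
  by (auto simp: component_def)

lemma component_eq: "y \<in> component es i x \<Longrightarrow> component es i y = component es i x"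
  using component_sym component_trans by blast

lemma component_linked: "y \<in> component es i x \<Longrightarrow> linked es i y z \<Longrightarrow> z \<in> component es i x"
  by (auto simp: component_def)

lemma component_least: "x \<in> S \<Longrightarrow> (\<And>y z. y \<in> S \<Longrightarrow> linked es i y z \<Longrightarrow> z \<in> S) \<Longrightarrow> component es i x \<subseteq> S"
proof
  fix y assume S: "x \<in> S" "\<And>y z. y \<in> S \<Longrightarrow> linked es i y z \<Longrightarrow> z \<in> S" and "y \<in> component es i x"
  then have "(linked es i)\<^sup>*\<^sup>* x y" by (simp add: component_def)
  then show "y \<in> S" by (induction rule: rtranclp_induct) (use S in auto)
qed

lemma component_mono: "i \<le> j \<Longrightarrow> component es i x \<subseteq> component es j x"
  by (rule component_least[OF component_self], erule component_linked) (auto simp: linked_def)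

lemma component_edge:
  assumes "e < length es" "rank es e < i"
  shows "end1 es e \<in> component es i x \<longleftrightarrow> end2 es e \<in> component es i x"
proof -
  have "linked es i (end1 es e) (end2 es e)" using assms by (auto simp: linked_def joins_def)
  then show ?thesis using component_linked linked_sym by blast
qed

lemma component_0: "component es 0 x = {x}"
  by (rule equalityI[OF component_least]) (auto simp: linked_def)

text \<open>The counterpart of processing one edge: the edge of rank \<open>i\<close> is the only
  new adjacency (\<open>step\<close>), so it fuses the components of its two ends and leaves the
  others alone.\<close>

lemma component_Suc:
  assumes "i < length es"
  defines "U \<equiv> component es i (end1 es (ranked es ! i)) \<union> component es i (end2 es (ranked es ! i))"
  shows "component es (Suc i) x = (if x \<in> U then U else component es i x)"
proof -
  let ?e = "ranked es ! i"
  note e = ranked_nth[OF assms(1)]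
  have step: "linked es i y z \<or> y = end1 es ?e \<and> z = end2 es ?e \<or> y = end2 es ?e \<and> z = end1 es ?e"
    if l: "linked es (Suc i) y z" for y z
  proof -
    obtain g where g: "joins es g y z" "rank es g < Suc i" using l unfolding linked_def by blast
    show ?thesis
    proof (cases "rank es g < i")
      case False
      then have "rank es g = rank es ?e" using g e by simp
      then have "g = ?e" using rank_inj e g(1) by (auto simp: joins_def)
      then show ?thesis using g(1) by (auto simp: joins_def)
    qed (use g in \<open>auto simp: linked_def\<close>)
  qed
  have U1: "U \<subseteq> component es (Suc i) (end1 es ?e)"
    using component_mono[of i "Suc i" es] component_edge[OF e(1), of "Suc i" "end1 es ?e"] e(2) component_eq[of _ es "Suc i"]
    unfolding U_def by (metis Un_least component_self lessI less_imp_le_nat)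
  show ?thesis
  proof (cases "x \<in> U")
    case True
    have "component es (Suc i) x \<subseteq> U"
      by (rule component_least[OF True]) (use step component_linked in \<open>unfold U_def, blast intro: component_self\<close>)
    moreover have "U \<subseteq> component es (Suc i) x" using U1 True component_eq by blast
    ultimately show ?thesis using True by auto
  next
    case False
    have "component es (Suc i) x \<subseteq> component es i x"
    proof (rule component_least[OF component_self])
      fix y z assume y: "y \<in> component es i x" "linked es (Suc i) y z"
      have "y \<noteq> end1 es ?e" "y \<noteq> end2 es ?e" using False component_sym[OF y(1)] unfolding U_def by auto
      then show "z \<in> component es i x" using step[OF y(2)] component_linked[OF y(1)] by blast
    qed
    then show ?thesis using False component_mono[of i "Suc i" es x] by auto
  qed
qed

section \<open>The clusters of the defining process as components\<close>

locale weighted_tree_input =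
  fixes n :: nat and es :: edge_list
  assumes wt: "weighted_tree n es"
begin

lemma n_pos: "n \<ge> 1"
  and ends: "e < length es \<Longrightarrow> end1 es e < n" "e < length es \<Longrightarrow> end2 es e < n"
  and conn: "connected_graph n es"
  and no_cycle: "\<not> is_cycle es xs fs"
  using wt by (auto simp: weighted_tree_def)

lemma component_subset: "x < n \<Longrightarrow> component es i x \<subseteq> {..<n}"
  by (rule component_least) (auto simp: linked_def joins_def ends)

text \<open>A simple path between the ends of \<open>e\<close> through edges of rank below
  \<open>i\<close> does not use \<open>e\<close>, so \<open>e\<close> closes it to a cycle. A path
  of one vertex covers self-loops.\<close>

lemma acyclic:
  assumes "e < length es" "i \<le> rank es e"
  shows "end2 es e \<notin> component es i (end1 es e)"
proof
  assume "end2 es e \<in> component es i (end1 es e)"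
  then obtain xs where xs: "xs \<noteq> []" "hd xs = end1 es e" "last xs = end2 es e" "distinct xs"
    "\<And>k. Suc k < length xs \<Longrightarrow> linked es i (xs ! k) (xs ! Suc k)"
    using rtranclp_simple_path[of "linked es i" "end1 es e" "end2 es e"] by (auto simp: component_def)
  then obtain g where g: "\<And>k. Suc k < length xs \<Longrightarrow> joins es (g k) (xs ! k) (xs ! Suc k) \<and> rank es (g k) < i"
    unfolding linked_def by metis
  define fs where "fs = map g [0..<length xs - 1] @ [e]"
  \<comment> \<open>One edge used at two positions would put \<open>xs ! k\<close> at a later
    position as well, against distinctness of \<open>xs\<close>.\<close>
  have inj: "g k \<noteq> g l" if "k < l" "Suc l < length xs" for k l
  proof
    assume "g k = g l"
    then have "joins es (g l) (xs ! k) (xs ! Suc k)" "joins es (g l) (xs ! l) (xs ! Suc l)"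
      using g[of k] g[of l] that by auto
    then have "xs ! k = xs ! l \<or> xs ! k = xs ! Suc l" by (auto simp: joins_def)
    then show False using that xs(4) by (auto simp: nth_eq_iff_index_eq)
  qed
  have "inj_on g {0..<length xs - 1}"
  proof (rule inj_onI)
    fix k l assume "k \<in> {0..<length xs - 1}" "l \<in> {0..<length xs - 1}" "g k = g l"
    then show "k = l" using inj[of k l] inj[of l k] by (cases k l rule: linorder_cases) (auto simp: less_diff_conv)
  qed
  moreover have "e \<notin> g ` {0..<length xs - 1}"
  proof
    assume "e \<in> g ` {0..<length xs - 1}"
    then obtain k where "k < length xs - 1" "e = g k" by auto
    then show False using g[of k] assms(2) by (auto simp: less_diff_conv)
  qed
  ultimately have "distinct fs" by (simp add: fs_def distinct_map)
  moreover have "joins es (fs ! k) (xs ! k) (xs ! (Suc k mod length xs))" if "k < length xs" for k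
  proof (cases "Suc k < length xs")
    case True
    then show ?thesis using g[of k] by (simp add: fs_def nth_append less_diff_conv)
  next
    case False
    then have k: "k = length xs - 1" "Suc k = length xs" using that by auto
    have "fs ! k = e" by (simp add: fs_def nth_append k(1))
    moreover have "xs ! k = end2 es e" "xs ! 0 = end1 es e"
      using xs(1-3) k(1) by (simp_all add: last_conv_nth hd_conv_nth)
    ultimately show ?thesis using assms(1) by (simp add: k(2) joins_def)
  qed
  moreover have "length fs = length xs" using xs(1) by (simp add: fs_def)
  ultimately have "is_cycle es xs fs" using xs by (simp add: is_cycle_def)
  then show False using no_cycle by blast
qed

lemma no_loop: "e < length es \<Longrightarrow> end1 es e \<noteq> end2 es e"
  using acyclic[of e 0] by (auto simp: component_0)

lemma cluster_of_comp: "v < n \<Longrightarrow> cluster_of (component es i ` {..<n}) v = component es i v"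
  unfolding cluster_of_def by (rule the_equality) (use component_eq in auto)

lemma process_edge_comp:
  assumes "i < length es"
  shows "process_edge es (ranked es ! i) (component es i ` {..<n}) = component es (Suc i) ` {..<n}"
proof -
  let ?A = "component es i (end1 es (ranked es ! i))" and ?B = "component es i (end2 es (ranked es ! i))"
  note e = ends[OF ranked_nth(1)[OF assms]]
  have "insert (?A \<union> ?B) (component es i ` {..<n} - {?A, ?B}) = component es (Suc i) ` {..<n}" (is "?l = ?r")
  proof
    show "?l \<subseteq> ?r"
    proof
      fix C assume "C \<in> ?l"
      then consider "C = ?A \<union> ?B" | x where "x < n" "C = component es i x" "C \<noteq> ?A" "C \<noteq> ?B" by blast
      then show "C \<in> ?r"
      proof cases
        case 1
        then show ?thesis using e(1) component_Suc[OF assms, of "end1 es (ranked es ! i)"]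
          by (intro image_eqI[of _ _ "end1 es (ranked es ! i)"]) auto
      next
        case 2
        then have "x \<notin> ?A \<union> ?B" using component_eq by blast
        then show ?thesis using 2 component_Suc[OF assms, of x] by (intro image_eqI[of _ _ x]) auto
      qed
    qed
    show "?r \<subseteq> ?l"
    proof
      fix C assume "C \<in> ?r"
      then obtain x where x: "x < n" "C = component es (Suc i) x" by blast
      then show "C \<in> ?l"
      proof (cases "x \<in> ?A \<union> ?B")
        case True
        then show ?thesis using x component_Suc[OF assms, of x] by simp
      next
        case False
        then have "C = component es i x" using x component_Suc[OF assms, of x] by simp
        moreover have "C \<noteq> ?A" "C \<noteq> ?B" using False calculation component_self[of x es i] by blast+
        ultimately show ?thesis using x by blast
      qed
    qed
  qed
  then show ?thesis using e by (simp add: process_edge_def Let_def cluster_of_comp)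
qed

lemma clusters_comp: "i \<le> length es \<Longrightarrow> clusters n es i = component es i ` {..<n}"
proof (induction i)
  case 0
  have "component es 0 = (\<lambda>v. {v})" by (simp add: fun_eq_iff component_0)
  then show ?case by (simp add: clusters_def)
next
  case (Suc i)
  then have "clusters n es (Suc i) = process_edge es (ranked es ! i) (clusters n es i)"
    by (simp add: clusters_def take_Suc_conv_app_nth)
  then show ?case using Suc process_edge_comp[of i] by simp
qed

lemma component_full:
  assumes "x < n" "\<And>e. e < length es \<Longrightarrow> end1 es e \<in> C \<longleftrightarrow> end2 es e \<in> C" "x \<in> C" "C \<subseteq> {..<n}"
  shows "C = {..<n}"
proof
  show "{..<n} \<subseteq> C"
  proof
    fix y assume "y \<in> {..<n}"
    then have "(\<lambda>x y. \<exists>e. joins es e x y)\<^sup>*\<^sup>* x y" using conn assms(1) by (simp add: connected_graph_def)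
    then show "y \<in> C"
      by (induction rule: rtranclp_induct) (use assms(2,3) in \<open>auto simp: joins_def\<close>)
  qed
qed (rule assms(4))

text \<open>By acyclicity every processed edge merges two different clusters, so their number drops
  by exactly one each time. Taken to the end this yields the edge count of a tree, from which a
  program that is given only \<open>n\<close> can locate the output cells.\<close>

lemma card_clusters: "i \<le> length es \<Longrightarrow> card (component es i ` {..<n}) + i = n"
proof (induction i)
  case 0
  have "component es 0 = (\<lambda>v. {v})" by (simp add: fun_eq_iff component_0)
  then show ?case by (simp add: card_image)
next
  case (Suc i)
  then have i: "i < length es" by simp
  let ?P = "component es i ` {..<n}"
  let ?A = "component es i (end1 es (ranked es ! i))" and ?B = "component es i (end2 es (ranked es ! i))"
  note e = ranked_nth[OF i]
  have AB: "?A \<in> ?P" "?B \<in> ?P" using ends[OF e(1)] by auto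
  have "end2 es (ranked es ! i) \<notin> ?A" by (rule acyclic) (use e in auto)
  then have ne: "?A \<noteq> ?B" by auto
  have "?A \<union> ?B \<notin> ?P - {?A, ?B}"
  proof
    assume *: "?A \<union> ?B \<in> ?P - {?A, ?B}"
    then obtain x where x: "?A \<union> ?B = component es i x" by blast
    have "end1 es (ranked es ! i) \<in> component es i x" unfolding x[symmetric] by simp
    then have "?A \<union> ?B = ?A" using component_eq x by simp
    then show False using * by simp
  qed
  moreover have "component es (Suc i) ` {..<n} = insert (?A \<union> ?B) (?P - {?A, ?B})"
    using process_edge_comp[OF i] ends[OF e(1)] by (simp add: process_edge_def Let_def cluster_of_comp)
  ultimately have "card (component es (Suc i) ` {..<n}) = Suc (card (?P - {?A, ?B}))" by simp
  moreover have "card {?A, ?B} = 2" using ne by simp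
  moreover have "card {?A, ?B} \<le> card ?P" by (rule card_mono) (use AB in simp_all)
  ultimately have "card (component es (Suc i) ` {..<n}) = Suc (card ?P - 2)" "2 \<le> card ?P"
    using AB by (simp_all add: card_Diff_subset)
  then show ?case using Suc.IH i by simp
qed

lemma Suc_length: "Suc (length es) = n"
proof -
  have "component es (length es) ` {..<n} = {{..<n}}"
  proof -
    have "component es (length es) x = {..<n}" if "x < n" for x
      using that component_edge rank_less_length component_subset by (intro component_full[of x]) auto
    then have "component es (length es) ` {..<n} = (\<lambda>_. {..<n}) ` {..<n}" by (intro image_cong) auto
    then show ?thesis using n_pos by (simp add: image_constant_conv lessThan_empty_iff)
  qed
  then show ?thesis using card_clusters[of "length es"] by simp
qed

section \<open>Dendrogram nodes, their clusters and the edges leaving them\<close>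

fun valid_node :: "sld_node \<Rightarrow> bool" where
  "valid_node (Vertex v) = (v < n)"
| "valid_node (Edge e) = (e < length es)"

fun node_rep :: "sld_node \<Rightarrow> nat" where
  "node_rep (Vertex v) = v"
| "node_rep (Edge e) = end1 es e"

abbreviation "cl \<equiv> node_cluster n es"

lemma node_rep_less: "valid_node x \<Longrightarrow> node_rep x < n"
  by (cases x) (auto simp: ends)

lemma node_cluster_comp: "valid_node x \<Longrightarrow> cl x = component es (created es x) (node_rep x)"
proof (cases x)
  case (Vertex v)
  then show ?thesis by (simp add: component_0)
next
  case (Edge e)
  moreover assume "valid_node x"
  ultimately show ?thesis
    using clusters_comp[of "Suc (rank es e)"] rank_less_length[of e es] ends(1)[of e]
    by (simp add: cluster_of_comp Suc_le_eq)
qed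

definition boundary :: "nat set \<Rightarrow> nat set" where
  "boundary C = {g. g < length es \<and> (end1 es g \<in> C) \<noteq> (end2 es g \<in> C)}"

lemma boundary_rank: "g \<in> boundary (component es i x) \<Longrightarrow> i \<le> rank es g"
  using component_edge[of g es i x] by (auto simp: boundary_def not_le[symmetric])

lemma component_stable:
  assumes "i \<le> j" "\<And>g. g \<in> boundary (component es i x) \<Longrightarrow> j \<le> rank es g"
  shows "component es j x = component es i x"
proof
  show "component es j x \<subseteq> component es i x"
  proof (rule component_least[OF component_self])
    fix y z assume y: "y \<in> component es i x" "linked es j y z"
    then obtain g where g: "joins es g y z" "rank es g < j" by (auto simp: linked_def)
    then have "g \<notin> boundary (component es i x)" using assms(2)[of g] by auto
    then show "z \<in> component es i x" using g(1) y(1) by (auto simp: boundary_def joins_def)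
  qed
qed (rule component_mono[OF assms(1)])

lemma merged_at_boundary:
  assumes "valid_node x" "created es x \<le> j" "merged_at n es (cl x) j"
  shows "ranked es ! j \<in> boundary (cl x)"
proof -
  let ?g = "ranked es ! j"
  have j: "j < length es" using assms(3) by (simp add: merged_at_def)
  note g = ranked_nth[OF j]
  have "clusters n es j = component es j ` {..<n}" using clusters_comp j by simp
  then have "cl x = component es j (end1 es ?g) \<or> cl x = component es j (end2 es ?g)"
    using assms(3) ends[OF g(1)] by (simp add: merged_at_def cluster_of_comp)
  moreover have "end2 es ?g \<notin> component es j (end1 es ?g)"
    by (rule acyclic) (use g in auto)
  ultimately show ?thesis using g(1) component_self component_sym by (auto simp: boundary_def)
qed

lemma sld_parent_None: "valid_node x \<Longrightarrow> boundary (cl x) = {} \<Longrightarrow> sld_parent n es x = None"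
  using merged_at_boundary[of x] unfolding sld_parent_def Let_def by auto

text \<open>A cluster persists until its lightest leaving edge is processed
  (\<open>component_stable\<close>), and an edge can merge it only by leaving it
  (\<open>merged_at_boundary\<close>). This turns the global process into a local criterion, which
  makes an asynchronous algorithm possible.\<close>

lemma sld_parent_Some:
  assumes x: "valid_node x" and f: "f \<in> boundary (cl x)"
    and min: "\<And>g. g \<in> boundary (cl x) \<Longrightarrow> g \<noteq> f \<Longrightarrow> precedes es f g"
  shows "sld_parent n es x = Some f"
proof -
  have fl: "f < length es" using f by (simp add: boundary_def)
  let ?j = "rank es f"
  note cx = node_cluster_comp[OF x]
  have cj: "created es x \<le> ?j" using boundary_rank f unfolding cx by blast
  have min': "?j \<le> rank es g" if "g \<in> boundary (cl x)" for g
    using min[OF that] that fl rank_less_iff[of f es g] by (cases "g = f") (auto simp: boundary_def)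
  have st: "component es ?j (node_rep x) = cl x"
    unfolding cx using component_stable[OF cj] min' unfolding cx by blast
  have "merged_at n es (cl x) ?j"
  proof -
    have "end1 es f \<in> cl x \<or> end2 es f \<in> cl x" using f by (auto simp: boundary_def)
    then have "component es ?j (end1 es f) = cl x \<or> component es ?j (end2 es f) = cl x"
      using component_eq[of _ es ?j "node_rep x"] unfolding st by auto
    moreover have "clusters n es ?j = component es ?j ` {..<n}"
      using clusters_comp rank_less_length[OF fl] by simp
    ultimately show ?thesis
      using ends[OF fl] by (auto simp: merged_at_def cluster_of_comp ranked_rank[OF fl] rank_less_length[OF fl])
  qed
  moreover have "?j \<le> j" if "created es x \<le> j \<and> merged_at n es (cl x) j" for j
  proof -
    have "j < length es" using that by (simp add: merged_at_def)
    moreover have "rank es f \<le> rank es (ranked es ! j)"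
      using min' merged_at_boundary[OF x] that by blast
    ultimately show ?thesis using ranked_nth(2)[of j es] by simp
  qed
  ultimately have "(LEAST j. created es x \<le> j \<and> merged_at n es (cl x) j) = ?j"
    using cj by (intro Least_equality) auto
  then show ?thesis
    using \<open>merged_at n es (cl x) ?j\<close> cj unfolding sld_parent_def Let_def
    by (auto simp: ranked_rank[OF fl])
qed

lemma boundary_min:
  assumes "boundary C \<noteq> {}"
  obtains f where "f \<in> boundary C" "\<And>g. g \<in> boundary C \<Longrightarrow> g \<noteq> f \<Longrightarrow> precedes es f g"
proof -
  obtain f where f: "f \<in> boundary C" "\<And>g. g \<in> boundary C \<Longrightarrow> rank es f \<le> rank es g"
    using assms ex_has_least_nat[of "\<lambda>g. g \<in> boundary C" _ "rank es"] by blast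
  have "precedes es f g" if "g \<in> boundary C" "g \<noteq> f" for g
    using f(2)[OF that(1)] f(1) that rank_less_iff[of f es g] rank_inj[of f es g] by (auto simp: boundary_def)
  with f(1) that show ?thesis by blast
qed

lemma sld_parent_SomeD:
  assumes x: "valid_node x" and p: "sld_parent n es x = Some f"
  shows "f \<in> boundary (cl x)" "f < length es" "created es x \<le> rank es f"
    "\<And>g. g \<in> boundary (cl x) \<Longrightarrow> g \<noteq> f \<Longrightarrow> precedes es f g"
    "\<And>g. g \<in> boundary (cl x) \<Longrightarrow> g \<noteq> f \<Longrightarrow> rank es f < rank es g"
    "component es (rank es f) (node_rep x) = cl x"
proof -
  have "boundary (cl x) \<noteq> {}" using sld_parent_None[OF x] p by auto
  then obtain f' where f': "f' \<in> boundary (cl x)" "\<And>g. g \<in> boundary (cl x) \<Longrightarrow> g \<noteq> f' \<Longrightarrow> precedes es f' g"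
    by (rule boundary_min) blast
  have "f' = f" using sld_parent_Some[OF x f'] p by simp
  then show fb: "f \<in> boundary (cl x)"
    and min: "\<And>g. g \<in> boundary (cl x) \<Longrightarrow> g \<noteq> f \<Longrightarrow> precedes es f g" using f' by auto
  then show fl: "f < length es" by (simp add: boundary_def)
  show cr: "created es x \<le> rank es f"
    using boundary_rank[of f] fb node_cluster_comp[OF x] by auto
  show min': "\<And>g. g \<in> boundary (cl x) \<Longrightarrow> g \<noteq> f \<Longrightarrow> rank es f < rank es g"
    using min rank_less_iff fl by (auto simp: boundary_def)
  show "component es (rank es f) (node_rep x) = cl x"
    unfolding node_cluster_comp[OF x]
    by (rule component_stable[OF cr]) (use min' node_cluster_comp[OF x] less_imp_le in \<open>metis order_refl\<close>)
qed

lemma boundary_empty: "valid_node x \<Longrightarrow> boundary (cl x) = {} \<Longrightarrow> cl x = {..<n}"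
  using node_rep_less[of x] component_subset[of "node_rep x"]
  by (intro component_full[of "node_rep x"]) (auto simp: boundary_def node_cluster_comp)

lemma node_cluster_parent:
  assumes "f < length es"
  shows "cl (Edge f) = component es (rank es f) (end1 es f) \<union> component es (rank es f) (end2 es f)"
  using node_cluster_comp[of "Edge f"] component_Suc[of "rank es f" es "end1 es f"] rank_less_length[OF assms]
    assms by (simp add: ranked_rank)

lemma cl_subset_parent:
  assumes "valid_node x" "sld_parent n es x = Some f"
  shows "cl x \<subseteq> cl (Edge f)"
proof -
  note p = sld_parent_SomeD[OF assms]
  have "end1 es f \<in> cl x \<or> end2 es f \<in> cl x" using p(1) by (auto simp: boundary_def)
  then show ?thesis
    using component_eq[of _ es "rank es f" "node_rep x"] node_cluster_parent[OF p(2)] p(6) by auto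
qed

text \<open>The cluster of \<open>f\<close> is already connected by edges of rank at most that of
  \<open>f\<close>, so a heavier edge inside it would close a cycle.\<close>

lemma not_internal:
  assumes "f < length es" "g < length es" "rank es f < rank es g"
  shows "\<not> (end1 es g \<in> cl (Edge f) \<and> end2 es g \<in> cl (Edge f))"
proof
  assume *: "end1 es g \<in> cl (Edge f) \<and> end2 es g \<in> cl (Edge f)"
  have "cl (Edge f) = component es (Suc (rank es f)) (end1 es f)"
    using node_cluster_comp[of "Edge f"] assms(1) by simp
  then have "end2 es g \<in> component es (Suc (rank es f)) (end1 es g)"
    using * component_eq[of "end1 es g" es "Suc (rank es f)" "end1 es f"] by simp
  then show False using acyclic[OF assms(2), of "Suc (rank es f)"] assms(3) by simp
qed

lemma node_cluster_merge:
  assumes x: "valid_node x" "sld_parent n es x = Some f" and y: "valid_node y" "sld_parent n es y = Some f"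
    and d: "cl x \<inter> cl y = {}"
  shows "cl (Edge f) = cl x \<union> cl y"
proof -
  note p = sld_parent_SomeD[OF x] and q = sld_parent_SomeD[OF y]
  have "end1 es f \<in> cl x \<and> end2 es f \<in> cl y \<or> end2 es f \<in> cl x \<and> end1 es f \<in> cl y"
    using p(1) q(1) d by (auto simp: boundary_def)
  then show ?thesis
    using component_eq[of _ es "rank es f" "node_rep x"] component_eq[of _ es "rank es f" "node_rep y"]
      node_cluster_parent[OF p(2)] p(6) q(6) by auto
qed

definition internal :: "nat set \<Rightarrow> nat set" where
  "internal C = {e. e < length es \<and> end1 es e \<in> C \<and> end2 es e \<in> C}"

text \<open>An edge between the two clusters leaves \<open>cl x\<close>, so it is \<open>f\<close>
  or heavier than \<open>f\<close>; a heavier one cannot lie inside \<open>cl (Edge f)\<close>. Thus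
  \<open>f\<close> is the only edge that becomes internal.\<close>

lemma internal_merge:
  assumes x: "valid_node x" "sld_parent n es x = Some f" and y: "valid_node y" "sld_parent n es y = Some f"
    and d: "cl x \<inter> cl y = {}"
  shows "internal (cl x \<union> cl y) = insert f (internal (cl x) \<union> internal (cl y))"
proof -
  note p = sld_parent_SomeD[OF x] and q = sld_parent_SomeD[OF y]
  have "g = f \<or> g \<in> internal (cl x) \<or> g \<in> internal (cl y)" if g: "g \<in> internal (cl x \<union> cl y)" for g
  proof (rule ccontr)
    assume *: "\<not> ?thesis"
    then have "g \<in> boundary (cl x)" using g d by (auto simp: internal_def boundary_def)
    then have "rank es f < rank es g" using p(5) * by blast
    then show False using not_internal[OF p(2), of g] g node_cluster_merge[OF assms] by (auto simp: internal_def)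
  qed
  moreover have "f \<in> internal (cl x \<union> cl y)"
    using p(1) q(1) d by (auto simp: boundary_def internal_def)
  moreover have "internal (cl x) \<union> internal (cl y) \<subseteq> internal (cl x \<union> cl y)"
    unfolding internal_def by blast
  ultimately show ?thesis by blast
qed

section \<open>Ancestors and height\<close>

abbreviation "anc \<equiv> sld_ancestors n es"

lemma anc_parent: "sld_parent n es x = Some f \<Longrightarrow> anc x = insert f (anc (Edge f))"
  unfolding sld_ancestors_def
  by (auto elim: converse_tranclpE intro: tranclp_into_tranclp2)

lemma anc_rank: "valid_node x \<Longrightarrow> g \<in> anc x \<Longrightarrow> g < length es \<and> created es x \<le> rank es g"
proof -
  assume x: "valid_node x" and g: "g \<in> anc x"
  let ?R = "\<lambda>y z. \<exists>g. sld_parent n es y = Some g \<and> z = Edge g"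
  have "?R\<^sup>+\<^sup>+ x z \<Longrightarrow> valid_node z \<and> created es x < created es z" for z
  proof (induction rule: tranclp_induct)
    case (base y)
    then show ?case using sld_parent_SomeD[OF x] by auto
  next
    case (step y z)
    then show ?case using sld_parent_SomeD[of y] by force
  qed
  then show ?thesis using g unfolding sld_ancestors_def by force
qed

lemma finite_anc: "valid_node x \<Longrightarrow> finite (anc x)"
  by (rule finite_subset[of _ "{..<length es}"]) (use anc_rank in auto)

lemma card_anc_parent:
  assumes "valid_node x" "sld_parent n es x = Some f"
  shows "card (anc x) = Suc (card (anc (Edge f)))"
proof -
  have f: "f < length es" using sld_parent_SomeD(2)[OF assms] .
  then have "f \<notin> anc (Edge f)" using anc_rank[of "Edge f" f] by auto
  then show ?thesis using anc_parent[OF assms(2)] finite_anc[of "Edge f"] f by simp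
qed

text \<open>A leaving edge other than the parent is heavier than the parent, so it leaves the
  parent's cluster too. Ranks grow on the way up, so it becomes a parent itself at some point. This
  is how the height comes to bound the size of heaps.\<close>

lemma boundary_anc: "valid_node x \<Longrightarrow> g \<in> boundary (cl x) \<Longrightarrow> g \<in> anc x"
proof (induction "length es - created es x" arbitrary: x rule: less_induct)
  case less
  then obtain f where p: "sld_parent n es x = Some f"
    using boundary_min[of "cl x"] sld_parent_Some[of x] by (metis empty_iff)
  note f = sld_parent_SomeD[OF less.prems(1) p]
  show ?case
  proof (cases "g = f")
    case True
    then show ?thesis using anc_parent[OF p] by simp
  next
    case False
    have g: "g < length es" using less.prems(2) by (simp add: boundary_def)
    have "\<not> (end1 es g \<in> cl (Edge f) \<and> end2 es g \<in> cl (Edge f))"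
      using not_internal[OF f(2) g] f(5)[OF less.prems(2) False] by blast
    then have "g \<in> boundary (cl (Edge f))"
      using less.prems(2) cl_subset_parent[OF less.prems(1) p] by (auto simp: boundary_def)
    moreover have "length es - created es (Edge f) < length es - created es x"
      using f(2,3) rank_less_length[OF f(2)] by simp
    ultimately have "g \<in> anc (Edge f)" using less.hyps[of "Edge f"] f(2) by simp
    then show ?thesis using anc_parent[OF p] by simp
  qed
qed

lemma card_boundary: "valid_node x \<Longrightarrow> card (boundary (cl x)) \<le> card (anc x)"
  using boundary_anc by (intro card_mono finite_anc) auto

lemma card_anc_vertex: "v < n \<Longrightarrow> card (anc (Vertex v)) \<le> sld_height n es"
  unfolding sld_height_def by (intro Max_ge) auto

lemma sld_height_le: "sld_height n es \<le> length es"
proof -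
  have "card (anc (Vertex v)) \<le> length es" if "v < n" for v
    using card_mono[of "{..<length es}" "anc (Vertex v)"] anc_rank[of "Vertex v"] that by auto
  then show ?thesis using n_pos unfolding sld_height_def by (subst Max_le_iff) (auto simp: lessThan_empty_iff)
qed

end

section \<open>Weight-biased leftist heaps\<close>

text \<open>Node \<open>q + 2\<close> of a heap is the half-edge \<open>q\<close>, so that node \<open>a\<close> belongs to edge \<open>a div 2 - 1\<close> and 0 is free to mean a leaf.\<close>

definition prec :: "(nat \<Rightarrow> real) \<Rightarrow> nat \<Rightarrow> nat \<Rightarrow> bool" where
  "prec w a b \<longleftrightarrow> w (a div 2 - 1) < w (b div 2 - 1) \<or> w (a div 2 - 1) = w (b div 2 - 1) \<and> a < b"

lemma prec_trans: "prec w a b \<Longrightarrow> prec w b c \<Longrightarrow> prec w a c"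
  by (auto simp: prec_def)

lemma prec_total: "a \<noteq> b \<Longrightarrow> \<not> prec w b a \<Longrightarrow> prec w a b"
  by (auto simp: prec_def)

definition node :: "nat tree \<Rightarrow> nat \<Rightarrow> nat tree \<Rightarrow> nat tree" where
  "node l a r = (if size l < size r then Node r a l else Node l a r)"

function meld :: "(nat \<Rightarrow> real) \<Rightarrow> nat tree \<Rightarrow> nat tree \<Rightarrow> nat tree" where
  "meld w Leaf t = t"
| "meld w t Leaf = t"
| "meld w (Node l1 a r1) (Node l2 b r2) =
     (if prec w b a then node l2 b (meld w r2 (Node l1 a r1)) else node l1 a (meld w r1 (Node l2 b r2)))"
  by pat_completeness auto
termination by (relation "measure (\<lambda>(w, t1, t2). size t1 + size t2)") auto

text \<open>Beyond order and bias, labels must be distinct and positive: they are the indices of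
  memory records, and \<open>0\<close> encodes the empty tree.\<close>

fun heap :: "(nat \<Rightarrow> real) \<Rightarrow> nat tree \<Rightarrow> bool" where
  "heap w Leaf = True"
| "heap w (Node l a r) = (size r \<le> size l \<and> 0 < a \<and> (\<forall>b \<in> set_tree l \<union> set_tree r. b \<noteq> a \<and> prec w a b) \<and>
     set_tree l \<inter> set_tree r = {} \<and> heap w l \<and> heap w r)"

fun spine :: "nat tree \<Rightarrow> nat" where
  "spine Leaf = 0"
| "spine (Node l a r) = Suc (spine r)"

fun root :: "nat tree \<Rightarrow> nat" where
  "root Leaf = 0"
| "root (Node l a r) = a"

lemma set_node [simp]: "set_tree (node l a r) = insert a (set_tree l \<union> set_tree r)"
  by (auto simp: node_def)

lemma size_node [simp]: "size (node l a r) = Suc (size l + size r)"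
  by (simp add: node_def)

lemma heap_node: "heap w (node l a r) \<longleftrightarrow> 0 < a \<and> (\<forall>b \<in> set_tree l \<union> set_tree r. b \<noteq> a \<and> prec w a b) \<and>
     set_tree l \<inter> set_tree r = {} \<and> heap w l \<and> heap w r"
  by (auto simp: node_def)

lemma set_meld [simp]: "set_tree (meld w t1 t2) = set_tree t1 \<union> set_tree t2"
  by (induction w t1 t2 rule: meld.induct) auto

lemma size_meld [simp]: "size (meld w t1 t2) = size t1 + size t2"
  by (induction w t1 t2 rule: meld.induct) auto

lemma heap_meld: "heap w t1 \<Longrightarrow> heap w t2 \<Longrightarrow> set_tree t1 \<inter> set_tree t2 = {} \<Longrightarrow> heap w (meld w t1 t2)"
proof (induction w t1 t2 rule: meld.induct)
  case (3 w l1 a r1 l2 b r2)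
  have ab: "a \<noteq> b" using 3(5) by auto
  show ?case
  proof (cases "prec w b a")
    case True
    have "heap w (meld w r2 (Node l1 a r1))"
      by (rule 3(1)[OF True]) (use 3(3-5) in auto)
    moreover have "c \<noteq> b \<and> prec w b c" if "c \<in> set_tree l1 \<union> set_tree r1" for c
      using that 3(3,5) prec_trans[OF True] by auto
    ultimately show ?thesis using True ab 3(3-5) by (auto simp: heap_node)
  next
    case False
    then have pr: "prec w a b" using prec_total[OF ab] by blast
    have "heap w (meld w r1 (Node l2 b r2))"
      by (rule 3(2)[OF False]) (use 3(3-5) in auto)
    moreover have "c \<noteq> a \<and> prec w a c" if "c \<in> set_tree l2 \<union> set_tree r2" for c
      using that 3(4,5) prec_trans[OF pr] by auto
    ultimately show ?thesis using False pr ab 3(3-5) by (auto simp: heap_node)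
  qed
qed auto

text \<open>The bias makes every step to the right at least halve \<open>Suc (size t)\<close>.
  Melding walks along right spines only.\<close>

lemma spine_bound: "heap w t \<Longrightarrow> 2 ^ spine t \<le> Suc (size t)"
  by (induction t) auto

lemma card_heap: "heap w t \<Longrightarrow> card (set_tree t) = size t"
proof (induction t)
  case (Node l a r)
  then have "a \<notin> set_tree l \<union> set_tree r" by auto
  then show ?case using Node by (simp add: card_Un_disjoint)
qed simp

lemma root_in_set: "t \<noteq> Leaf \<Longrightarrow> root t \<in> set_tree t"
  by (cases t) auto

lemma root_min: "heap w t \<Longrightarrow> b \<in> set_tree t \<Longrightarrow> b \<noteq> root t \<Longrightarrow> prec w (root t) b"
  by (cases t) auto

text \<open>
  Register 0 holds \<open>n\<close> throughout. Cells below \<open>16 n\<close> are input and output; above them, record \<open>i\<close> has the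
  fields 2 (left child), 3 (right child), 4 and 5 (sizes of the children) of heap node \<open>i\<close>, and others.
\<close>

definition addr :: "nat \<Rightarrow> nat \<Rightarrow> nat \<Rightarrow> nat" where
  "addr n j i = 16 * (n + i) + j"

lemma addr_eq_iff [simp]: "j < 16 \<Longrightarrow> j' < 16 \<Longrightarrow> addr n j i = addr n j' i' \<longleftrightarrow> j = j' \<and> i = i'"
proof
  have dm: "(16 * k + j) mod 16 = j" "(16 * k + j) div 16 = k" if "j < 16" for j k :: nat
    using that by simp_all
  assume j: "j < 16" "j' < 16" and eq: "addr n j i = addr n j' i'"
  have "j = j'" "n + i = n + i'" using dm j eq unfolding addr_def by metis+
  then show "j = j' \<and> i = i'" by simp
qed simp

definition adr :: "nat \<Rightarrow> aexp \<Rightarrow> aexp" where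
  "adr j a = Plus (Times (Lit 16) (Plus (Reg 0) a)) (Lit j)"

lemma aval_adr [simp]: "aval s (adr j a) = addr (s 0) j (aval s a)"
  by (simp add: adr_def addr_def)

text \<open>Only the fields of heap nodes. Fields \<open>6\<close> to \<open>9\<close> of a record
  serve an edge, a vertex or a slot that happens to have the same index, so unrelated owners may
  share a record.\<close>

definition cells :: "nat \<Rightarrow> nat set \<Rightarrow> nat set" where
  "cells n S = (\<Union>a\<in>S. {addr n 2 a, addr n 3 a, addr n 4 a, addr n 5 a})"

lemma cells_Un: "cells n (S \<union> T) = cells n S \<union> cells n T"
  by (auto simp: cells_def)

lemma cells_mono: "S \<subseteq> T \<Longrightarrow> cells n S \<subseteq> cells n T"
  by (auto simp: cells_def)

lemma addr_in_cells [simp]: "j < 16 \<Longrightarrow> addr n j a \<in> cells n S \<longleftrightarrow> a \<in> S \<and> j \<in> {2, 3, 4, 5}"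
  by (auto simp: cells_def)

lemma cells_disjoint: "S \<inter> T = {} \<Longrightarrow> cells n S \<inter> cells n T = {}"
  by (auto simp: cells_def)

section \<open>Heaps in memory\<close>

fun repr :: "nat \<Rightarrow> memory \<Rightarrow> nat tree \<Rightarrow> bool" where
  "repr n m Leaf = True"
| "repr n m (Node l a r) = (m (addr n 2 a) = root l \<and> m (addr n 3 a) = root r \<and>
     m (addr n 4 a) = size l \<and> m (addr n 5 a) = size r \<and> repr n m l \<and> repr n m r)"

lemma repr_cong: "(\<And>b. b \<in> cells n (set_tree t) \<Longrightarrow> m b = m' b) \<Longrightarrow> repr n m t \<Longrightarrow> repr n m' t"
proof (induction t)
  case (Node l a r)
  have "repr n m' l" "repr n m' r"
    using Node by (auto simp: cells_def)
  moreover have "m (addr n j a) = m' (addr n j a)" if "j \<in> {2, 3, 4, 5}" for j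
    using Node.prems(1)[of "addr n j a"] that by auto
  ultimately show ?case using Node.prems(2) by force
qed simp

text \<open>Tests have no disjunction, hence the nested negations.\<close>

definition prec_test :: "nat \<Rightarrow> nat \<Rightarrow> bexp" where
  "prec_test p q =
     (let e = (\<lambda>r. Minus (Div (Reg r) (Lit 2)) (Lit 1)) in
      Neg (Conj (Neg (Lighter (e p) (e q))) (Neg (Conj (Neg (Lighter (e q) (e p))) (Less (Reg p) (Reg q))))))"

lemma bval_prec_test [simp]: "bval w s (prec_test p q) \<longleftrightarrow> prec w (s p) (s q)"
  by (auto simp: prec_test_def prec_def Let_def)

definition swap_com :: com where
  "swap_com = Cond (prec_test 4 3) (Seq (Assign 6 (Reg 3)) (Seq (Assign 3 (Reg 4)) (Assign 4 (Reg 6)))) Skip"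

definition descend_com :: com where
  "descend_com =
     Seq (Store (Reg 5) (Reg 3))
    (Seq (Load 6 (adr 2 (Reg 3)))
    (Seq (Load 7 (adr 3 (Reg 3)))
    (Seq (Load 8 (adr 4 (Reg 3)))
    (Seq (Load 9 (adr 5 (Reg 3)))
    (Seq (Load 10 (adr 4 (Reg 4)))
    (Seq (Load 11 (adr 5 (Reg 4)))
    (Seq (Assign 9 (Plus (Plus (Reg 9) (Reg 10)) (Plus (Reg 11) (Lit 1))))
    (Seq (Cond (Less (Reg 8) (Reg 9))
           (Seq (Store (adr 3 (Reg 3)) (Reg 6))
           (Seq (Store (adr 5 (Reg 3)) (Reg 8))
           (Seq (Store (adr 4 (Reg 3)) (Reg 9))
                (Assign 5 (adr 2 (Reg 3))))))
           (Seq (Store (adr 5 (Reg 3)) (Reg 9))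
                (Assign 5 (adr 3 (Reg 3)))))
         (Assign 3 (Reg 7))))))))))"

text \<open>
  Registers 3 and 4 hold the roots of the two heaps and register 5 the address of the cell that is to
  receive the root of the result. Because the sizes of the result's subheaps are known in advance, one
  pass from the root downwards restores the bias to the left.
\<close>

definition meld_com :: com where
  "meld_com =
     Seq (While (Conj (Less (Lit 0) (Reg 3)) (Less (Lit 0) (Reg 4))) (Seq swap_com descend_com))
         (Store (Reg 5) (Plus (Reg 3) (Reg 4)))"

section \<open>Correctness and cost of melding\<close>

context
  fixes prog :: "com list" and w :: "nat \<Rightarrow> real" and W :: nat
begin

abbreviation wps where "wps \<equiv> wp prog w W"

lemma wp_CondI: "(bval w s b \<Longrightarrow> wps A p (\<lambda>K. Q (Suc K)) s m) \<Longrightarrow> (\<not> bval w s b \<Longrightarrow> wps A q (\<lambda>K. Q (Suc K)) s m) \<Longrightarrow>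
    wps A (Cond b p q) Q s m"
  by (rule wp_Cond) simp

lemma wp_AssignV: "aval s a = v \<Longrightarrow> v \<le> W \<Longrightarrow> Q 1 (s(r := v)) m \<Longrightarrow> wps A (Assign r a) Q s m"
  by (rule wp_Assign) (simp_all only:)

lemma wp_LoadV: "aval s a = c \<Longrightarrow> c \<in> A \<Longrightarrow> m c = v \<Longrightarrow> Q 1 (s(r := v)) m \<Longrightarrow> wps A (Load r a) Q s m"
  by (rule wp_Load) (simp_all only:)

lemma wp_StoreV: "aval s a = c \<Longrightarrow> aval s b = v \<Longrightarrow> c \<in> A \<Longrightarrow> v \<le> W \<Longrightarrow> Q 1 s (m(c := v)) \<Longrightarrow> wps A (Store a b) Q s m"
  by (rule wp_Store) (simp_all only:)

lemma descend_wp: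
  assumes "repr n m (Node l a r)" "repr n m t2" "t2 \<noteq> Leaf" "x \<notin> cells n (insert a (set_tree t2))"
    and "a \<notin> set_tree t2" "cells n (insert a (set_tree t2)) \<subseteq> A" "x \<in> A"
    and "s 0 = n" "s 3 = a" "s 4 = root t2" "s 5 = x"
    and "addr n 6 a \<le> W" "Suc (size l + size r + size t2) \<le> W" "a \<le> W" "root l \<le> W" "root r \<le> W"
  shows "wps A descend_com (\<lambda>K s' m'. K \<le> 35 \<and> s' 3 = root r \<and> s' 4 = root t2 \<and> (\<forall>i. i \<notin> {3..11} \<longrightarrow> s' i = s i) \<and>
     (if size l < size r + size t2 then
        s' 5 = addr n 2 a \<and> m' = m(x := a, addr n 3 a := root l, addr n 5 a := size l, addr n 4 a := size r + size t2)
      else s' 5 = addr n 3 a \<and> m' = m(x := a, addr n 5 a := size r + size t2))) s m"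
proof -
  define Q where "Q = (\<lambda>K s' m'. K \<le> (35::nat) \<and> s' 3 = root r \<and> s' 4 = root t2 \<and> (\<forall>i. i \<notin> {3..11} \<longrightarrow> s' i = s i) \<and>
     (if size l < size r + size t2 then
        s' 5 = addr n 2 a \<and> m' = m(x := a, addr n 3 a := root l, addr n 5 a := size l, addr n 4 a := size r + size t2)
      else s' 5 = addr n 3 a \<and> m' = m(x := a, addr n 5 a := size r + size t2)))"
  obtain l2 b r2 where t2: "t2 = Node l2 b r2" using assms(3) by (cases t2) auto
  have x: "addr n 2 a \<noteq> x" "addr n 3 a \<noteq> x" "addr n 4 a \<noteq> x" "addr n 5 a \<noteq> x" "addr n 4 b \<noteq> x" "addr n 5 b \<noteq> x"
    using assms(4) by (auto simp: t2)
  have A: "addr n 2 a \<in> A" "addr n 3 a \<in> A" "addr n 4 a \<in> A" "addr n 5 a \<in> A" "addr n 4 b \<in> A" "addr n 5 b \<in> A"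
    using assms(6) by (auto simp: t2)
  have le: "addr n 2 a \<le> W" "addr n 3 a \<le> W"
    using assms(12) by (simp_all add: addr_def)
  have ma: "m (addr n 2 a) = root l" "m (addr n 3 a) = root r" "m (addr n 4 a) = size l" "m (addr n 5 a) = size r"
    and mb: "m (addr n 4 b) = size l2" "m (addr n 5 b) = size r2"
    using assms(1,2) by (auto simp: t2)
  have sz: "size r + size l2 + Suc (size r2) = size r + size t2" "size r + size t2 \<le> W" "size l \<le> W"
    using assms(13) by (auto simp: t2)
  have s4: "s 4 = b" using assms(10) by (simp add: t2)
  note facts = x A le ma mb sz(2,3) assms(7-9,11,14-16) s4
  have "wps A descend_com Q s m"
    unfolding descend_com_def
    supply facts [simp]
    apply (rule wp_Seq, rule wp_StoreV, simp, simp, simp, simp)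
    apply (rule wp_Seq, rule wp_LoadV, simp, simp, simp)
    apply (rule wp_Seq, rule wp_LoadV, simp, simp, simp)
    apply (rule wp_Seq, rule wp_LoadV, simp, simp, simp)
    apply (rule wp_Seq, rule wp_LoadV, simp, simp, simp)
    apply (rule wp_Seq, rule wp_LoadV, simp, simp, simp)
    apply (rule wp_Seq, rule wp_LoadV, simp, simp, simp)
    apply (rule wp_Seq, rule wp_AssignV[where v = "size r + size t2"], simp add: t2, simp)
    apply (rule wp_Seq, rule wp_CondI)
     apply (rule wp_Seq, rule wp_StoreV, simp, simp, simp, simp)
     apply (rule wp_Seq, rule wp_StoreV, simp, simp, simp, simp)
     apply (rule wp_Seq, rule wp_StoreV, simp, simp, simp, simp)
     apply (rule wp_AssignV, simp, simp)
     apply (rule wp_AssignV, simp, simp)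
     apply (simp add: Q_def t2)
    apply (rule wp_Seq, rule wp_StoreV, simp, simp, simp, simp)
    apply (rule wp_AssignV, simp, simp)
    apply (rule wp_AssignV, simp, simp)
    apply (simp add: Q_def t2)
    done
  then show ?thesis by (simp only: Q_def)
qed

lemma swap_wp:
  assumes "s 3 \<le> W" "s 4 \<le> W"
  shows "wps A swap_com (\<lambda>K s' m'. K \<le> 6 \<and> m' = m \<and> s' 3 = (if prec w (s 4) (s 3) then s 4 else s 3) \<and>
     s' 4 = (if prec w (s 4) (s 3) then s 3 else s 4) \<and> (\<forall>i. i \<notin> {3, 4, 6} \<longrightarrow> s' i = s i)) s m"
proof -
  define Q where "Q = (\<lambda>K s' m'. K \<le> (6::nat) \<and> m' = m \<and> s' 3 = (if prec w (s 4) (s 3) then s 4 else s 3) \<and>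
     s' 4 = (if prec w (s 4) (s 3) then s 3 else s 4) \<and> (\<forall>i. i \<notin> {3, 4, 6} \<longrightarrow> s' i = s i))"
  have "wps A swap_com Q s m"
    unfolding swap_com_def
    supply assms [simp]
    apply (rule wp_CondI)
     apply (rule wp_Seq, rule wp_AssignV, simp, simp)
     apply (rule wp_Seq, rule wp_AssignV, simp, simp)
     apply (rule wp_AssignV, simp, simp)
     apply (simp add: Q_def)
    apply (rule wp_Skip)
    apply (simp add: Q_def)
    done
  then show ?thesis by (simp only: Q_def)
qed

text \<open>What holds after the loop, with the final store of \<open>meld_com\<close> still to
  come: \<open>m2\<close> anticipates it. The sum of registers \<open>3\<close> and \<open>4\<close>
  is the remaining root, because one of them is \<open>0\<close> when the loop ends.\<close>

definition melded :: "nat \<Rightarrow> nat set \<Rightarrow> nat \<Rightarrow> nat set \<Rightarrow> nat tree \<Rightarrow> nat \<Rightarrow> regs \<Rightarrow> memory \<Rightarrow>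
    nat \<Rightarrow> regs \<Rightarrow> memory \<Rightarrow> bool" where
  "melded n A x S t B s m K s' m' \<longleftrightarrow> K \<le> B \<and> (\<forall>i. i \<notin> {3..11} \<longrightarrow> s' i = s i) \<and> s' 5 \<in> A \<and> s' 3 + s' 4 \<le> W \<and>
     (let m2 = m'(s' 5 := s' 3 + s' 4) in m2 x = root t \<and> repr n m2 t \<and>
       (\<forall>c. c \<notin> insert x (cells n S) \<longrightarrow> m2 c = m c))"

text \<open>After one iteration node \<open>a\<close> is complete except for the field
  \<open>x'\<close>, which is to receive the meld of its old right subheap with \<open>t2\<close>.
  The loop test, two sequencing steps counted together with it, the swap (at most \<open>6\<close>)
  and the descent (at most \<open>35\<close>) stay within \<open>45\<close> per node of the
  spines.\<close>

lemma melded_step: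
  assumes h: "heap w (Node l a r)" "heap w t2" "set_tree (Node l a r) \<inter> set_tree t2 = {}"
    and rp: "repr n m (Node l a r)"
    and x: "x \<notin> cells n (insert a (set_tree l \<union> set_tree r \<union> set_tree t2))"
    and s1: "\<forall>i. i \<notin> {3..11} \<longrightarrow> s1 i = s i"
    and br: "if size l < size r + size t2 then
        x' = addr n 2 a \<and> m1 = m(x := a, addr n 3 a := root l, addr n 5 a := size l, addr n 4 a := size r + size t2)
      else x' = addr n 3 a \<and> m1 = m(x := a, addr n 5 a := size r + size t2)"
    and IH: "melded n A x' (set_tree r \<union> set_tree t2) (meld w r t2) (45 * (spine r + spine t2) + 1) s1 m1 K s' m'"
    and K0: "K0 \<le> 44"
  shows "melded n A x (insert a (set_tree l \<union> set_tree r \<union> set_tree t2)) (node l a (meld w r t2))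
     (45 * (Suc (spine r) + spine t2) + 1) s m (Suc (K0 + K)) s' m'"
proof -
  define m2 where "m2 = m'(s' 5 := s' 3 + s' 4)"
  have i: "K \<le> 45 * (spine r + spine t2) + 1" "\<forall>i. i \<notin> {3..11} \<longrightarrow> s' i = s1 i" "s' 5 \<in> A" "s' 3 + s' 4 \<le> W"
    "m2 x' = root (meld w r t2)" "repr n m2 (meld w r t2)"
    and keep: "\<And>c. c \<notin> insert x' (cells n (set_tree r \<union> set_tree t2)) \<Longrightarrow> m2 c = m1 c"
    using IH by (auto simp: melded_def m2_def Let_def)
  have a: "a \<notin> set_tree l" "a \<notin> set_tree r" "a \<notin> set_tree t2" "set_tree l \<inter> (set_tree r \<union> set_tree t2) = {}"
    using h by auto
  have x': "x' = addr n 2 a \<or> x' = addr n 3 a" using br by (auto split: if_splits)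
  have xx: "x \<noteq> x'" "x \<noteq> addr n j a" if "j \<in> {2, 3, 4, 5}" for j
    using x x' that by (auto simp: cells_def)
  have m1x: "m1 x = a" using br xx(2) by (auto split: if_splits)
  have kx: "m2 x = a"
    using keep[of x] x xx(1)[of 2] m1x by (auto simp: cells_def)
  have kl: "m2 c = m c" if c: "c \<in> cells n (set_tree l)" for c
  proof -
    have "c \<noteq> x" "c \<noteq> addr n j a" if "j \<in> {2, 3, 4, 5}" for j
      using c x a(1) that by (auto simp: cells_def)
    moreover have "c \<notin> cells n (set_tree r \<union> set_tree t2)" using c cells_disjoint[OF a(4)] by blast
    ultimately have "m2 c = m1 c" "m1 c = m c" using keep[of c] x' br by (auto split: if_splits)
    then show ?thesis by simp
  qed
  have rl: "repr n m2 l" using repr_cong[of n l m m2] kl rp by auto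
  have ka: "m2 (addr n j a) = m1 (addr n j a)" if "j \<in> {2, 3, 4, 5}" "addr n j a \<noteq> x'" for j
    using keep[of "addr n j a"] that a by auto
  have rn: "repr n m2 (node l a (meld w r t2))"
  proof (cases "size l < size r + size t2")
    case True
    then have "x' = addr n 2 a" and m1: "m1 = m(x := a, addr n 3 a := root l, addr n 5 a := size l, addr n 4 a := size r + size t2)"
      using br by auto
    then have "m2 (addr n 2 a) = root (meld w r t2)" "m2 (addr n 3 a) = root l" "m2 (addr n 4 a) = size r + size t2"
      "m2 (addr n 5 a) = size l" using i(5) ka[of 3] ka[of 4] ka[of 5] by simp_all
    then show ?thesis using True i(6) rl by (simp add: node_def)
  next
    case False
    then have x': "x' = addr n 3 a" and m1: "m1 = m(x := a, addr n 5 a := size r + size t2)"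
      using br by auto
    then have "m2 (addr n 3 a) = root (meld w r t2)" "m2 (addr n 2 a) = root l" "m2 (addr n 4 a) = size l"
      "m2 (addr n 5 a) = size r + size t2"
      using i(5) ka[of 2] ka[of 4] ka[of 5] xx(2)[of 2] xx(2)[of 4] rp by simp_all
    then show ?thesis using False i(6) rl by (simp add: node_def)
  qed
  have "m2 c = m c" if "c \<notin> insert x (cells n (insert a (set_tree l \<union> set_tree r \<union> set_tree t2)))" for c
  proof -
    have "c \<noteq> x" "c \<noteq> addr n j a" if "j \<in> {2, 3, 4, 5}" for j
      using \<open>c \<notin> _\<close> that by (auto simp: cells_def)
    moreover have "c \<notin> cells n (set_tree r \<union> set_tree t2)" using that by (auto simp: cells_def)
    ultimately have "m2 c = m1 c" "m1 c = m c" using keep[of c] x' br by (auto split: if_splits)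
    then show ?thesis by simp
  qed
  moreover have "root (node l a (meld w r t2)) = a" by (simp add: node_def)
  ultimately show ?thesis
    using i s1 kx rn K0 unfolding melded_def m2_def[symmetric] Let_def by auto
qed

lemma meld_loop:
  assumes "heap w t1" "heap w t2" "set_tree t1 \<inter> set_tree t2 = {}" "repr n m t1" "repr n m t2"
    and "x \<notin> cells n (set_tree t1 \<union> set_tree t2)" "cells n (set_tree t1 \<union> set_tree t2) \<subseteq> A" "x \<in> A"
    and "s 0 = n" "s 3 = root t1" "s 4 = root t2" "s 5 = x"
    and "\<And>a. a \<in> set_tree t1 \<union> set_tree t2 \<Longrightarrow> addr n 6 a \<le> W" "Suc (size t1 + size t2) \<le> W"
  shows "wps A (While (Conj (Less (Lit 0) (Reg 3)) (Less (Lit 0) (Reg 4))) (Seq swap_com descend_com))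
     (melded n A x (set_tree t1 \<union> set_tree t2) (meld w t1 t2) (45 * (spine t1 + spine t2) + 1) s m) s m"
    (is "wps A ?loop _ s m")
  using assms
proof (induction "size t1 + size t2" arbitrary: t1 t2 m s x rule: less_induct)
  case less
  have rW: "root t \<le> W" if "t = Leaf \<or> root t \<in> set_tree t1 \<union> set_tree t2" for t
    using less.prems(13)[of "root t"] that by (auto simp: addr_def)
  show ?case
  proof (cases "t1 = Leaf \<or> t2 = Leaf")
    case True
    then have t: "root t1 + root t2 = root (meld w t1 t2)" "repr n m (meld w t1 t2)"
      using less.prems(4,5) by (cases t1; cases t2; auto)+
    have "repr n (m(x := root (meld w t1 t2))) (meld w t1 t2)"
      by (rule repr_cong[OF _ t(2)]) (use less.prems(6) in auto)
    moreover have "root (meld w t1 t2) \<le> W"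
      using rW[of "meld w t1 t2"] root_in_set[of "meld w t1 t2"] by auto
    ultimately show ?thesis
      using True t(1) less.prems by (intro wp_While_false) (auto simp: melded_def)
  next
    case False
    then obtain l1 a r1 l2 b r2 where t1: "t1 = Node l1 a r1" and t2: "t2 = Node l2 b r2"
      by (cases t1; cases t2) auto
    \<comment> \<open>Here \<open>Node l c r\<close> is the heap with the smaller root and
      \<open>u\<close> the other one. The swap makes both outcomes of the comparison instances of
      this statement.\<close>
    have win: "wps A descend_com (\<lambda>K' s'' m''. wps A ?loop (\<lambda>K''. melded n A x (insert c (set_tree l \<union> set_tree r \<union> set_tree u))
        (node l c (meld w r u)) (45 * (Suc (spine r) + spine u) + 1) s m (Suc (Suc (K + K') + K''))) s'' m'') s' m"
      if h: "heap w (Node l c r)" "heap w u" "u \<noteq> Leaf" "set_tree (Node l c r) \<inter> set_tree u = {}"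
        and rp: "repr n m (Node l c r)" "repr n m u"
        and st: "set_tree (Node l c r) \<union> set_tree u = set_tree t1 \<union> set_tree t2"
        and sz: "size (Node l c r) + size u = size t1 + size t2"
        and s': "s' 3 = c" "s' 4 = root u" "\<forall>i. i \<notin> {3, 4, 6} \<longrightarrow> s' i = s i" and K: "K \<le> 6"
      for l c r u s' K
    proof (rule wp_conseq[OF descend_wp[where n = n and m = m and l = l and a = c and r = r and ?t2.0 = u and x = x]])
      have sub: "insert c (set_tree u) \<subseteq> set_tree t1 \<union> set_tree t2" "set_tree r \<union> set_tree u \<subseteq> set_tree t1 \<union> set_tree t2"
        using st by auto
      show "x \<notin> cells n (insert c (set_tree u))" "cells n (insert c (set_tree u)) \<subseteq> A"
        using less.prems(6,7) cells_mono[OF sub(1)] by blast+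
      show "c \<notin> set_tree u" using h(4) by auto
      show "s' 0 = n" "s' 5 = x" using s' less.prems(9,12) by auto
      show "addr n 6 c \<le> W" by (rule less.prems(13)) (use st in auto)
      show "root l \<le> W" "root r \<le> W"
        using rW[of l] rW[of r] root_in_set[of l] root_in_set[of r] st by auto
      show "c \<le> W" using rW[of "Node l c r"] st by auto
      show "Suc (size l + size r + size u) \<le> W" using less.prems(14) sz by simp
      fix K' :: nat and s1 m1
      assume d: "K' \<le> 35 \<and> s1 3 = root r \<and> s1 4 = root u \<and> (\<forall>i. i \<notin> {3..11} \<longrightarrow> s1 i = s' i) \<and>
         (if size l < size r + size u then
            s1 5 = addr n 2 c \<and> m1 = m(x := c, addr n 3 c := root l, addr n 5 c := size l, addr n 4 c := size r + size u)
          else s1 5 = addr n 3 c \<and> m1 = m(x := c, addr n 5 c := size r + size u))"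
      have x': "s1 5 \<in> {addr n 2 c, addr n 3 c}" using d by (auto split: if_splits)
      have xc: "x \<notin> cells n (set_tree r \<union> set_tree u)"
        using less.prems(6) cells_mono[OF sub(2)] by blast
      have same: "m1 e = m e" if "e \<in> cells n (set_tree r \<union> set_tree u)" for e
      proof -
        have "e \<noteq> x" using that xc by blast
        moreover have "e \<noteq> addr n j c" if "j \<in> {2, 3, 4, 5}" for j
          using h(1,4) \<open>e \<in> _\<close> that by (auto simp: cells_def)
        ultimately show ?thesis using d by (auto split: if_splits)
      qed
      have s1: "\<forall>i. i \<notin> {3..11} \<longrightarrow> s1 i = s i"
      proof (intro allI impI)
        fix i :: nat assume "i \<notin> {3..11}"
        then show "s1 i = s i" using d s'(3) by (cases "i \<in> {3, 4, 6}") auto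
      qed
      show "wps A ?loop (\<lambda>K''. melded n A x (insert c (set_tree l \<union> set_tree r \<union> set_tree u))
        (node l c (meld w r u)) (45 * (Suc (spine r) + spine u) + 1) s m (Suc (Suc (K + K') + K''))) s1 m1"
      proof (rule wp_conseq[OF less.hyps[of r u m1 "s1 5" s1]])
        show "size r + size u < size t1 + size t2" using sz by simp
        show "repr n m1 r" by (rule repr_cong[OF _ rp(1)[simplified, THEN conjunct2, THEN conjunct2, THEN conjunct2, THEN conjunct2, THEN conjunct2]])
            (simp add: same cells_Un)
        show "repr n m1 u" by (rule repr_cong[OF _ rp(2)]) (simp add: same cells_Un)
        show "s1 5 \<notin> cells n (set_tree r \<union> set_tree u)" using x' h(1,4) by auto
        show "cells n (set_tree r \<union> set_tree u) \<subseteq> A" using less.prems(7) cells_mono[OF sub(2)] by blast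
        have "cells n {c} \<subseteq> A" using less.prems(7) cells_mono[of "{c}" "set_tree t1 \<union> set_tree t2" n] st by auto
        then show "s1 5 \<in> A" using x' by (auto simp: cells_def)
        show "s1 0 = n" using s1 less.prems(9) by simp
        show "Suc (size r + size u) \<le> W" using less.prems(14) sz by simp
        show "addr n 6 e \<le> W" if "e \<in> set_tree r \<union> set_tree u" for e
          using less.prems(13)[of e] that sub(2) by blast
        fix K'' :: nat and s'' m''
        assume "melded n A (s1 5) (set_tree r \<union> set_tree u) (meld w r u) (45 * (spine r + spine u) + 1) s1 m1 K'' s'' m''"
        from melded_step[OF h(1,2,4) rp(1) _ s1 _ this, of x "Suc (K + K')"]
        show "melded n A x (insert c (set_tree l \<union> set_tree r \<union> set_tree u))
          (node l c (meld w r u)) (45 * (Suc (spine r) + spine u) + 1) s m (Suc (Suc (K + K') + K'')) s'' m''"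
          using d K less.prems(6) st by (simp add: Un_assoc)
      qed (use d h in auto)
    qed (use h rp s' less.prems in auto)
    have bv: "bval w s (Conj (Less (Lit 0) (Reg 3)) (Less (Lit 0) (Reg 4)))"
      using less.prems(1,2,10,11) by (simp add: t1 t2)
    show ?thesis
    proof (rule wp_While_true[OF bv], rule wp_Seq, rule wp_conseq[OF swap_wp])
      show "s 3 \<le> W" "s 4 \<le> W" using rW[of t1] rW[of t2] less.prems(10,11) by (auto simp: t1 t2)
      fix K :: nat and s' m'
      assume sw: "K \<le> 6 \<and> m' = m \<and> s' 3 = (if prec w (s 4) (s 3) then s 4 else s 3) \<and>
        s' 4 = (if prec w (s 4) (s 3) then s 3 else s 4) \<and> (\<forall>i. i \<notin> {3, 4, 6} \<longrightarrow> s' i = s i)"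
      have s34: "s 3 = a" "s 4 = b" using less.prems(10,11) by (auto simp: t1 t2)
      show "wps A descend_com (\<lambda>K' s'' m''. wps A ?loop (\<lambda>K''. melded n A x (set_tree t1 \<union> set_tree t2) (meld w t1 t2)
          (45 * (spine t1 + spine t2) + 1) s m (Suc (Suc (K + K') + K''))) s'' m'') s' m'"
      proof (cases "prec w b a")
        case True
        have "insert b (set_tree l2 \<union> set_tree r2 \<union> set_tree t1) = set_tree t1 \<union> set_tree t2"
          by (auto simp: t2)
        moreover have "45 * (Suc (spine r2) + spine t1) + 1 = 45 * (spine t1 + spine t2) + 1" by (simp add: t2)
        ultimately show ?thesis
          using win[of l2 b r2 t1 s' K] less.prems(1-5) sw s34 True by (simp add: t1 t2 Int_commute Un_commute add.commute)
      next
        case False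
        have "insert a (set_tree l1 \<union> set_tree r1 \<union> set_tree t2) = set_tree t1 \<union> set_tree t2"
          by (auto simp: t1)
        then show ?thesis
          using win[of l1 a r1 t2 s' K] less.prems(1-5) sw s34 False by (simp add: t1 t2)
      qed
    qed
  qed
qed

lemma meld_wp:
  assumes "heap w t1" "heap w t2" "set_tree t1 \<inter> set_tree t2 = {}" "repr n m t1" "repr n m t2"
    and "x \<notin> cells n (set_tree t1 \<union> set_tree t2)" "cells n (set_tree t1 \<union> set_tree t2) \<subseteq> A" "x \<in> A"
    and "s 0 = n" "s 3 = root t1" "s 4 = root t2" "s 5 = x"
    and "\<And>a. a \<in> set_tree t1 \<union> set_tree t2 \<Longrightarrow> addr n 6 a \<le> W" "Suc (size t1 + size t2) \<le> W"
  shows "wps A meld_com (\<lambda>K s' m'. K \<le> 45 * (spine t1 + spine t2) + 3 \<and> (\<forall>i. i \<notin> {3..11} \<longrightarrow> s' i = s i) \<and>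
     m' x = root (meld w t1 t2) \<and> repr n m' (meld w t1 t2) \<and>
     (\<forall>c. c \<notin> insert x (cells n (set_tree t1 \<union> set_tree t2)) \<longrightarrow> m' c = m c)) s m"
  unfolding meld_com_def
  by (rule wp_Seq, rule wp_conseq[OF meld_loop[OF assms]], simp, rule wp_Store)
    (auto simp: melded_def Let_def)

end

section \<open>Half-edges\<close>

text \<open>The two nodes of edge \<open>f\<close> are \<open>2 f + 2\<close>, at its first end, and \<open>2 f + 3\<close>, at its second end.\<close>

definition edge_of :: "nat \<Rightarrow> nat" where
  "edge_of a = a div 2 - 1"

text \<open>Flips the lowest bit, in a form that program expressions can evaluate.\<close>

definition sib :: "nat \<Rightarrow> nat" where
  "sib a = a + 1 - 2 * (a mod 2)"

lemma sib_even: "even a \<Longrightarrow> sib a = Suc a" and sib_odd: "odd a \<Longrightarrow> sib a = a - 1"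
  by (auto simp: sib_def odd_iff_mod_2_eq_one)

lemma div2_edge_of: "2 \<le> a \<Longrightarrow> a div 2 = Suc (edge_of a)"
  by (simp add: edge_of_def)

lemma sib_props:
  assumes "2 \<le> a"
  shows "2 \<le> sib a" "sib a \<noteq> a" "sib (sib a) = a" "edge_of (sib a) = edge_of a" "even (sib a) \<longleftrightarrow> odd a"
proof -
  obtain k where k: "a = 2 * k \<or> a = Suc (2 * k)" by (metis oddE evenE Suc_eq_plus1)
  with assms show "2 \<le> sib a" "sib a \<noteq> a" "sib (sib a) = a" "edge_of (sib a) = edge_of a" "even (sib a) \<longleftrightarrow> odd a"
    by (auto simp: sib_def edge_of_def) 
qed

lemma same_edge: "2 \<le> a \<Longrightarrow> 2 \<le> b \<Longrightarrow> edge_of a = edge_of b \<Longrightarrow> b = a \<or> b = sib a"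
  unfolding edge_of_def sib_def by (cases "even a"; cases "even b") (auto elim!: evenE oddE)

lemma edge_nodes: "2 \<le> a \<Longrightarrow> edge_of a = f \<longleftrightarrow> a = 2 * f + 2 \<or> a = 2 * f + 3"
  unfolding edge_of_def by (cases "even a") (auto elim!: evenE oddE)

context weighted_tree_input
begin

abbreviation "w \<equiv> weight es"

text \<open>The vertex at which a half-edge starts. The numbering is such that input cell
  \<open>q\<close> holds the end of node \<open>q + 2\<close>.\<close>

definition hend :: "nat \<Rightarrow> nat" where
  "hend a = (if even a then end1 es (edge_of a) else end2 es (edge_of a))"

text \<open>Represents every edge leaving \<open>C\<close> by its node on the inner side. These are
  the contents of the heap of a cluster.\<close>

definition half :: "nat set \<Rightarrow> nat set" where
  "half C = {a \<in> {2..<2 * n}. hend a \<in> C \<and> hend (sib a) \<notin> C}"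

lemma edge_of_less: "a \<in> {2..<2 * n} \<Longrightarrow> edge_of a < length es"
  using Suc_length by (auto simp: edge_of_def)

lemma hend_less: "a \<in> {2..<2 * n} \<Longrightarrow> hend a < n"
  using ends[OF edge_of_less] by (simp add: hend_def)

lemma sib_range: "a \<in> {2..<2 * n} \<Longrightarrow> sib a \<in> {2..<2 * n}"
  by (cases "even a") (auto simp: sib_even sib_odd elim!: evenE oddE)

lemma hend_sib: "2 \<le> a \<Longrightarrow> hend (sib a) = (if even a then end2 es (edge_of a) else end1 es (edge_of a))"
  by (simp add: hend_def sib_props)

lemma half_iff: "a \<in> half C \<longleftrightarrow> a \<in> {2..<2 * n} \<and>
    (if even a then end1 es (edge_of a) \<in> C \<and> end2 es (edge_of a) \<notin> C
     else end2 es (edge_of a) \<in> C \<and> end1 es (edge_of a) \<notin> C)"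
  using hend_sib[of a] hend_def[of a] by (auto simp: half_def)

lemma half_range: "a \<in> half C \<Longrightarrow> a \<in> {2..<2 * n}"
  by (simp add: half_def)

lemma finite_half: "finite (half C)"
  by (simp add: half_def)

lemma half_boundary: "a \<in> half C \<Longrightarrow> edge_of a \<in> boundary C"
  using edge_of_less[of a] by (auto simp: half_iff boundary_def split: if_splits)

lemma half_inj:
  assumes "a \<in> half C" "b \<in> half C" "edge_of a = edge_of b"
  shows "a = b"
  using same_edge[of a b] assms by (auto simp: half_def)

lemma boundary_half:
  assumes "f \<in> boundary C"
  shows "\<exists>a \<in> half C. edge_of a = f"
proof -
  have f: "f < length es" "2 * f + 3 < 2 * n" using assms Suc_length by (auto simp: boundary_def)
  have e: "edge_of (2 * f + 2) = f" "edge_of (2 * f + 3) = f" "sib (2 * f + 2) = 2 * f + 3" "sib (2 * f + 3) = 2 * f + 2"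
    by (auto simp: edge_of_def sib_def)
  show ?thesis
  proof (cases "end1 es f \<in> C")
    case True
    then have "2 * f + 2 \<in> half C" using assms f e by (auto simp: half_def hend_def boundary_def)
    then show ?thesis using e by blast
  next
    case False
    then have "2 * f + 3 \<in> half C" using assms f e by (auto simp: half_def hend_def boundary_def)
    then show ?thesis using e by blast
  qed
qed

lemma card_half: "card (half C) = card (boundary C)"
proof -
  have "bij_betw edge_of (half C) (boundary C)"
    unfolding bij_betw_def inj_on_def using half_inj half_boundary boundary_half by blast
  then show ?thesis by (rule bij_betw_same_card)
qed

lemma half_vertex: "v < n \<Longrightarrow> half {v} = {a \<in> {2..<2 * n}. hend a = v}"
  using no_loop[OF edge_of_less] by (fastforce simp: half_iff hend_def)

lemma prec_precedes: "2 \<le> a \<Longrightarrow> 2 \<le> b \<Longrightarrow> edge_of a \<noteq> edge_of b \<Longrightarrow> prec w a b \<longleftrightarrow> precedes es (edge_of a) (edge_of b)"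
proof -
  assume "2 \<le> a" "2 \<le> b" "edge_of a \<noteq> edge_of b"
  then have "a < b \<longleftrightarrow> edge_of a < edge_of b"
    unfolding edge_of_def by (cases "even a"; cases "even b") (auto elim!: evenE oddE)
  then show ?thesis by (simp add: prec_def precedes_def edge_of_def)
qed

text \<open>On different edges the heap order coincides with \<open>precedes\<close>, and an edge
  leaving the cluster has only one node in \<open>half\<close>. So the root belongs to the lightest
  leaving edge.\<close>

lemma sld_parent_heap:
  assumes x: "valid_node x" and t: "heap w t" "set_tree t = half (cl x)"
  shows "sld_parent n es x = (if t = Leaf then None else Some (edge_of (root t)))"
proof (cases t)
  case Leaf
  then have "boundary (cl x) = {}" using t(2) boundary_half[of _ "cl x"] by auto
  then show ?thesis using Leaf sld_parent_None[OF x] by simp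
next
  case (Node l a r)
  then have a: "a \<in> half (cl x)" using t(2) by auto
  have "sld_parent n es x = Some (edge_of a)"
  proof (rule sld_parent_Some[OF x half_boundary[OF a]])
    fix g assume g: "g \<in> boundary (cl x)" "g \<noteq> edge_of a"
    obtain b where b: "b \<in> half (cl x)" "edge_of b = g" using boundary_half[OF g(1)] by blast
    then have "b \<noteq> a" using g by blast
    moreover have "b \<in> set_tree t" using b(1) t(2) by simp
    ultimately have "prec w a b" using root_min[OF t(1), of b] by (simp add: Node)
    then show "precedes es (edge_of a) g"
      using prec_precedes[of a b] a b g half_range by auto
  qed
  then show ?thesis by (simp add: Node)
qed

definition out_value :: "nat \<Rightarrow> nat" where
  "out_value e = (case sld_parent n es (Edge e) of None \<Rightarrow> 0 | Some f \<Rightarrow> Suc f)"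

text \<open>Both \<open>2 * f + 2\<close> and \<open>2 * f + 3\<close> halve to
  \<open>Suc f\<close>, and the root \<open>0\<close> of the empty heap to \<open>0\<close>, so
  halving the root gives the output encoding.\<close>

lemma out_value_heap:
  assumes "e < length es" and t: "heap w t" "set_tree t = half (cl (Edge e))"
  shows "out_value e = root t div 2"
proof (cases t)
  case (Node l a r)
  then have "a \<in> half (cl (Edge e))" using t(2) by auto
  then have "2 \<le> a" by (simp add: half_def)
  then show ?thesis
    using sld_parent_heap[of "Edge e" t] assms Node div2_edge_of[of a] by (simp add: out_value_def del: node_cluster.simps)
qed (use sld_parent_heap[of "Edge e" t] assms in \<open>simp add: out_value_def del: node_cluster.simps\<close>)

text \<open>As \<open>f\<close> is the only edge between the two clusters, any other half-edge
  leaving one of them leaves the union as well. A merge therefore only has to delete two roots and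
  meld.\<close>

lemma half_merge:
  assumes x: "valid_node x" "sld_parent n es x = Some f" and y: "valid_node y" "sld_parent n es y = Some f"
    and d: "cl x \<inter> cl y = {}" and a: "a \<in> half (cl x)" "edge_of a = f"
  shows "sib a \<in> half (cl y)" "half (cl x \<union> cl y) = (half (cl x) - {a}) \<union> (half (cl y) - {sib a})"
proof -
  note p = sld_parent_SomeD[OF x] and q = sld_parent_SomeD[OF y]
  have a2: "2 \<le> a" "a \<in> {2..<2*n}" using half_range[OF a(1)] by auto
  note sb = sib_props[OF a2(1)]
  have ax: "hend a \<in> cl x" "hend (sib a) \<notin> cl x" using a(1) by (auto simp: half_def)
  have "(hend a \<in> cl y) \<noteq> (hend (sib a) \<in> cl y)"
    using q(1) a hend_def[of a] hend_sib[OF a2(1)] by (auto simp: boundary_def)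
  then have ay: "hend (sib a) \<in> cl y" "hend a \<notin> cl y" using ax d by auto
  then show sy: "sib a \<in> half (cl y)" using sib_range[OF a2(2)] sb(3) by (simp add: half_def)
  have key: "hend (sib b) \<notin> cl x \<union> cl y" if b: "b \<in> {2..<2 * n}" "edge_of b \<noteq> f" "hend b \<in> cl x \<union> cl y"
    "b \<in> half (cl x) \<or> b \<in> half (cl y)" for b
  proof
    assume "hend (sib b) \<in> cl x \<union> cl y"
    then have "edge_of b \<in> internal (cl x \<union> cl y)"
      using b edge_of_less[OF b(1)] hend_def[of b] hend_sib[of b] by (auto simp: internal_def split: if_splits)
    then have "edge_of b \<in> internal (cl x) \<union> internal (cl y)"
      using internal_merge[OF x y d] b(2) by auto
    moreover have "edge_of b \<in> boundary (cl x) \<or> edge_of b \<in> boundary (cl y)"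
      using b(4) half_boundary by blast
    ultimately show False using d by (auto simp: internal_def boundary_def)
  qed
  show "half (cl x \<union> cl y) = (half (cl x) - {a}) \<union> (half (cl y) - {sib a})"
  proof (intro equalityI subsetI)
    fix b assume b: "b \<in> half (cl x \<union> cl y)"
    then have "b \<noteq> a" "b \<noteq> sib a" using ax ay sb(3) by (auto simp: half_def)
    then show "b \<in> (half (cl x) - {a}) \<union> (half (cl y) - {sib a})" using b by (auto simp: half_def)
  next
    fix b assume b: "b \<in> (half (cl x) - {a}) \<union> (half (cl y) - {sib a})"
    then have "edge_of b \<noteq> f"
      using half_inj[of b "cl x" a] half_inj[of b "cl y" "sib a"] a sy sb(4) by auto
    moreover have "b \<in> {2..<2 * n}" "hend b \<in> cl x \<union> cl y" using b by (auto simp: half_def)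
    ultimately show "b \<in> half (cl x \<union> cl y)" using key[of b] b by (auto simp: half_def)
  qed
qed

end

section \<open>The program\<close>

definition load_meld :: "aexp \<Rightarrow> aexp \<Rightarrow> aexp \<Rightarrow> com" where
  "load_meld a1 a2 h = Seq (Load 3 a1) (Seq (Load 4 a2) (Seq (Assign 5 h) meld_com))"

text \<open>Slot \<open>r * n + v\<close> is number \<open>r\<close> of vertex \<open>v\<close>.
  Each vertex has an unbounded column of slots, so degrees need not be known in advance.\<close>

definition fill_com :: com where
  "fill_com =
     Seq (Load 3 (Reg 1))
    (Seq (Fetch_Inc 4 (adr 7 (Reg 3)))
         (Store (adr 8 (Plus (Times (Reg 4) (Reg 0)) (Reg 3))) (Plus (Reg 1) (Lit 2))))"

text \<open>A half-edge enters as a heap of one node. Its record needs no preparation, because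
  fields that are all \<open>0\<close> describe two empty subheaps.\<close>

definition insert_com :: com where
  "insert_com =
     Seq (load_meld (adr 9 (Reg 1)) (adr 8 (Plus (Times (Reg 12) (Reg 0)) (Reg 1))) (adr 9 (Reg 1)))
         (Assign 12 (Plus (Reg 12) (Lit 1)))"

definition build_com :: com where
  "build_com =
     Seq (Load 13 (adr 7 (Reg 1)))
    (Seq (Assign 12 (Lit 0))
    (Seq (While (Less (Reg 12) (Reg 13)) insert_com)
         (Load 14 (adr 9 (Reg 1)))))"

text \<open>Melding the two subheaps of a root deletes the root; this is done for both nodes of the
  edge before the results are melded. Cell \<open>addr n 9 (n + v)\<close> is scratch space of
  thread \<open>v\<close>. Register \<open>12\<close> saves the edge before register
  \<open>14\<close> receives the new root.\<close>

definition merge_com :: com where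
  "merge_com =
     Seq (Assign 15 (Minus (Plus (Reg 14) (Lit 1)) (Times (Lit 2) (Mod (Reg 14) (Lit 2)))))
    (Seq (load_meld (adr 2 (Reg 14)) (adr 3 (Reg 14)) (adr 9 (Reg 1)))
    (Seq (load_meld (adr 2 (Reg 15)) (adr 3 (Reg 15)) (adr 9 (Plus (Reg 0) (Reg 1))))
    (Seq (load_meld (adr 9 (Reg 1)) (adr 9 (Plus (Reg 0) (Reg 1))) (adr 9 (Reg 1)))
    (Seq (Assign 12 (Div (Reg 14) (Lit 2)))
    (Seq (Load 14 (adr 9 (Reg 1)))
         (Store (Plus (Times (Lit 2) (Minus (Reg 0) (Lit 1))) (Minus (Reg 12) (Lit 1))) (Div (Reg 14) (Lit 2))))))))"

text \<open>The atomic increment decides which cluster arrives second. Clearing register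
  \<open>14\<close> ends the loop in the same way as an empty heap.\<close>

definition climb_com :: com where
  "climb_com =
     While (Less (Lit 0) (Reg 14))
       (Seq (Fetch_Inc 16 (adr 6 (Div (Reg 14) (Lit 2))))
            (Cond (Less (Lit 0) (Reg 16)) merge_com (Assign 14 (Lit 0))))"

definition main_com :: com where
  "main_com =
     Seq (Assign 2 (Times (Lit 2) (Minus (Reg 0) (Lit 1))))
    (Seq (Call 1)
    (Seq (Assign 1 (Lit 0))
    (Seq (Assign 2 (Reg 0))
         (Call 2))))"

definition uf_prog :: "com list" where
  "uf_prog = [main_com, par_for 1 fill_com, par_for 2 (Seq build_com climb_com)]"

definition out :: "nat \<Rightarrow> nat \<Rightarrow> nat" where
  "out n f = 2 * (n - 1) + f"

lemma out_not_addr: "Suc f < n \<Longrightarrow> out n f \<noteq> addr n j i"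
  by (simp add: out_def addr_def)

lemma out_inj: "out n f = out n g \<longleftrightarrow> f = g"
  by (simp add: out_def)

section \<open>Step bounds in terms of the height\<close>

locale tree_run = weighted_tree_input +
  fixes W :: nat
  assumes W: "100 * n * n \<le> W"
begin

abbreviation "H \<equiv> sld_height n es"
abbreviation "wpr \<equiv> wp uf_prog w W"
abbreviation "sf \<equiv> safe uf_prog w W"

text \<open>Bounds the right spine of a heap with at most \<open>H\<close> nodes. The successor
  comes from \<open>spine_bound\<close> and avoids the logarithm of \<open>0\<close>.\<close>

definition lg :: nat where
  "lg = nat \<lfloor>log 2 (real (Suc H))\<rfloor>"

lemma spine_le: "heap w t \<Longrightarrow> size t \<le> H \<Longrightarrow> spine t \<le> lg"
proof -
  assume "heap w t" "size t \<le> H"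
  then have "2 ^ spine t \<le> Suc H" using spine_bound[of w t] by simp
  then have "real (2 ^ spine t) \<le> real (Suc H)" by (rule of_nat_mono)
  then have "real (spine t) \<le> log 2 (real (Suc H))" by (simp add: le_log_iff powr_realpow)
  then show ?thesis unfolding lg_def by linarith
qed

text \<open>Addresses pass through register \<open>5\<close> and are therefore subject to the word
  bound.\<close>

lemma addr_bound:
  assumes "j < 16" "i \<le> 2 * n * n + 2 * n"
  shows "addr n j i \<le> W"
proof -
  define N where "N = n * n"
  have N: "n \<le> N" "1 \<le> N" using n_pos by (auto simp: N_def)
  have "i \<le> 2 * N + 2 * n" "100 * N \<le> W" using assms(2) W by (simp_all add: N_def mult.assoc)
  then have "16 * i \<le> 32 * N + 32 * n" "16 * n \<le> 16 * N" "32 * n \<le> 32 * N" "j \<le> 15 * N"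
    using N assms(1) by linarith+
  then have "16 * n + 16 * i + j \<le> 100 * N" by linarith
  then show ?thesis using \<open>100 * N \<le> W\<close> unfolding addr_def by simp
qed

lemma node_bound: "a < 2 * n \<Longrightarrow> j < 16 \<Longrightarrow> addr n j a \<le> W"
  by (rule addr_bound) auto

lemma nn_bound: "i \<le> 100 * n \<Longrightarrow> i \<le> W"
proof -
  assume "i \<le> 100 * n"
  moreover have "100 * n * 1 \<le> 100 * n * n" using n_pos by (intro mult_le_mono2) simp
  ultimately show ?thesis using W by linarith
qed

lemma H_less: "H < n"
  using sld_height_le Suc_length by simp

text \<open>The coefficient \<open>90\<close> is \<open>45\<close> for each of two right spines.
  Hypothesis \<open>av\<close> is uniform in registers \<open>3\<close> to \<open>11\<close>,
  because the loads overwrite some of them before the later addresses are evaluated.\<close>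

lemma load_meld_wp:
  assumes h: "heap w t1" "heap w t2" "set_tree t1 \<inter> set_tree t2 = {}" "repr n m t1" "repr n m t2"
    and x: "x \<notin> cells n (set_tree t1 \<union> set_tree t2)" "cells n (set_tree t1 \<union> set_tree t2) \<subseteq> A" "x \<in> A"
    and nodes: "set_tree t1 \<union> set_tree t2 \<subseteq> {2..<2 * n}" and sz: "size t1 \<le> H" "size t2 \<le> H"
    and s: "s 0 = n"
    and av: "\<And>s'. (\<forall>i. i \<notin> {3..11} \<longrightarrow> s' i = s i) \<Longrightarrow> aval s' a1 = c1 \<and> aval s' a2 = c2 \<and> aval s' hl = x"
    and c: "c1 \<in> A" "c2 \<in> A" "m c1 = root t1" "m c2 = root t2" "x \<le> W"
  shows "wpr A (load_meld a1 a2 hl) (\<lambda>K s' m'. K \<le> 90 * lg + 9 \<and> (\<forall>i. i \<notin> {3..11} \<longrightarrow> s' i = s i) \<and>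
     m' x = root (meld w t1 t2) \<and> repr n m' (meld w t1 t2) \<and>
     (\<forall>c. c \<notin> insert x (cells n (set_tree t1 \<union> set_tree t2)) \<longrightarrow> m' c = m c)) s m"
proof -
  define Q where "Q = (\<lambda>K (s' :: regs) m'. K \<le> 90 * lg + 9 \<and> (\<forall>i. i \<notin> {3..11} \<longrightarrow> s' i = s i) \<and>
     m' x = root (meld w t1 t2) \<and> repr n m' (meld w t1 t2) \<and>
     (\<forall>c. c \<notin> insert x (cells n (set_tree t1 \<union> set_tree t2)) \<longrightarrow> m' c = m c))"
  have "wpr A (load_meld a1 a2 hl) Q s m"
    unfolding load_meld_def
  proof (rule wp_Seq, rule wp_LoadV[where m = m and c = c1 and v = "root t1", OF _ c(1,3)], use av in simp, rule wp_Seq, rule wp_LoadV[where m = m and c = c2 and v = "root t2", OF _ c(2,4)], use av in simp,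
      rule wp_Seq, rule wp_AssignV[OF _ c(5)], use av in simp, rule wp_conseq[OF meld_wp[OF h x]])
    let ?s = "s(3 := root t1, 4 := root t2, 5 := x)"
    show "?s 0 = n" "?s 3 = root t1" "?s 4 = root t2" "?s 5 = x" using s by auto
    show "addr n 6 a \<le> W" if "a \<in> set_tree t1 \<union> set_tree t2" for a
      using that nodes by (intro node_bound) auto
    show "Suc (size t1 + size t2) \<le> W" using sz H_less by (intro nn_bound) simp
    fix K s' m'
    assume "K \<le> 45 * (spine t1 + spine t2) + 3 \<and> (\<forall>i. i \<notin> {3..11} \<longrightarrow> s' i = ?s i) \<and>
     m' x = root (meld w t1 t2) \<and> repr n m' (meld w t1 t2) \<and>
     (\<forall>c. c \<notin> insert x (cells n (set_tree t1 \<union> set_tree t2)) \<longrightarrow> m' c = m c)"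
    then show "Q (Suc (1 + Suc (1 + Suc (1 + K)))) s' m'"
      using spine_le[OF h(1) sz(1)] spine_le[OF h(2) sz(2)] unfolding Q_def by auto
  qed
  then show ?thesis by (simp only: Q_def)
qed

text \<open>The term \<open>270 * lg\<close> stands for three melds. The intermediate heaps lack a
  root each, so they still have at most \<open>H\<close> nodes and the third meld costs no more than
  the first two.\<close>

lemma merge_wp:
  assumes h: "heap w t" "heap w u" "t = Node t1 a t2" "u = Node u1 (sib a) u2" "set_tree t \<inter> set_tree u = {}"
    "repr n m t" "repr n m u"
    and nodes: "set_tree t \<union> set_tree u \<subseteq> {2..<2 * n}" and sz: "size t \<le> H" "size u \<le> H" "size t + size u \<le> Suc (Suc H)"
    and A: "cells n (set_tree t1 \<union> set_tree t2 \<union> (set_tree u1 \<union> set_tree u2)) \<subseteq> A"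
      "addr n 2 a \<in> A" "addr n 3 a \<in> A" "addr n 2 (sib a) \<in> A" "addr n 3 (sib a) \<in> A"
      "addr n 9 v \<in> A" "addr n 9 (n + v) \<in> A" "out n (edge_of a) \<in> A"
    and s: "s 0 = n" "s 1 = v" "s 14 = a" "v < n"
  shows "wpr A merge_com (\<lambda>K s' m'. K \<le> 270 * lg + 60 \<and> s' 0 = n \<and> s' 1 = v \<and>
     (\<exists>t'. heap w t' \<and> repr n m' t' \<and> set_tree t' = set_tree t1 \<union> set_tree t2 \<union> (set_tree u1 \<union> set_tree u2) \<and>
       s' 14 = root t' \<and> m' (out n (edge_of a)) = root t' div 2) \<and>
     (\<forall>c. c \<notin> {addr n 9 v, addr n 9 (n + v), out n (edge_of a)} \<union>
        cells n (set_tree t1 \<union> set_tree t2 \<union> (set_tree u1 \<union> set_tree u2)) \<longrightarrow> m' c = m c)) s m"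
proof -
  let ?S = "set_tree t1 \<union> set_tree t2" and ?U = "set_tree u1 \<union> set_tree u2"
  let ?x = "addr n 9 v" and ?y = "addr n 9 (n + v)" and ?o = "out n (edge_of a)"
  let ?T1 = "meld w t1 t2" and ?T2 = "meld w u1 u2"
  let ?T = "meld w ?T1 ?T2"
  define Q where "Q = (\<lambda>K (s' :: regs) m'. K \<le> 270 * lg + 60 \<and> s' 0 = n \<and> s' 1 = v \<and>
     (\<exists>t'. heap w t' \<and> repr n m' t' \<and> set_tree t' = ?S \<union> ?U \<and> s' 14 = root t' \<and> m' ?o = root t' div 2) \<and>
     (\<forall>c. c \<notin> {?x, ?y, ?o} \<union> cells n (?S \<union> ?U) \<longrightarrow> m' c = m c))"
  have a2: "2 \<le> a" "a < 2 * n" "2 \<le> sib a" "sib a < 2 * n" using nodes h(3,4) by auto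
  have eo: "Suc (edge_of a) < n" using edge_of_less[of a] a2 Suc_length by auto
  have hs: "heap w t1" "heap w t2" "heap w u1" "heap w u2" "set_tree t1 \<inter> set_tree t2 = {}" "set_tree u1 \<inter> set_tree u2 = {}"
    "?S \<inter> ?U = {}" "a \<notin> ?S \<union> ?U" "sib a \<notin> ?S \<union> ?U"
    using h(1,2,5) unfolding h(3,4) by auto
  have rp: "repr n m t1" "repr n m t2" "repr n m u1" "repr n m u2"
    and mm: "m (addr n 2 a) = root t1" "m (addr n 3 a) = root t2" "m (addr n 2 (sib a)) = root u1" "m (addr n 3 (sib a)) = root u2"
    using h(6,7) unfolding h(3,4) by auto
  have szs: "size t1 \<le> H" "size t2 \<le> H" "size u1 \<le> H" "size u2 \<le> H" "size ?T1 \<le> H" "size ?T2 \<le> H"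
    using sz unfolding h(3,4) by auto
  have hT: "heap w ?T1" "heap w ?T2" "heap w ?T" using hs by (auto intro!: heap_meld)
  have cA: "cells n ?S \<subseteq> A" "cells n ?U \<subseteq> A" using A(1) unfolding cells_Un by blast+
  have nd: "?S \<subseteq> {2..<2*n}" "?U \<subseteq> {2..<2*n}" using nodes unfolding h(3,4) by auto
  have xW: "?x \<le> W" "?y \<le> W" using s(4) by (auto intro!: node_bound)
  have aW: "a \<le> W" "sib a \<le> W" "a div 2 \<le> W" using a2 by (auto intro!: nn_bound)
  have xy: "?x \<noteq> ?y" using n_pos by simp
  have "wpr A merge_com Q s m"
    unfolding merge_com_def
  proof (rule wp_Seq, rule wp_AssignV[where v = "sib a"])
    show "aval s (Minus (Plus (Reg 14) (Lit 1)) (Times (Lit 2) (Mod (Reg 14) (Lit 2)))) = sib a"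
      using s by (simp add: sib_def)
    show "sib a \<le> W" by (rule aW)
    let ?s = "s(15 := sib a)"
    show "wpr A (Seq (load_meld (adr 2 (Reg 14)) (adr 3 (Reg 14)) (adr 9 (Reg 1)))
      (Seq (load_meld (adr 2 (Reg 15)) (adr 3 (Reg 15)) (adr 9 (Plus (Reg 0) (Reg 1))))
      (Seq (load_meld (adr 9 (Reg 1)) (adr 9 (Plus (Reg 0) (Reg 1))) (adr 9 (Reg 1)))
      (Seq (Assign 12 (Div (Reg 14) (Lit 2)))
      (Seq (Load 14 (adr 9 (Reg 1)))
         (Store (Plus (Times (Lit 2) (Minus (Reg 0) (Lit 1))) (Minus (Reg 12) (Lit 1))) (Div (Reg 14) (Lit 2))))))))
       (\<lambda>K'. Q (Suc (1 + K'))) ?s m"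
    proof (rule wp_Seq, rule wp_conseq[OF load_meld_wp[OF hs(1,2,5) rp(1,2) _ cA(1) A(6) nd(1) szs(1,2), where ?a1.0 = "adr 2 (Reg 14)" and ?a2.0 = "adr 3 (Reg 14)" and hl = "adr 9 (Reg 1)"]])
      fix K1 s1 m1
      assume "K1 \<le> 90 * lg + 9 \<and> (\<forall>i. i \<notin> {3..11} \<longrightarrow> s1 i = ?s i) \<and> m1 ?x = root ?T1 \<and> repr n m1 ?T1 \<and>
        (\<forall>c. c \<notin> insert ?x (cells n ?S) \<longrightarrow> m1 c = m c)"
      then have 1: "K1 \<le> 90 * lg + 9" "\<And>i. i \<notin> {3..11} \<Longrightarrow> s1 i = ?s i" "m1 ?x = root ?T1" "repr n m1 ?T1"
        "\<And>c. c \<notin> insert ?x (cells n ?S) \<Longrightarrow> m1 c = m c" by auto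
      have k1: "m1 c = m c" if "c \<in> cells n ?U" for c
      proof -
        have "c \<notin> cells n ?S" using that cells_disjoint[OF hs(7)] by blast
        moreover have "c \<noteq> ?x" using that by (auto simp: cells_def)
        ultimately show ?thesis using 1(5) by blast
      qed
      have r1: "repr n m1 u1" "repr n m1 u2"
        using repr_cong[OF _ rp(3), of m1] repr_cong[OF _ rp(4), of m1] k1 by (auto simp: cells_Un)
      have mm1: "m1 (addr n 2 (sib a)) = root u1" "m1 (addr n 3 (sib a)) = root u2"
        using 1(5) mm hs(9) by auto
      show "wpr A (Seq (load_meld (adr 2 (Reg 15)) (adr 3 (Reg 15)) (adr 9 (Plus (Reg 0) (Reg 1))))
        (Seq (load_meld (adr 9 (Reg 1)) (adr 9 (Plus (Reg 0) (Reg 1))) (adr 9 (Reg 1)))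
        (Seq (Assign 12 (Div (Reg 14) (Lit 2)))
        (Seq (Load 14 (adr 9 (Reg 1)))
         (Store (Plus (Times (Lit 2) (Minus (Reg 0) (Lit 1))) (Minus (Reg 12) (Lit 1))) (Div (Reg 14) (Lit 2)))))))
         (\<lambda>K'. Q (Suc (1 + Suc (K1 + K')))) s1 m1"
      proof (rule wp_Seq, rule wp_conseq[OF load_meld_wp[OF hs(3,4,6) r1 _ cA(2) A(7) nd(2) szs(3,4), where ?a1.0 = "adr 2 (Reg 15)" and ?a2.0 = "adr 3 (Reg 15)" and hl = "adr 9 (Plus (Reg 0) (Reg 1))"]])
        fix K2 s2 m2
        assume "K2 \<le> 90 * lg + 9 \<and> (\<forall>i. i \<notin> {3..11} \<longrightarrow> s2 i = s1 i) \<and> m2 ?y = root ?T2 \<and> repr n m2 ?T2 \<and>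
          (\<forall>c. c \<notin> insert ?y (cells n ?U) \<longrightarrow> m2 c = m1 c)"
        then have 2: "K2 \<le> 90 * lg + 9" "\<And>i. i \<notin> {3..11} \<Longrightarrow> s2 i = s1 i" "m2 ?y = root ?T2" "repr n m2 ?T2"
          "\<And>c. c \<notin> insert ?y (cells n ?U) \<Longrightarrow> m2 c = m1 c" by auto
        have r2: "repr n m2 ?T1"
        proof (rule repr_cong[OF _ 1(4)])
          fix c assume c: "c \<in> cells n (set_tree ?T1)"
          then have "c \<notin> cells n ?U" using cells_disjoint[OF hs(7)] by auto
          moreover have "c \<noteq> ?y" using c by (auto simp: cells_def)
          ultimately show "m1 c = m2 c" using 2(5) by simp
        qed
        have x2: "m2 ?x = root ?T1" using 2(5)[of ?x] 1(3) xy by simp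
        show "wpr A (Seq (load_meld (adr 9 (Reg 1)) (adr 9 (Plus (Reg 0) (Reg 1))) (adr 9 (Reg 1)))
          (Seq (Assign 12 (Div (Reg 14) (Lit 2)))
          (Seq (Load 14 (adr 9 (Reg 1)))
           (Store (Plus (Times (Lit 2) (Minus (Reg 0) (Lit 1))) (Minus (Reg 12) (Lit 1))) (Div (Reg 14) (Lit 2))))))
           (\<lambda>K'. Q (Suc (1 + Suc (K1 + Suc (K2 + K'))))) s2 m2"
        proof (rule wp_Seq, rule wp_conseq[OF load_meld_wp[OF hT(1,2) _ r2 2(4) _ _ A(6) _ szs(5,6), where ?a1.0 = "adr 9 (Reg 1)" and ?a2.0 = "adr 9 (Plus (Reg 0) (Reg 1))" and hl = "adr 9 (Reg 1)"]])
          fix K3 s3 m3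
          assume "K3 \<le> 90 * lg + 9 \<and> (\<forall>i. i \<notin> {3..11} \<longrightarrow> s3 i = s2 i) \<and> m3 ?x = root ?T \<and> repr n m3 ?T \<and>
            (\<forall>c. c \<notin> insert ?x (cells n (set_tree ?T1 \<union> set_tree ?T2)) \<longrightarrow> m3 c = m2 c)"
          then have 3: "K3 \<le> 90 * lg + 9" "\<And>i. i \<notin> {3..11} \<Longrightarrow> s3 i = s2 i" "m3 ?x = root ?T" "repr n m3 ?T"
            "\<And>c. c \<notin> insert ?x (cells n (?S \<union> ?U)) \<Longrightarrow> m3 c = m2 c" by auto
          have s3: "s3 0 = n" "s3 1 = v" "s3 14 = a"
            using 3(2) 2(2) 1(2) s by auto
          have ox: "?o \<noteq> addr n j i" for j i by (rule out_not_addr[OF eo])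
          have rT: "root ?T \<le> W" "root ?T div 2 \<le> W"
          proof -
            have "root ?T = 0 \<or> root ?T \<in> ?S \<union> ?U" using root_in_set[of ?T] by (cases "?T = Leaf") auto
            then have "root ?T \<le> 100 * n" using nd by auto
            then show "root ?T \<le> W" "root ?T div 2 \<le> W" by (auto intro!: nn_bound)
          qed
          have oc: "?o \<notin> cells n C" for C using ox by (auto simp: cells_def)
          have rep: "repr n (m3(?o := root ?T div 2)) ?T"
            by (rule repr_cong[OF _ 3(4)]) (use oc in auto)
          have fr: "(m3(?o := root ?T div 2)) c = m c" if "c \<notin> {?x, ?y, ?o} \<union> cells n (?S \<union> ?U)" for c
            using that 3(5)[of c] 2(5)[of c] 1(5)[of c] by (auto simp: cells_Un)
          show "wpr A (Seq (Assign 12 (Div (Reg 14) (Lit 2)))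
            (Seq (Load 14 (adr 9 (Reg 1)))
             (Store (Plus (Times (Lit 2) (Minus (Reg 0) (Lit 1))) (Minus (Reg 12) (Lit 1))) (Div (Reg 14) (Lit 2)))))
             (\<lambda>K'. Q (Suc (1 + Suc (K1 + Suc (K2 + Suc (K3 + K')))))) s3 m3"
            apply (rule wp_Seq, rule wp_AssignV[where v = "a div 2"], simp add: s3, rule aW(3))
            apply (rule wp_Seq, rule wp_LoadV[where c = ?x and v = "root ?T"], use s3 in simp, rule A(6), rule 3(3))
            apply (rule wp_StoreV[where c = ?o and v = "root ?T div 2"])
                apply (use s3 in \<open>simp add: out_def edge_of_def\<close>)
               apply simp
              apply (rule A(8))
             apply (rule rT(2))
            unfolding Q_def using 1(1) 2(1) 3(1) s3 hT(3) rep fr by (intro conjI exI[of _ ?T] allI impI) auto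
        next
          show "set_tree ?T1 \<inter> set_tree ?T2 = {}" using hs(7) by simp
          show "cells n (set_tree ?T1 \<union> set_tree ?T2) \<subseteq> A" using A(1) by simp
          show "set_tree ?T1 \<union> set_tree ?T2 \<subseteq> {2..<2 * n}" using nd by simp
          show "s2 0 = n" using 2(2) 1(2) s by auto
          show "m2 ?x = root ?T1" "m2 ?y = root ?T2" by (fact x2) (fact 2(3))
          show "?x \<in> A" "?y \<in> A" "?x \<le> W" using A xW by auto
          fix s' :: regs assume "\<forall>i. i \<notin> {3..11} \<longrightarrow> s' i = s2 i"
          then have "s' 0 = n" "s' 1 = v" using 2(2) 1(2) s by auto
          then show "aval s' (adr 9 (Reg 1)) = ?x \<and> aval s' (adr 9 (Plus (Reg 0) (Reg 1))) = ?y \<and> aval s' (adr 9 (Reg 1)) = ?x"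
            by simp
        qed (auto simp: cells_def)
      next
        show "s1 0 = n" using 1(2) s by auto
        show "m1 (addr n 2 (sib a)) = root u1" "m1 (addr n 3 (sib a)) = root u2" by (fact mm1)+
        show "addr n 2 (sib a) \<in> A" "addr n 3 (sib a) \<in> A" "?y \<le> W" using A xW by auto
        fix s' :: regs assume "\<forall>i. i \<notin> {3..11} \<longrightarrow> s' i = s1 i"
        then have "s' 0 = n" "s' 1 = v" "s' 15 = sib a" using 1(2) s by auto
        then show "aval s' (adr 2 (Reg 15)) = addr n 2 (sib a) \<and> aval s' (adr 3 (Reg 15)) = addr n 3 (sib a) \<and>
            aval s' (adr 9 (Plus (Reg 0) (Reg 1))) = ?y" by simp
      qed (auto simp: cells_def)
    next
      show "?s 0 = n" using s by auto
      show "m (addr n 2 a) = root t1" "m (addr n 3 a) = root t2" by (fact mm)+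
      show "addr n 2 a \<in> A" "addr n 3 a \<in> A" "?x \<le> W" using A xW by auto
      fix s' :: regs assume "\<forall>i. i \<notin> {3..11} \<longrightarrow> s' i = ?s i"
      then have "s' 0 = n" "s' 1 = v" "s' 14 = a" using s by auto
      then show "aval s' (adr 2 (Reg 14)) = addr n 2 a \<and> aval s' (adr 3 (Reg 14)) = addr n 3 a \<and> aval s' (adr 9 (Reg 1)) = ?x"
        by simp
    qed (auto simp: cells_def)
  qed
  then show ?thesis by (simp only: Q_def)
qed

end

section \<open>Climbing the dendrogram\<close>

context tree_run
begin

lemma cl_less: "valid_node x \<Longrightarrow> u \<in> cl x \<Longrightarrow> u < n"
  using component_subset[OF node_rep_less[of x]] by (auto simp: node_cluster_comp)

lemma size_heap_half: "heap w t \<Longrightarrow> set_tree t = half (cl x) \<Longrightarrow> valid_node x \<Longrightarrow> size t \<le> card (anc x)"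
  using card_heap[of w t] card_half card_boundary[of x] by simp

lemma insert_loop:
  assumes v: "v < n" and D: "D \<le> H" and inj: "inj_on sl {..<D}" and nodes: "sl ` {..<D} \<subseteq> {2..<2 * n}"
    and A: "addr n 9 v \<in> A" "\<And>i. addr n 8 (i * n + v) \<in> A" "cells n (sl ` {..<D}) \<subseteq> A"
    and "k \<le> D" "s 12 = k" "s 13 = D" "s 0 = n" "s 1 = v"
    and "heap w t" "repr n m t" "set_tree t = sl ` {..<k}" "m (addr n 9 v) = root t"
    and "\<And>i. i < D \<Longrightarrow> m (addr n 8 (i * n + v)) = sl i"
    and "\<And>i j. k \<le> i \<Longrightarrow> i < D \<Longrightarrow> j \<in> {2, 3, 4, 5} \<Longrightarrow> m (addr n j (sl i)) = 0"
  shows "wpr A (While (Less (Reg 12) (Reg 13)) insert_com) (\<lambda>K s' m'. K \<le> (90 * lg + 20) * (D - k) + 1 \<and> s' 0 = n \<and> s' 1 = v \<and>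
     (\<exists>t. heap w t \<and> repr n m' t \<and> set_tree t = sl ` {..<D} \<and> m' (addr n 9 v) = root t)) s m"
  using assms(8-)
proof (induction "D - k" arbitrary: k s m t)
  case 0
  then have "k = D" by simp
  then show ?case using 0 by (intro wp_While_false) auto
next
  case (Suc d)
  then have k: "k < D" by simp
  let ?x = "addr n 9 v" and ?a = "sl k"
  let ?u = "Node Leaf ?a Leaf"
  let ?P = "\<lambda>K s' m'. K \<le> (90 * lg + 20) * (D - k) + 1 \<and> s' 0 = n \<and> s' 1 = v \<and>
     (\<exists>t. heap w t \<and> repr n m' t \<and> set_tree t = sl ` {..<D} \<and> m' (addr n 9 v) = root t)"
  note I = Suc.prems
  have a: "?a \<in> {2..<2*n}" using nodes k by auto
  have ane: "?a \<notin> sl ` {..<k}" using inj_on_image_mem_iff[OF inj, of k "{..<k}"] k by auto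
  have hu: "heap w ?u" using a by simp
  have ru: "repr n m ?u" using I(11)[of k] k by simp
  have ks: "set_tree t \<union> set_tree ?u = sl ` {..<Suc k}" using I(8) by (simp add: lessThan_Suc Un_commute)
  have sub: "sl ` {..<Suc k} \<subseteq> sl ` {..<D}" using k by (intro image_mono) auto
  have st: "size t \<le> H" using card_heap[OF I(6)] card_image_le[of "{..<k}" sl] I(8) k D by simp
  have su: "size ?u \<le> H" using k D by simp
  have slW: "addr n 9 v \<le> W" using v by (intro node_bound) auto
  show ?case
  proof (rule wp_While_true)
    show "bval w s (Less (Reg 12) (Reg 13))" using I k by simp
    show "wpr A insert_com (\<lambda>K s' m'. wpr A (While (Less (Reg 12) (Reg 13)) insert_com) (\<lambda>K'. ?P (Suc (K + K'))) s' m') s m"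
      unfolding insert_com_def
    proof (rule wp_Seq, rule wp_conseq[OF load_meld_wp[of t ?u m ?x A s _ ?x _ "addr n 8 (k * n + v)"]])
      show "heap w t" "heap w ?u" "repr n m t" "repr n m ?u" by fact+
      show "set_tree t \<inter> set_tree ?u = {}" using ane I(8) by simp
      show "?x \<notin> cells n (set_tree t \<union> set_tree ?u)" by simp
      show "cells n (set_tree t \<union> set_tree ?u) \<subseteq> A" unfolding ks using A(3) cells_mono[OF sub] by blast
      show "set_tree t \<union> set_tree ?u \<subseteq> {2..<2 * n}" unfolding ks using sub nodes by blast
      show "size t \<le> H" "size ?u \<le> H" by fact+
      show "m ?x = root t" by (rule I(9))
      show "m (addr n 8 (k * n + v)) = root ?u" using I(10)[OF k] by simp
      show "?x \<in> A" "?x \<in> A" "addr n 8 (k * n + v) \<in> A" "?x \<le> W" "s 0 = n" using A slW I(4) by auto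
      fix s' :: regs
      assume "\<forall>i. i \<notin> {3..11} \<longrightarrow> s' i = s i"
      then have "s' 0 = n" "s' 1 = v" "s' 12 = k" using I by auto
      then show "aval s' (adr 9 (Reg 1)) = ?x \<and> aval s' (adr 8 (Plus (Times (Reg 12) (Reg 0)) (Reg 1))) = addr n 8 (k * n + v)
         \<and> aval s' (adr 9 (Reg 1)) = ?x" by simp
    next
      fix K :: nat and s1 m1
      assume "K \<le> 90 * lg + 9 \<and> (\<forall>i. i \<notin> {3..11} \<longrightarrow> s1 i = s i) \<and> m1 ?x = root (meld w t ?u) \<and> repr n m1 (meld w t ?u) \<and>
        (\<forall>c. c \<notin> insert ?x (cells n (set_tree t \<union> set_tree ?u)) \<longrightarrow> m1 c = m c)"
      then have 1: "K \<le> 90 * lg + 9" "\<And>i. i \<notin> {3..11} \<Longrightarrow> s1 i = s i" "m1 ?x = root (meld w t ?u)" "repr n m1 (meld w t ?u)"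
        "\<And>c. c \<notin> insert ?x (cells n (sl ` {..<Suc k})) \<Longrightarrow> m1 c = m c" using ks by auto
      have kW: "Suc k \<le> W" using k D H_less by (intro nn_bound) simp
      show "wpr A (Assign 12 (Plus (Reg 12) (Lit 1))) (\<lambda>K'. (\<lambda>K s' m'. wpr A (While (Less (Reg 12) (Reg 13))
          (Seq (load_meld (adr 9 (Reg 1)) (adr 8 (Plus (Times (Reg 12) (Reg 0)) (Reg 1))) (adr 9 (Reg 1)))
         (Assign 12 (Plus (Reg 12) (Lit 1))))) (\<lambda>K'. ?P (Suc (K + K'))) s' m') (Suc (K + K'))) s1 m1"
        unfolding insert_com_def[symmetric]
      proof (rule wp_AssignV[where v = "Suc k"])
        show "aval s1 (Plus (Reg 12) (Lit 1)) = Suc k" using 1(2)[of 12] I by simp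
        show "Suc k \<le> W" by (rule kW)
        show "wpr A (While (Less (Reg 12) (Reg 13)) insert_com) (\<lambda>K'. ?P (Suc (Suc (K + 1) + K'))) (s1(12 := Suc k)) m1"
        proof (rule wp_conseq[OF Suc.hyps(1)])
          show "d = D - Suc k" using Suc.hyps(2) by simp
          show "Suc k \<le> D" using k by simp
          show "heap w (meld w t ?u)" using ane I(6,8) hu by (intro heap_meld) auto
          show "repr n m1 (meld w t ?u)" "m1 ?x = root (meld w t ?u)" by fact+
          show "set_tree (meld w t ?u) = sl ` {..<Suc k}" using ks by simp
          show "m1 (addr n 8 (i * n + v)) = sl i" if "i < D" for i
            using 1(5)[of "addr n 8 (i * n + v)"] I(10)[OF that] by simp
          show "m1 (addr n j (sl i)) = 0" if "Suc k \<le> i" "i < D" "j \<in> {2, 3, 4, 5}" for i j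
          proof -
            have "sl i \<notin> sl ` {..<Suc k}"
              using inj_on_image_mem_iff[OF inj, of i "{..<Suc k}"] that by auto
            moreover have "addr n j (sl i) \<noteq> ?x" using that(3) by auto
            ultimately show ?thesis using 1(5)[of "addr n j (sl i)"] I(11)[of i j] that by auto
          qed
          fix K' :: nat and s2 :: regs and m2
          assume "K' \<le> (90 * lg + 20) * (D - Suc k) + 1 \<and> s2 0 = n \<and> s2 1 = v \<and>
            (\<exists>t. heap w t \<and> repr n m2 t \<and> set_tree t = sl ` {..<D} \<and> m2 ?x = root t)"
          moreover have "(90 * lg + 20) * (D - k) = (90 * lg + 20) * (D - Suc k) + (90 * lg + 20)"
            using k by (metis Suc_diff_Suc mult_Suc_right add.commute)
          ultimately show "?P (Suc (Suc (K + 1) + K')) s2 m2" using 1(1) by simp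
        qed (use 1(2) I in auto)
      qed
    qed
  qed
qed

lemma build_wp:
  assumes v: "v < n" and m: "inj_on sl {..<D}" "sl ` {..<D} = half {v}"
    "m (addr n 7 v) = D" "\<And>i. i < D \<Longrightarrow> m (addr n 8 (i * n + v)) = sl i"
    "\<And>a j. a \<in> half {v} \<Longrightarrow> j \<in> {2, 3, 4, 5} \<Longrightarrow> m (addr n j a) = 0" "m (addr n 9 v) = 0"
    and A: "addr n 7 v \<in> A" "addr n 9 v \<in> A" "\<And>i. addr n 8 (i * n + v) \<in> A" "cells n (half {v}) \<subseteq> A"
    and s: "s 0 = n" "s 1 = v"
  shows "wpr A build_com (\<lambda>K s' m'. K \<le> (90 * lg + 20) * D + 10 \<and> s' 0 = n \<and> s' 1 = v \<and>
     (\<exists>t. heap w t \<and> repr n m' t \<and> set_tree t = half {v} \<and> s' 14 = root t)) s m"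
proof -
  define Q where "Q = (\<lambda>K (s' :: regs) m'. K \<le> (90 * lg + 20) * D + 10 \<and> s' 0 = n \<and> s' 1 = v \<and>
     (\<exists>t. heap w t \<and> repr n m' t \<and> set_tree t = half {v} \<and> s' 14 = root t))"
  \<comment> \<open>All edges at \<open>v\<close> leave its singleton cluster and are ancestors of
    its leaf, so degrees are bounded by the height.\<close>
  have "D = card (half {v})" using card_image[OF m(1)] m(2) by simp
  also have "\<dots> \<le> card (anc (Vertex v))"
    using card_half[of "{v}"] card_boundary[of "Vertex v"] v by simp
  also have "\<dots> \<le> H" by (rule card_anc_vertex[OF v])
  finally have D: "D \<le> H" .
  then have DW: "D \<le> W" using H_less by (intro nn_bound) simp
  have nodes: "sl ` {..<D} \<subseteq> {2..<2 * n}" unfolding m(2) by (auto simp: half_def)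
  have "wpr A build_com Q s m"
    unfolding build_com_def
    apply (rule wp_Seq, rule wp_LoadV[where c = "addr n 7 v" and v = D], use s in simp, rule A(1), rule m(3))
    apply (rule wp_Seq, rule wp_AssignV[where v = 0], simp, simp)
  proof (rule wp_Seq, rule wp_conseq[OF insert_loop[OF v D m(1) nodes A(2,3), where k = 0 and t = Leaf]])
    show "cells n (sl ` {..<D}) \<subseteq> A" using A(4) m(2) by simp
    show "m (addr n j (sl i)) = 0" if "0 \<le> i" "i < D" "j \<in> {2, 3, 4, 5}" for i j
      by (rule m(5)) (use m(2) that in auto)
    fix K :: nat and s' :: regs and m'
    assume "K \<le> (90 * lg + 20) * (D - 0) + 1 \<and> s' 0 = n \<and> s' 1 = v \<and>
       (\<exists>t. heap w t \<and> repr n m' t \<and> set_tree t = sl ` {..<D} \<and> m' (addr n 9 v) = root t)"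
    then obtain t where K: "K \<le> (90 * lg + 20) * D + 1" and s': "s' 0 = n" "s' 1 = v"
      and t: "heap w t" "repr n m' t" "set_tree t = half {v}" "m' (addr n 9 v) = root t"
      using m(2) by auto
    show "wpr A (Load 14 (adr 9 (Reg 1))) (\<lambda>K'. Q (Suc (1 + Suc (1 + Suc (K + K'))))) s' m'"
    proof (rule wp_LoadV[where c = "addr n 9 v" and v = "root t"])
      show "aval s' (adr 9 (Reg 1)) = addr n 9 v" using s' by simp
      show "Q (Suc (1 + Suc (1 + Suc (K + 1)))) (s'(14 := root t)) m'"
        unfolding Q_def using K s' t by (intro conjI exI[of _ t]) auto
    qed (use A(2) t(4) in auto)
  qed (use s m(4,6) in auto)
  then show ?thesis by (simp only: Q_def)
qed

text \<open>The resource that changes hands when clusters meet: the tokens of exactly its vertices,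
  the finished output of the edges inside, and the heap of those leaving. Tokens force clusters held
  at the same time to be disjoint, without any global record of the partition.\<close>

definition cluster_tree :: "memory \<Rightarrow> sld_node \<Rightarrow> nat set \<Rightarrow> nat tree \<Rightarrow> bool" where
  "cluster_tree m x Z t \<longleftrightarrow> valid_node x \<and> (\<forall>u<n. addr n 7 u \<in> Z \<longleftrightarrow> u \<in> cl x) \<and>
     out n ` internal (cl x) \<subseteq> Z \<and> (\<forall>e \<in> internal (cl x). m (out n e) = out_value e) \<and>
     cells n (half (cl x)) \<subseteq> Z \<and> heap w t \<and> repr n m t \<and> set_tree t = half (cl x)"

lemma cluster_tree_cong:
  assumes "cluster_tree m x Z t" "agree Z m m'" "Z \<subseteq> Z'" "\<forall>u<n. addr n 7 u \<in> Z' \<longrightarrow> addr n 7 u \<in> Z"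
  shows "cluster_tree m' x Z' t"
proof -
  note c = assms(1)[unfolded cluster_tree_def]
  have "repr n m' t" by (rule repr_cong[of n t m]) (use c assms(2) in \<open>auto simp: agree_def\<close>)
  moreover have "m' (out n e) = out_value e" if "e \<in> internal (cl x)" for e
  proof -
    have "out n e \<in> Z" using c that by blast
    then have "m' (out n e) = m (out n e)" using assms(2) by (simp add: agree_def)
    then show ?thesis using c that by simp
  qed
  ultimately show ?thesis using c assms(3,4) unfolding cluster_tree_def by blast
qed

text \<open>One merge takes at most \<open>270 * lg + 60\<close> steps; the remaining
  \<open>40\<close> allow for the loop around it.\<close>

definition step_cost :: nat where
  "step_cost = 270 * lg + 100"

definition no_token :: "nat set \<Rightarrow> bool" where
  "no_token Z \<longleftrightarrow> (\<forall>u<n. addr n 7 u \<notin> Z)"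

text \<open>
  The counter of edge \<open>f\<close> is the number of its two clusters that have arrived. The first one is deposited
  with \<open>step_cost\<close> credits. After the second one, the size fields of both nodes of \<open>f\<close> stay behind, so
  that nobody can own a heap with root at \<open>f\<close> again. Cell \<open>addr n 7 u\<close> serves as a token for vertex \<open>u\<close>.
\<close>

definition edge_inv :: "nat \<Rightarrow> memory \<Rightarrow> nat set \<Rightarrow> bool" where
  "edge_inv f m Z \<longleftrightarrow> addr n 6 (Suc f) \<in> Z \<and>
     (m (addr n 6 (Suc f)) = 0 \<and> out n f \<in> Z \<and> no_token Z \<or>
      m (addr n 6 (Suc f)) = 1 \<and> out n f \<in> Z \<and> (\<exists>x t. cluster_tree m x Z t \<and> sld_parent n es x = Some f) \<or>
      m (addr n 6 (Suc f)) = 2 \<and> addr n 5 (2 * f + 2) \<in> Z \<and> addr n 5 (2 * f + 3) \<in> Z \<and> no_token Z)"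

lemma edge_inv_cong: "edge_inv f m Z \<Longrightarrow> agree Z m m' \<Longrightarrow> edge_inv f m' Z"
proof -
  assume a: "edge_inv f m Z" "agree Z m m'"
  then have "m' (addr n 6 (Suc f)) = m (addr n 6 (Suc f))" by (auto simp: edge_inv_def agree_def)
  moreover have "cluster_tree m' x Z t" if "cluster_tree m x Z t" for x t
    by (rule cluster_tree_cong[OF that a(2)]) auto
  ultimately show ?thesis using a(1) unfolding edge_inv_def by metis
qed

text \<open>The extra part with index \<open>length es\<close> collects the shared cells that belong
  to no edge. Counting the counters with value \<open>1\<close> counts the waiting clusters, each of
  which has deposited its credits.\<close>

definition climb_inv :: inv where
  "climb_inv m Y c \<longleftrightarrow> (\<exists>z. Y = (\<Union>f\<le>length es. z f) \<and> disjoint_family_on z {..length es} \<and>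
     step_cost * card {f. f < length es \<and> m (addr n 6 (Suc f)) = 1} \<le> c \<and>
     (\<forall>f<length es. edge_inv f m (z f)) \<and> no_token (z (length es)))"

lemma climb_inv_local: "local_inv climb_inv"
  unfolding local_inv_def
proof (intro allI impI)
  fix m m' Y c assume a: "agree Y m m'" "climb_inv m Y c"
  obtain z where z: "Y = (\<Union>f\<le>length es. z f)" "disjoint_family_on z {..length es}"
    "step_cost * card {f. f < length es \<and> m (addr n 6 (Suc f)) = 1} \<le> c"
    "\<forall>f<length es. edge_inv f m (z f)" "no_token (z (length es))" using a(2) unfolding climb_inv_def by blast
  have ag: "agree (z f) m m'" if "f < length es" for f
    by (rule agree_mono[OF a(1)]) (use z(1) that in auto)
  have "m' (addr n 6 (Suc f)) = m (addr n 6 (Suc f))" if "f < length es" for f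
    using ag[OF that] z(4) that by (auto simp: edge_inv_def agree_def)
  then have "{f. f < length es \<and> m' (addr n 6 (Suc f)) = 1} = {f. f < length es \<and> m (addr n 6 (Suc f)) = 1}" by auto
  then show "climb_inv m' Y c"
    unfolding climb_inv_def using z ag edge_inv_cong by (intro exI[of _ z]) auto
qed

declare node_cluster.simps(2) [simp del]

lemma root_edge:
  assumes "cluster_tree m x X t" "sld_parent n es x = Some f"
  shows "t \<noteq> Leaf" "root t \<in> half (cl x)" "edge_of (root t) = f" "root t = 2 * f + 2 \<or> root t = 2 * f + 3"
    "2 \<le> root t"
proof -
  note c = assms(1)[unfolded cluster_tree_def]
  have "sld_parent n es x = (if t = Leaf then None else Some (edge_of (root t)))"
    by (rule sld_parent_heap) (use c in auto)
  then show t: "t \<noteq> Leaf" and e: "edge_of (root t) = f" using assms(2) by (auto split: if_splits)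
  show r: "root t \<in> half (cl x)" using root_in_set[OF t] c by simp
  then show "2 \<le> root t" by (simp add: half_def)
  then show "root t = 2 * f + 2 \<or> root t = 2 * f + 3" using edge_nodes e by blast
qed

lemma cluster_disjoint:
  assumes "cluster_tree m x X t" "cluster_tree m' y Z u" "X \<inter> Z = {}"
  shows "cl x \<inter> cl y = {}"
proof (rule ccontr)
  assume "cl x \<inter> cl y \<noteq> {}"
  then obtain v where v: "v \<in> cl x" "v \<in> cl y" by blast
  then have "v < n" using cl_less assms(1) by (auto simp: cluster_tree_def)
  then have "addr n 7 v \<in> X \<inter> Z" using v assms(1,2) by (auto simp: cluster_tree_def)
  then show False using assms(3) by simp
qed

text \<open>Value \<open>2\<close> is impossible: the invariant would own the size fields of both
  nodes of \<open>f\<close>, one of which is in the heap of the arriving cluster. At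
  \<open>0\<close> the cluster and its cells go into the invariant. At \<open>1\<close> the waiting
  cluster and its credits come out, and the two size fields go in, which closes the edge for
  good.\<close>

lemma climb_inv_arrive:
  assumes I: "climb_inv m Y e" and d: "X \<inter> Y = {}" and c: "cluster_tree m x X t" and p: "sld_parent n es x = Some f"
  defines "k \<equiv> addr n 6 (Suc f)" and "m1 \<equiv> m(addr n 6 (Suc f) := Suc (m (addr n 6 (Suc f))))"
  shows "k \<in> Y" and "m k = 0 \<or> m k = 1"
    and "m k = 0 \<Longrightarrow> climb_inv m1 (X \<union> Y) (e + step_cost)"
    and "m k = 1 \<Longrightarrow> \<exists>Z y u. Z \<subseteq> Y \<and> step_cost \<le> e \<and> cluster_tree m y Z u \<and> sld_parent n es y = Some f \<and>
      out n f \<in> Z \<and> {k, addr n 5 (2 * f + 2), addr n 5 (2 * f + 3)} \<subseteq> X \<union> Z \<and>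
      climb_inv m1 ((Y - Z) \<union> {k, addr n 5 (2 * f + 2), addr n 5 (2 * f + 3)}) (e - step_cost)"
proof -
  let ?J = "{f. f < length es \<and> m (addr n 6 (Suc f)) = 1}" and ?J1 = "{f. f < length es \<and> m1 (addr n 6 (Suc f)) = 1}"
  let ?T = "{k, addr n 5 (2 * f + 2), addr n 5 (2 * f + 3)}"
  have x: "valid_node x" using c by (simp add: cluster_tree_def)
  have f: "f < length es" by (rule sld_parent_SomeD(2)[OF x p])
  note r = root_edge[OF c p]
  obtain z where z: "Y = (\<Union>f\<le>length es. z f)" "disjoint_family_on z {..length es}"
    "step_cost * card ?J \<le> e" "\<And>f. f < length es \<Longrightarrow> edge_inv f m (z f)" "no_token (z (length es))"
    using I unfolding climb_inv_def by blast
  have zY: "z g \<subseteq> Y" if "g \<le> length es" for g using z(1) that by auto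
  have zd: "z g \<inter> z h = {}" if "g \<le> length es" "h \<le> length es" "g \<noteq> h" for g h
    using disjoint_family_onD[OF z(2)] that by simp
  have kz: "k \<in> z f" using z(4)[OF f] by (simp add: edge_inv_def k_def)
  then show kY: "k \<in> Y" using zY f by (meson less_imp_le subsetD)
  have rX: "addr n 5 (root t) \<in> X"
    using c r(2) unfolding cluster_tree_def by (auto simp: cells_def)
  then have rY: "addr n 5 (root t) \<notin> Y" using d by blast
  show k01: "m k = 0 \<or> m k = 1"
  proof (rule ccontr)
    assume "\<not> ?thesis"
    then have "addr n 5 (2 * f + 2) \<in> z f" "addr n 5 (2 * f + 3) \<in> z f"
      using z(4)[OF f] by (auto simp: edge_inv_def k_def)
    then show False using rY r(4) zY[of f] f by auto
  qed
  have inv_other: "edge_inv g m1 (z g)" if "g < length es" "g \<noteq> f" for g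
  proof (rule edge_inv_cong[OF z(4)[OF that(1)]])
    have "k \<notin> z g" using kz zd[of g f] that f by auto
    then show "agree (z g) m m1" by (auto simp: agree_def m1_def k_def)
  qed
  have finJ: "finite ?J" by simp
  {
    assume k0: "m k = 0"
    have "?J1 = insert f ?J" using k0 f by (auto simp: m1_def k_def)
    moreover have "f \<notin> ?J" using k0 by (simp add: k_def)
    ultimately have cJ: "card ?J1 = Suc (card ?J)" using finJ by simp
    define z' where "z' = z(f := z f \<union> X)"
    have "(\<Union>g\<le>length es. z' g) = X \<union> Y"
      using f unfolding z(1) z'_def by (auto split: if_splits) 
    moreover have "disjoint_family_on z' {..length es}"
      unfolding disjoint_family_on_def
    proof (intro ballI impI)
      fix g h assume gh: "g \<in> {..length es}" "h \<in> {..length es}" "g \<noteq> h"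
      have "X \<inter> z g = {}" "X \<inter> z h = {}" using d zY gh by auto
      then show "z' g \<inter> z' h = {}" using zd[of g h] gh by (auto simp: z'_def)
    qed
    moreover have ef: "edge_inv f m1 (z' f)"
    proof -
      have tok: "no_token (z f)" "out n f \<in> z f" using z(4)[OF f] k0 by (auto simp: edge_inv_def k_def)
      have "k \<notin> X" using kY d by blast
      then have "agree X m m1" by (auto simp: agree_def m1_def k_def)
      then have "cluster_tree m1 x (z' f) t"
        using tok(1) by (intro cluster_tree_cong[OF c]) (auto simp: z'_def no_token_def)
      then show ?thesis using tok(2) kz k0 p unfolding edge_inv_def by (auto simp: z'_def m1_def k_def)
    qed
    have "edge_inv g m1 (z' g)" if "g < length es" "g \<noteq> f" for g
      using inv_other[OF that] that by (simp add: z'_def)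
    then have "\<forall>g<length es. edge_inv g m1 (z' g)" using ef by metis
    moreover have "no_token (z' (length es))" using z(5) f by (simp add: z'_def)
    ultimately show "climb_inv m1 (X \<union> Y) (e + step_cost)"
      unfolding climb_inv_def using z(3) cJ by (intro exI[of _ z'] conjI) simp_all
  }
  {
    assume k1: "m k = 1"
    have "edge_inv f m (z f)" by (rule z(4)[OF f])
    then have "out n f \<in> z f \<and> (\<exists>x t. cluster_tree m x (z f) t \<and> sld_parent n es x = Some f)"
      using k1[unfolded k_def] unfolding edge_inv_def by simp
    then obtain y u where y: "cluster_tree m y (z f) u" "sld_parent n es y = Some f" and o: "out n f \<in> z f"
      by (elim conjE exE)
    have fJ: "f \<in> ?J" using k1 f by (simp add: k_def)
    have J1: "?J1 = ?J - {f}" using k1 by (auto simp: m1_def k_def)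
    have "card ?J = Suc (card ?J1)" unfolding J1 by (rule card_Suc_Diff1[OF finJ fJ, symmetric])
    then have cr: "step_cost \<le> e" "step_cost * card ?J1 \<le> e - step_cost" using z(3) by auto
    have dis: "X \<inter> z f = {}" using d zY[of f] f by auto
    note cd = cluster_disjoint[OF c y(1) dis]
    have yv: "valid_node y" using y(1) by (simp add: cluster_tree_def)
    have sb: "sib (root t) \<in> half (cl y)" by (rule half_merge(1)[OF x p yv y(2) cd r(2,3)])
    have sz: "addr n 5 (sib (root t)) \<in> z f"
      using sb y(1) unfolding cluster_tree_def by (auto simp: cells_def)
    have rs: "{2 * f + 2, 2 * f + 3} = {root t, sib (root t)}"
      using r(4) sib_even[of "2 * f + 2"] sib_odd[of "2 * f + 3"] by auto
    have TT: "?T = {k, addr n 5 (root t), addr n 5 (sib (root t))}"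
      using arg_cong[OF rs, of "\<lambda>S. insert k (addr n 5 ` S)"] by simp
    have TX: "?T \<subseteq> X \<union> z f" unfolding TT using rX sz kz by blast
    define z' where "z' = z(f := ?T)"
    have "(\<Union>g\<le>length es. z' g) = (Y - z f) \<union> ?T"
    proof -
      have "{..length es} = insert f ({..length es} - {f})" using f by auto
      then have "(\<Union>g\<le>length es. z' g) = z' f \<union> (\<Union>g\<in>{..length es} - {f}. z' g)"
        by (metis UN_insert)
      also have "(\<Union>g\<in>{..length es} - {f}. z' g) = (\<Union>g\<in>{..length es} - {f}. z g)"
        by (intro SUP_cong) (auto simp: z'_def)
      also have "z' f = ?T" by (simp add: z'_def)
      also have "(\<Union>g\<in>{..length es} - {f}. z g) = Y - z f"
      proof (intro equalityI subsetI)
        fix c assume "c \<in> (\<Union>g\<in>{..length es} - {f}. z g)"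
        then obtain g where "g \<le> length es" "g \<noteq> f" "c \<in> z g" by auto
        then show "c \<in> Y - z f" using zd[of g f] zY[of g] f by auto
      next
        fix c assume "c \<in> Y - z f"
        then show "c \<in> (\<Union>g\<in>{..length es} - {f}. z g)" using z(1) by auto
      qed
      finally show ?thesis by (simp only: Un_commute)
    qed
    moreover have "disjoint_family_on z' {..length es}"
      unfolding disjoint_family_on_def
    proof (intro ballI impI)
      fix g h assume gh: "g \<in> {..length es}" "h \<in> {..length es}" "g \<noteq> h"
      have T: "?T \<inter> z g = {}" if "g \<le> length es" "g \<noteq> f" for g
      proof -
        have "X \<inter> z g = {}" "z f \<inter> z g = {}" using d zY[OF that(1)] zd[of f g] that f by auto
        then show ?thesis using TX by blast
      qed
      show "z' g \<inter> z' h = {}" using T[of g] T[of h] zd[of g h] gh by (auto simp: z'_def)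
    qed
    moreover have ef: "edge_inv f m1 (z' f)"
      using k1 unfolding edge_inv_def by (simp add: z'_def m1_def k_def no_token_def)
    have "edge_inv g m1 (z' g)" if "g < length es" "g \<noteq> f" for g
      using inv_other[OF that] that by (simp add: z'_def)
    then have "\<forall>g<length es. edge_inv g m1 (z' g)" using ef by metis
    moreover have "no_token (z' (length es))" using z(5) f by (simp add: z'_def)
    ultimately have "climb_inv m1 ((Y - z f) \<union> ?T) (e - step_cost)"
      unfolding climb_inv_def using cr(2) by (intro exI[of _ z'] conjI) simp_all
    then show "\<exists>Z y u. Z \<subseteq> Y \<and> step_cost \<le> e \<and> cluster_tree m y Z u \<and> sld_parent n es y = Some f \<and>
      out n f \<in> Z \<and> ?T \<subseteq> X \<union> Z \<and> climb_inv m1 ((Y - Z) \<union> ?T) (e - step_cost)"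
      using zY[of f] f cr(1) y o TX by (intro exI[of _ "z f"] exI[of _ y] exI[of _ u]) simp
  }
qed

text \<open>The cells removed remain with the invariant. The merged cluster can do without them,
  since \<open>f\<close> is now internal and its two nodes are in no heap any more.\<close>

lemma cluster_tree_merge:
  assumes c: "cluster_tree m x X t" "sld_parent n es x = Some f" and c': "cluster_tree m y Z u" "sld_parent n es y = Some f"
    and d: "X \<inter> Z = {}" and o: "out n f \<in> Z"
    and t: "t = Node t1 a t2" "u = Node u1 (sib a) u2"
    and new: "heap w t'" "repr n m' t'" "set_tree t' = set_tree t1 \<union> set_tree t2 \<union> (set_tree u1 \<union> set_tree u2)"
      "m' (out n f) = root t' div 2"
    and same: "\<And>e. e \<noteq> f \<Longrightarrow> e < length es \<Longrightarrow> m' (out n e) = m (out n e)"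
  shows "cluster_tree m' (Edge f) (X \<union> Z - {addr n 6 (Suc f), addr n 5 a, addr n 5 (sib a)}) t'"
proof -
  have v: "valid_node x" "valid_node y" using c(1) c'(1) by (auto simp: cluster_tree_def)
  note cd = cluster_disjoint[OF c(1) c'(1) d]
  note r = root_edge[OF c]
  have f: "f < length es" by (rule sld_parent_SomeD(2)[OF v(1) c(2)])
  have a: "a \<in> half (cl x)" "edge_of a = f" using r t by auto
  have cl: "cl (Edge f) = cl x \<union> cl y" by (rule node_cluster_merge[OF v(1) c(2) v(2) c'(2) cd])
  have st: "set_tree t' = half (cl (Edge f))"
  proof -
    have "set_tree t = half (cl x)" "set_tree u = half (cl y)" "heap w t" "heap w u"
      using c(1) c'(1) by (auto simp: cluster_tree_def)
    then have "set_tree t1 \<union> set_tree t2 = half (cl x) - {a}" "set_tree u1 \<union> set_tree u2 = half (cl y) - {sib a}"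
      unfolding t by auto
    then show ?thesis unfolding cl half_merge(2)[OF v(1) c(2) v(2) c'(2) cd a] new(3) by (simp only:)
  qed
  have int: "internal (cl (Edge f)) = insert f (internal (cl x) \<union> internal (cl y))"
    unfolding cl by (rule internal_merge[OF v(1) c(2) v(2) c'(2) cd])
  let ?X = "X \<union> Z - {addr n 6 (Suc f), addr n 5 a, addr n 5 (sib a)}"
  have oa: "out n e \<noteq> addr n j i" if "e < length es" for e j i
    by (rule out_not_addr) (use that Suc_length in simp)
  have il: "e < length es" if "e \<in> internal C" for e C using that by (simp add: internal_def)
  have "out n ` internal (cl (Edge f)) \<subseteq> ?X"
    unfolding int using c(1) c'(1) o oa[OF f] oa[OF il] unfolding cluster_tree_def by auto
  moreover have "m' (out n e) = out_value e" if "e \<in> internal (cl (Edge f))" for e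
  proof (cases "e = f")
    case True
    then show ?thesis using new(4) out_value_heap[OF f new(1) st] by simp
  next
    case False
    then have "e \<in> internal (cl x) \<or> e \<in> internal (cl y)" using that int by simp
    then have "m (out n e) = out_value e" using c(1) c'(1) by (auto simp: cluster_tree_def)
    then show ?thesis using same[OF False il[OF that]] by simp
  qed
  moreover have "cells n (half (cl (Edge f))) \<subseteq> ?X"
  proof -
    have na: "a \<notin> half (cl (Edge f))" "sib a \<notin> half (cl (Edge f))"
      using half_boundary[of _ "cl (Edge f)"] a(2) sib_props(4)[of a] r(5) t f int
      by (auto simp: boundary_def internal_def)
    have "half (cl (Edge f)) \<subseteq> half (cl x) \<union> half (cl y)"
      unfolding cl half_merge(2)[OF v(1) c(2) v(2) c'(2) cd a] by blast
    then have "cells n (half (cl (Edge f))) \<subseteq> cells n (half (cl x)) \<union> cells n (half (cl y))"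
      unfolding cells_Un[symmetric] by (rule cells_mono)
    moreover have "cells n (half (cl x)) \<subseteq> X" "cells n (half (cl y)) \<subseteq> Z"
      using c(1) c'(1) by (simp_all add: cluster_tree_def)
    ultimately have "cells n (half (cl (Edge f))) \<subseteq> X \<union> Z" by blast
    moreover have "addr n 6 (Suc f) \<notin> cells n (half (cl (Edge f)))" by simp
    ultimately show ?thesis using na by auto
  qed
  moreover have "addr n 7 i \<in> ?X \<longleftrightarrow> i \<in> cl (Edge f)" if "i < n" for i
    using c(1) c'(1) that unfolding cl cluster_tree_def by auto
  ultimately show ?thesis
    using f new(1,2) st unfolding cluster_tree_def by auto
qed

definition thread_post :: "memory \<Rightarrow> nat set \<Rightarrow> bool" where
  "thread_post m X \<longleftrightarrow> no_token X \<or> (\<exists>x t. cluster_tree m x X t \<and> sld_parent n es x = None)"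

lemma thread_post_cong: "agree X m m' \<Longrightarrow> thread_post m X \<Longrightarrow> thread_post m' X"
  using cluster_tree_cong[of m _ X _ m' X] unfolding thread_post_def by blast

definition climb_post :: "nat \<Rightarrow> post" where
  "climb_post D s d m X c \<longleftrightarrow> s 0 = n \<and> d \<le> D \<and> thread_post m X"

lemma climb_stop:
  assumes "s 0 = n" "s 14 = 0" "d < D" "0 < c" "thread_post m X"
  shows "sf climb_inv (climb_post D) (Run [climb_com] s d) m X c"
proof -
  have e: "sf climb_inv (climb_post D) (Run [] s (Suc d)) m X (c - 1)"
  proof (rule safe_end)
    fix m' assume "agree X m m'"
    then show "climb_post D s (Suc d) m' X (c - 1)"
      using assms thread_post_cong by (simp add: climb_post_def)
  qed
  have c: "c = Suc (c - 1)" using assms(4) by simp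
  show ?thesis unfolding climb_com_def by (subst c, rule safe_While) (use e assms(2) in simp)
qed

text \<open>Induction along the path to the root. Credits stay level: a merge consumes less than
  \<open>step_cost\<close>, and the waiting cluster contributes \<open>step_cost\<close>, so each
  iteration starts with \<open>step_cost + 20\<close> again. A thread that arrives first leaves
  \<open>step_cost\<close> behind and ends on what remains. Depth is not level, it grows by at most
  \<open>step_cost + 20\<close> per ancestor.\<close>

lemma climb_safe:
  assumes "cluster_tree m x X t" "s 0 = n" "s 1 = v" "v < n" "s 14 = root t"
    "addr n 9 v \<in> X" "addr n 9 (n + v) \<in> X" "card (anc x) \<le> H" "step_cost + 20 \<le> c"
    "d + (step_cost + 20) * card (anc x) + 20 \<le> D"
  shows "sf climb_inv (climb_post D) (Run [climb_com] s d) m X c"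
  using assms
proof (induction "card (anc x)" arbitrary: x X t s d m c rule: less_induct)
  case less
  note c = less.prems(1)
  have x: "valid_node x" using c by (simp add: cluster_tree_def)
  show ?case
  proof (cases t)
    case Leaf
    have "sld_parent n es x = None"
      using sld_parent_heap[OF x, of t] c Leaf by (simp add: cluster_tree_def)
    then show ?thesis
      using less.prems Leaf by (intro climb_stop) (auto simp: thread_post_def)
  next
    case t: (Node t1 a t2)
    define f where "f = edge_of a"
    have p: "sld_parent n es x = Some f"
      using sld_parent_heap[OF x, of t] c t by (simp add: cluster_tree_def f_def)
    note r = root_edge[OF c p]
    have a: "a \<in> half (cl x)" "edge_of a = f" "2 \<le> a" "a \<in> {2..<2 * n}" using r t half_range by auto
    have f: "f < length es" by (rule sld_parent_SomeD(2)[OF x p])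
    have fn: "Suc f < n" using f Suc_length by simp
    let ?k = "addr n 6 (Suc f)"
    let ?fetch = "Fetch_Inc 16 (adr 6 (Div (Reg 14) (Lit 2)))"
    let ?cond = "Cond (Less (Lit 0) (Reg 16)) merge_com (Assign 14 (Lit 0))"
    have s14: "s 14 = a" using less.prems(5) t by simp
    have k: "aval s (adr 6 (Div (Reg 14) (Lit 2))) = ?k"
      using less.prems(2) s14 div2_edge_of[OF a(3)] a(2) by simp
    have cc: "card (anc x) = Suc (card (anc (Edge f)))" by (rule card_anc_parent[OF x p])
    have main: "sf climb_inv (climb_post D) (Run (?fetch # ?cond # [climb_com]) s (Suc (Suc d))) m X (c - 2)"
    proof (rule safe_Fetch_Inc, unfold k)
      fix m0 Y e
      assume b: "range s \<subseteq> {..W}" "range m0 \<subseteq> {..W}" "agree X m m0" "X \<inter> Y = {}" "climb_inv m0 Y e"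
      have c0: "cluster_tree m0 x X t" by (rule cluster_tree_cong[OF c b(3)]) auto
      note ar = climb_inv_arrive[OF b(5,4) c0 p]
      let ?m1 = "m0(?k := Suc (m0 ?k))" and ?s1 = "s(16 := m0 ?k)"
      have kW: "Suc (m0 ?k) \<le> W" using ar(2) n_pos by (intro nn_bound) auto
      have "\<exists>X' c' Y' e'. X' \<union> Y' = X \<union> Y \<and> X' \<inter> Y' = {} \<and> c' + e' < c - 2 + e \<and> climb_inv ?m1 Y' e' \<and>
        sf climb_inv (climb_post D) (Run (?cond # [climb_com]) ?s1 (Suc (Suc (Suc d)))) ?m1 X' c'"
      proof (cases "m0 ?k = 0")
        case True
        have stop: "sf climb_inv (climb_post D) (Run [climb_com] (?s1(14 := 0)) (Suc (Suc (Suc (Suc (Suc d)))))) ?m1 {} (c - step_cost - 5)"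
          using less.prems by (intro climb_stop) (auto simp: thread_post_def no_token_def)
        have "sf climb_inv (climb_post D) (Run (Assign 14 (Lit 0) # [climb_com]) ?s1 (Suc (Suc (Suc (Suc d))))) ?m1 {} (Suc (c - step_cost - 5))"
          by (rule safe_Assign) (use stop in simp_all)
        then have "sf climb_inv (climb_post D) (Run (?cond # [climb_com]) ?s1 (Suc (Suc (Suc d)))) ?m1 {} (Suc (Suc (c - step_cost - 5)))"
          using True by (intro safe_Cond) simp
        moreover have "Suc (Suc (c - step_cost - 5)) + (e + step_cost) < c - 2 + e" using less.prems(9) by linarith
        moreover have "climb_inv ?m1 (X \<union> Y) (e + step_cost)" by (rule ar(3)[OF True])
        ultimately show ?thesis
          by (intro exI[of _ "{}"] exI[of _ "Suc (Suc (c - step_cost - 5))"] exI[of _ "X \<union> Y"] exI[of _ "e + step_cost"]) simp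
      next
        case False
        then have one: "m0 ?k = 1" using ar(2) by simp
        let ?T = "{?k, addr n 5 (2 * f + 2), addr n 5 (2 * f + 3)}"
        obtain Z y u where Z: "Z \<subseteq> Y" "step_cost \<le> e" "cluster_tree m0 y Z u" "sld_parent n es y = Some f" "out n f \<in> Z"
          "?T \<subseteq> X \<union> Z" "climb_inv ?m1 ((Y - Z) \<union> ?T) (e - step_cost)"
          using ar(4)[OF one] by blast
        have dXZ: "X \<inter> Z = {}" using b(4) Z(1) by blast
        have y: "valid_node y" using Z(3) by (simp add: cluster_tree_def)
        note q = root_edge[OF Z(3,4)]
        note cd = cluster_disjoint[OF c0 Z(3) dXZ]
        \<comment> \<open>Both clusters have \<open>f\<close> as their lightest leaving edge, so the
          two nodes of \<open>f\<close> are the two roots.\<close>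
        have "root u = sib a"
          by (rule half_inj[OF q(2) half_merge(1)[OF x p y Z(4) cd a(1,2)]]) (use q(3) a sib_props(4)[OF a(3)] in simp)
        then obtain u1 u2 where u: "u = Node u1 (sib a) u2" using q(1) by (cases u) auto
        have rs: "{2 * f + 2, 2 * f + 3} = {a, sib a}"
          using r(4) t sib_even[of "2 * f + 2"] sib_odd[of "2 * f + 3"] by auto
        have TT: "?T = {?k, addr n 5 a, addr n 5 (sib a)}"
          using arg_cong[OF rs, of "\<lambda>S. insert ?k (addr n 5 ` S)"] by simp
        let ?X = "X \<union> Z - ?T"
        let ?N = "set_tree t1 \<union> set_tree t2 \<union> (set_tree u1 \<union> set_tree u2)"
        have st: "set_tree t = half (cl x)" "set_tree u = half (cl y)" "heap w t" "heap w u" "repr n m0 t" "repr n m0 u"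
          using c0 Z(3) by (auto simp: cluster_tree_def)
        have rp: "repr n ?m1 t" "repr n ?m1 u"
          by (rule repr_cong[OF _ st(5)], simp add: cells_def, fastforce)
             (rule repr_cong[OF _ st(6)], simp add: cells_def, fastforce)
        have ac: "card (anc y) = card (anc x)" using card_anc_parent[OF y Z(4)] cc by simp
        have szt: "size t \<le> H" "size u \<le> H"
          using size_heap_half[OF st(3,1) x] size_heap_half[OF st(4,2) y] ac less.prems(8) by auto
        have dis: "set_tree t \<inter> set_tree u = {}" unfolding st using cd by (auto simp: half_def)
        have a_not: "a \<notin> ?N" "sib a \<notin> ?N" using st(3,4) dis unfolding t u by auto
        have sz2: "size t + size u \<le> Suc (Suc H)"
        proof -
          have "half (cl (Edge f)) = (half (cl x) - {a}) \<union> (half (cl y) - {sib a})"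
            using half_merge(2)[OF x p y Z(4) cd a(1,2)] node_cluster_merge[OF x p y Z(4) cd] by simp
          moreover have "card ((half (cl x) - {a}) \<union> (half (cl y) - {sib a})) = card (half (cl x) - {a}) + card (half (cl y) - {sib a})"
            by (rule card_Un_disjoint) (use finite_half dis st in auto)
          moreover have "sib a \<in> half (cl y)" using q(2) u by simp
          ultimately have "card (half (cl (Edge f))) = (card (half (cl x)) - 1) + (card (half (cl y)) - 1)"
            using a(1) by (simp add: card_Diff_singleton)
          moreover have "card (half (cl x)) = size t" "card (half (cl y)) = size u"
            using card_heap st by metis+
          moreover have "card (half (cl (Edge f))) \<le> H"
            using card_half card_boundary[of "Edge f"] f cc less.prems(8) by simp
          ultimately show ?thesis by linarith
        qed
        have cellsX: "cells n (set_tree t) \<subseteq> X" "cells n (set_tree u) \<subseteq> Z"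
          using c0 Z(3) st by (auto simp: cluster_tree_def)
        have subN: "?N \<subseteq> set_tree t \<union> set_tree u" unfolding t u by auto
        have cN: "cells n ?N \<subseteq> ?X"
        proof -
          have "cells n ?N \<subseteq> X \<union> Z" using cells_mono[OF subN, of n] cellsX unfolding cells_Un by blast
          moreover have "cells n ?N \<inter> ?T = {}" unfolding TT using a_not by auto
          ultimately show ?thesis by blast
        qed
        have kids: "addr n 2 a \<in> ?X" "addr n 3 a \<in> ?X" "addr n 2 (sib a) \<in> ?X" "addr n 3 (sib a) \<in> ?X"
          using cellsX unfolding t u by (auto simp: cells_def)
        have oX: "out n (edge_of a) \<in> ?X" unfolding a(2) using Z(5) out_not_addr[OF fn] by auto
        have "sf climb_inv (climb_post D) (Run (merge_com # [climb_com]) ?s1 (Suc (Suc (Suc (Suc d))))) ?m1 ?X (c + step_cost - 4)"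
        proof (rule safe_wp[OF climb_inv_local], rule wp_conseq[OF merge_wp[OF st(3,4) t u dis rp]])
          show "set_tree t \<union> set_tree u \<subseteq> {2..<2 * n}" unfolding st by (auto simp: half_def)
          show "size t \<le> H" "size u \<le> H" "size t + size u \<le> Suc (Suc H)" by fact+
          show "cells n ?N \<subseteq> ?X" by fact
          show "addr n 2 a \<in> ?X" "addr n 3 a \<in> ?X" "addr n 2 (sib a) \<in> ?X" "addr n 3 (sib a) \<in> ?X" "out n (edge_of a) \<in> ?X" by fact+
          show "addr n 9 v \<in> ?X" "addr n 9 (n + v) \<in> ?X" using less.prems(6,7) by auto
          show "?s1 0 = n" "?s1 1 = v" "?s1 14 = a" "v < n" using less.prems s14 by auto
          fix K :: nat and s2 :: regs and m2
          assume mw: "K \<le> 270 * lg + 60 \<and> s2 0 = n \<and> s2 1 = v \<and>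
            (\<exists>t'. heap w t' \<and> repr n m2 t' \<and> set_tree t' = ?N \<and> s2 14 = root t' \<and> m2 (out n (edge_of a)) = root t' div 2) \<and>
            (\<forall>c. c \<notin> {addr n 9 v, addr n 9 (n + v), out n (edge_of a)} \<union> cells n ?N \<longrightarrow> m2 c = ?m1 c)"
          then obtain t' where t': "heap w t'" "repr n m2 t'" "set_tree t' = ?N" "s2 14 = root t'" "m2 (out n f) = root t' div 2"
            using a(2) by auto
          have same: "m2 (out n g) = m0 (out n g)" if g: "g \<noteq> f" "g < length es" for g
          proof -
            have "out n g \<noteq> addr n j i" for j i by (rule out_not_addr) (use g Suc_length in simp)
            then have "out n g \<notin> {addr n 9 v, addr n 9 (n + v), out n (edge_of a)} \<union> cells n ?N" "out n g \<noteq> ?k"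
              using g a(2) by (auto simp: out_inj cells_def)
            then show ?thesis using mw by simp
          qed
          have ct: "cluster_tree m2 (Edge f) ?X t'"
            unfolding TT by (rule cluster_tree_merge[OF c0 p Z(3,4) dXZ Z(5) t u t'(1-3,5) same])
          have K: "K + 100 \<le> step_cost + 60 - 20 + 20" "K \<le> step_cost - 40" using mw by (auto simp: step_cost_def)
          have mu: "(step_cost + 20) * card (anc x) = (step_cost + 20) + (step_cost + 20) * card (anc (Edge f))"
            unfolding cc by simp
          show "K \<le> c + step_cost - 4 \<and> sf climb_inv (climb_post D) (Run [climb_com] s2 (Suc (Suc (Suc (Suc d))) + K)) m2 ?X (c + step_cost - 4 - K)"
          proof
            show "K \<le> c + step_cost - 4" using K less.prems(9) by linarith
            show "sf climb_inv (climb_post D) (Run [climb_com] s2 (Suc (Suc (Suc (Suc d))) + K)) m2 ?X (c + step_cost - 4 - K)"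
            proof (rule less.hyps[OF _ ct])
              show "card (anc (Edge f)) < card (anc x)" "card (anc (Edge f)) \<le> H" using cc less.prems(8) by auto
              show "s2 0 = n" "s2 1 = v" "v < n" "s2 14 = root t'" using mw t' less.prems(4) by auto
              show "addr n 9 v \<in> ?X" "addr n 9 (n + v) \<in> ?X" using less.prems(6,7) by auto
              show "step_cost + 20 \<le> c + step_cost - 4 - K" using K(2) less.prems(9) by (simp add: step_cost_def)
              show "Suc (Suc (Suc (Suc d))) + K + (step_cost + 20) * card (anc (Edge f)) + 20 \<le> D"
                using less.prems(10) mu K(2) by linarith
            qed
          qed
        qed simp
        then have "sf climb_inv (climb_post D) (Run (?cond # [climb_com]) ?s1 (Suc (Suc (Suc d)))) ?m1 ?X (Suc (c + step_cost - 4))"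
          using one by (intro safe_Cond) simp
        moreover have "Suc (c + step_cost - 4) + (e - step_cost) < c - 2 + e" using Z(2) less.prems(9) by linarith
        moreover have "?X \<union> ((Y - Z) \<union> ?T) = X \<union> Y" using Z(1,6) by blast
        moreover have "?X \<inter> ((Y - Z) \<union> ?T) = {}" using b(4) by blast
        ultimately show ?thesis using Z(7)
          by (intro exI[of _ ?X] exI[of _ "Suc (c + step_cost - 4)"] exI[of _ "(Y - Z) \<union> ?T"] exI[of _ "e - step_cost"] conjI)
      qed
      then show "?k \<in> X \<union> Y \<and> Suc (m0 ?k) \<le> W \<and> (\<exists>X' c' Y' e'. X' \<union> Y' = X \<union> Y \<and> X' \<inter> Y' = {} \<and> c' + e' < c - 2 + e \<and> climb_inv ?m1 Y' e' \<and>
        sf climb_inv (climb_post D) (Run (?cond # [climb_com]) ?s1 (Suc (Suc (Suc d)))) ?m1 X' c')"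
        using ar(1) kW by blast
    qed
    have "sf climb_inv (climb_post D) (Run [climb_com] s d) m X (Suc (Suc (c - 2)))"
      unfolding climb_com_def
    proof (rule safe_While)
      show "sf climb_inv (climb_post D) (Run (if bval w s (Less (Lit 0) (Reg 14)) then Seq ?fetch ?cond # While (Less (Lit 0) (Reg 14)) (Seq ?fetch ?cond) # [] else []) s (Suc d)) m X (Suc (c - 2))"
        using s14 a(3) safe_Seq[OF main[unfolded climb_com_def]] by simp
    qed
    moreover have "Suc (Suc (c - 2)) = c" using less.prems(9) by simp
    ultimately show ?thesis by simp
  qed
qed

end

section \<open>Collecting the half-edges\<close>

context tree_run
begin

text \<open>All that the thread of \<open>v\<close> starts with, including its column of slots.
  Field \<open>7\<close>, the degree counter of the first phase, becomes the token.\<close>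

definition vertex_cells :: "nat \<Rightarrow> nat set" where
  "vertex_cells v = {addr n 7 v, addr n 9 v, addr n 9 (n + v)} \<union> range (\<lambda>i. addr n 8 (i * n + v)) \<union> cells n (half {v})"

text \<open>At most \<open>H\<close> insertions, followed by at most \<open>H\<close> merges on the
  way to the root.\<close>

definition climb_depth :: nat where
  "climb_depth = (90 * lg + 20) * H + (step_cost + 20) * H + 40"

lemma vertex_safe:
  assumes v: "v < n" and m: "inj_on sl {..<D}" "sl ` {..<D} = half {v}"
    "m (addr n 7 v) = D" "\<And>i. i < D \<Longrightarrow> m (addr n 8 (i * n + v)) = sl i"
    "\<And>a j. a \<in> half {v} \<Longrightarrow> j \<in> {2, 3, 4, 5} \<Longrightarrow> m (addr n j a) = 0" "m (addr n 9 v) = 0"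
    and ag: "agree (vertex_cells v) m m0" and s: "s 0 = n" "s 1 = v"
  shows "sf climb_inv (\<lambda>s' d' m' X' c'. s' 0 = n \<and> d' \<le> d + climb_depth \<and> thread_post m' X')
    (Run [Seq build_com climb_com] s d) m0 (vertex_cells v) ((90 * lg + 20) * D + step_cost + 40)"
proof -
  have "D = card (half {v})" using card_image[OF m(1)] m(2) by simp
  also have "\<dots> \<le> card (anc (Vertex v))"
    using card_half[of "{v}"] card_boundary[of "Vertex v"] v by simp
  finally have D: "D \<le> H" using card_anc_vertex[OF v] by simp
  have sub: "addr n 7 v \<in> vertex_cells v" "addr n 9 v \<in> vertex_cells v" "addr n 8 (i * n + v) \<in> vertex_cells v"
    "cells n (half {v}) \<subseteq> vertex_cells v" for i
    by (auto simp: vertex_cells_def)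
  have eq: "m0 a = m a" if "a \<in> vertex_cells v" for a using ag that by (simp add: agree_def)
  have m0: "m0 (addr n 7 v) = D" "\<And>i. i < D \<Longrightarrow> m0 (addr n 8 (i * n + v)) = sl i"
    "\<And>a j. a \<in> half {v} \<Longrightarrow> j \<in> {2, 3, 4, 5} \<Longrightarrow> m0 (addr n j a) = 0" "m0 (addr n 9 v) = 0"
    using eq[OF sub(1)] eq[OF sub(2)] eq[OF sub(3)] m(3-6) apply simp_all
    using eq sub(4) m(5) by (auto simp: cells_def subset_iff)
  have cost: "(90 * lg + 20) * D \<le> (90 * lg + 20) * H" "(step_cost + 20) * card (anc (Vertex v)) \<le> (step_cost + 20) * H"
    using D card_anc_vertex[OF v] by (intro mult_le_mono2; simp)+
  have "sf climb_inv (climb_post (d + climb_depth)) (Run (build_com # [climb_com]) s (Suc d)) m0 (vertex_cells v)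
      ((90 * lg + 20) * D + step_cost + 39)"
  proof (rule safe_wp[OF climb_inv_local], rule wp_conseq[OF build_wp[OF v m(1,2) m0 sub s]])
    fix K :: nat and s' :: regs and m'
    assume b: "K \<le> (90 * lg + 20) * D + 10 \<and> s' 0 = n \<and> s' 1 = v \<and>
     (\<exists>t. heap w t \<and> repr n m' t \<and> set_tree t = half {v} \<and> s' 14 = root t)"
    then obtain t where t: "heap w t" "repr n m' t" "set_tree t = half {v}" "s' 14 = root t" by blast
    have "internal {v} = {}" using no_loop by (fastforce simp: internal_def)
    moreover have "addr n 7 u \<in> vertex_cells v \<longleftrightarrow> u = v" for u by (auto simp: vertex_cells_def)
    ultimately have ct: "cluster_tree m' (Vertex v) (vertex_cells v) t"
      using t v sub(4) by (auto simp: cluster_tree_def)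
    show "K \<le> (90 * lg + 20) * D + step_cost + 39 \<and>
      sf climb_inv (climb_post (d + climb_depth)) (Run [climb_com] s' (Suc d + K)) m' (vertex_cells v) ((90 * lg + 20) * D + step_cost + 39 - K)"
    proof
      show "K \<le> (90 * lg + 20) * D + step_cost + 39" using b by linarith
      show "sf climb_inv (climb_post (d + climb_depth)) (Run [climb_com] s' (Suc d + K)) m' (vertex_cells v) ((90 * lg + 20) * D + step_cost + 39 - K)"
      proof (rule climb_safe[OF ct])
        show "s' 0 = n" "s' 1 = v" "v < n" "s' 14 = root t" using b t v by auto
        show "addr n 9 v \<in> vertex_cells v" "addr n 9 (n + v) \<in> vertex_cells v" by (auto simp: vertex_cells_def)
        show "card (anc (Vertex v)) \<le> H" by (rule card_anc_vertex[OF v])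
        show "step_cost + 20 \<le> (90 * lg + 20) * D + step_cost + 39 - K" using b by linarith
        show "Suc d + K + (step_cost + 20) * card (anc (Vertex v)) + 20 \<le> d + climb_depth"
          using b cost unfolding climb_depth_def by linarith
      qed
    qed
  qed (assumption | rule subset_refl)+
  then have "sf climb_inv (climb_post (d + climb_depth)) (Run [Seq build_com climb_com] s d) m0 (vertex_cells v)
     (Suc ((90 * lg + 20) * D + step_cost + 39))"
    by (rule safe_Seq)
  moreover have "Suc ((90 * lg + 20) * D + step_cost + 39) = (90 * lg + 20) * D + step_cost + 40" by simp
  ultimately have "sf climb_inv (climb_post (d + climb_depth)) (Run [Seq build_com climb_com] s d) m0 (vertex_cells v)
     ((90 * lg + 20) * D + step_cost + 40)" by (simp only:)
  then show ?thesis by (rule safe_conseq) (simp only: climb_post_def)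
qed

text \<open>The first phase hands these cells on as zeros. The second one relies on that for its
  counters and for fresh heap records.\<close>

definition rest_cells :: "nat set" where
  "rest_cells = - ({..<2 * length es} \<union> addr n 7 ` {..<n} \<union> range (addr n 8))"

text \<open>
  Slot \<open>k\<close> belongs to vertex \<open>k mod n\<close>. A half-edge that has drawn a slot leaves its input cell behind, so
  that the counters add up to at most the number of input cells. The \<open>b\<close> credits are kept for later.
\<close>

definition fill_inv :: "nat \<Rightarrow> inv" where
  "fill_inv b m Y c \<longleftrightarrow> b \<le> c \<and> (\<forall>a\<in>rest_cells. m a = 0) \<and>
     (\<exists>S. S \<subseteq> {..<2 * length es} \<and> (\<Sum>v<n. m (addr n 7 v)) = card S \<and>
       Y = S \<union> addr n 7 ` {..<n} \<union> addr n 8 ` {k. m (addr n 7 (k mod n)) \<le> k div n} \<union> rest_cells)"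

lemma fill_inv_local: "local_inv (fill_inv b)"
  unfolding local_inv_def
proof (intro allI impI)
  fix m m' Y c assume a: "agree Y m m'" "fill_inv b m Y c"
  obtain S where S: "S \<subseteq> {..<2 * length es}" "(\<Sum>v<n. m (addr n 7 v)) = card S"
    "Y = S \<union> addr n 7 ` {..<n} \<union> addr n 8 ` {k. m (addr n 7 (k mod n)) \<le> k div n} \<union> rest_cells"
    using a(2) unfolding fill_inv_def by blast
  have eq: "m' c = m c" if "c \<in> Y" for c using a(1) that by (simp add: agree_def)
  have d: "m' (addr n 7 v) = m (addr n 7 v)" if "v < n" for v
    by (rule eq) (use S(3) that in auto)
  have "m' (addr n 7 (k mod n)) = m (addr n 7 (k mod n))" for k
    by (rule d) (use n_pos in simp)
  moreover have "m' c = 0" if "c \<in> rest_cells" for c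
    using eq[of c] a(2) S(3) that by (simp add: fill_inv_def)
  ultimately show "fill_inv b m' Y c"
    unfolding fill_inv_def using S d a(2)[unfolded fill_inv_def] by (intro conjI exI[of _ S]) auto
qed

text \<open>The input cell has been traded for one slot. Its row \<open>r\<close> depends on the
  schedule and is therefore existential.\<close>

definition fill_post :: "nat \<Rightarrow> memory \<Rightarrow> nat set \<Rightarrow> bool" where
  "fill_post q m X \<longleftrightarrow> (\<exists>r. X = {addr n 8 (r * n + hend (q + 2))} \<and> m (addr n 8 (r * n + hend (q + 2))) = q + 2)"

lemma fill_post_cong: "agree X m m' \<Longrightarrow> fill_post q m X \<Longrightarrow> fill_post q m' X"
  by (auto simp: fill_post_def agree_def)

lemma addr_ge: "2 * length es \<le> addr n j i"
  using Suc_length by (auto simp: addr_def)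

lemma input_not_addr: "c < 2 * length es \<Longrightarrow> c \<noteq> addr n j i"
  using Suc_length by (auto simp: addr_def)

lemma fill_safe:
  assumes q: "q < 2 * length es" "m q = hend (q + 2)" and s: "s 0 = n" "s 1 = q"
  shows "sf (fill_inv b) (\<lambda>s' d' m' X' c'. s' 0 = n \<and> d' \<le> d + 5 \<and> fill_post q m' X') (Run [fill_com] s d) m {q} 5"
proof -
  let ?v = "hend (q + 2)"
  let ?k = "addr n 7 ?v"
  let ?Q = "\<lambda>s' d' m' X' c'. s' 0 = n \<and> d' \<le> d + 5 \<and> fill_post q m' X'"
  let ?store = "Store (adr 8 (Plus (Times (Reg 4) (Reg 0)) (Reg 3))) (Plus (Reg 1) (Lit 2))"
  have v: "?v < n" by (rule hend_less) (use q Suc_length in auto)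
  let ?s3 = "s(3 := ?v)"
  have fetch: "sf (fill_inv b) ?Q (Run (Fetch_Inc 4 (adr 7 (Reg 3)) # [?store]) ?s3 (Suc (Suc (Suc d)))) m {q} 2"
  proof (rule safe_Fetch_Inc)
    fix m0 Y e
    assume I: "{q} \<inter> Y = {}" "fill_inv b m0 Y e"
    obtain S where S: "S \<subseteq> {..<2 * length es}" "(\<Sum>v<n. m0 (addr n 7 v)) = card S"
      "Y = S \<union> addr n 7 ` {..<n} \<union> addr n 8 ` {k. m0 (addr n 7 (k mod n)) \<le> k div n} \<union> rest_cells"
      and bI: "b \<le> e" "\<forall>a\<in>rest_cells. m0 a = 0"
      using I(2) unfolding fill_inv_def by blast
    have finS: "finite S" by (rule finite_subset[OF S(1)]) simp
    have qS: "q \<notin> S" using I(1) S(3) by auto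
    let ?r = "m0 ?k"
    let ?m1 = "m0(?k := Suc ?r)" and ?c = "addr n 8 (?r * n + ?v)"
    \<comment> \<open>A counter cannot exceed the number of input cells left behind, so the
      increment respects the word bound.\<close>
    have "?r \<le> (\<Sum>v<n. m0 (addr n 7 v))" by (rule member_le_sum) (use v in auto)
    also have "\<dots> \<le> 2 * length es" unfolding S(2) using card_mono[OF _ S(1)] by simp
    finally have r: "?r \<le> 2 * n" using Suc_length by simp
    have dm: "(?r * n + ?v) mod n = ?v" "(?r * n + ?v) div n = ?r" using v by auto
    have cY: "?c \<in> Y" unfolding S(3) using dm by (intro UnI1 UnI2 imageI) simp
    have kY: "?k \<in> Y" unfolding S(3) using v by blast
    let ?Y = "(Y - {?c}) \<union> {q}"
    \<comment> \<open>Raising the counter of \<open>?v\<close> past \<open>?r\<close> withdraws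
      exactly one slot from the pool.\<close>
    have Y': "?Y = insert q S \<union> addr n 7 ` {..<n} \<union> addr n 8 ` {k. ?m1 (addr n 7 (k mod n)) \<le> k div n} \<union> rest_cells"
    proof -
      have c_not: "?c \<notin> S \<union> addr n 7 ` {..<n} \<union> rest_cells"
        using S(1) input_not_addr by (auto simp: rest_cells_def)
      have split: "{k. ?m1 (addr n 7 (k mod n)) \<le> k div n} = {k. m0 (addr n 7 (k mod n)) \<le> k div n} - {?r * n + ?v}"
      proof (intro equalityI subsetI)
        fix k assume "k \<in> {k. ?m1 (addr n 7 (k mod n)) \<le> k div n}"
        then show "k \<in> {k. m0 (addr n 7 (k mod n)) \<le> k div n} - {?r * n + ?v}"
          using dm by (auto split: if_splits)
      next
        fix k assume k: "k \<in> {k. m0 (addr n 7 (k mod n)) \<le> k div n} - {?r * n + ?v}"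
        show "k \<in> {k. ?m1 (addr n 7 (k mod n)) \<le> k div n}"
        proof (cases "k mod n = ?v")
          case True
          have "k div n \<noteq> ?r" using k True div_mult_mod_eq[of k n] by auto
          then show ?thesis using k True by auto
        qed (use k in auto)
      qed
      have "addr n 8 ` {k. ?m1 (addr n 7 (k mod n)) \<le> k div n} = addr n 8 ` {k. m0 (addr n 7 (k mod n)) \<le> k div n} - {?c}"
        unfolding split by (subst image_set_diff) (auto simp: inj_def)
      then show ?thesis unfolding S(3) using c_not by blast
    qed
    have krest: "?k \<notin> rest_cells" using v by (auto simp: rest_cells_def)
    have sum: "(\<Sum>v<n. ?m1 (addr n 7 v)) = card (insert q S)"
    proof -
      have "(\<Sum>u<n. ?m1 (addr n 7 u)) = (\<Sum>u<n. m0 (addr n 7 u) + (if u = ?v then 1 else 0))"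
        by (intro sum.cong) auto
      also have "\<dots> = Suc (card S)" using v S(2) by (simp add: sum.distrib)
      finally show ?thesis using qS finS by simp
    qed
    have inv: "fill_inv b ?m1 ?Y e"
      unfolding fill_inv_def
    proof (intro conjI exI[of _ "insert q S"])
      show "\<forall>a\<in>rest_cells. ?m1 a = 0" using bI(2) krest by auto
    qed (use bI(1) S(1) q(1) sum Y' in auto)
    have qc: "?c \<noteq> q" by (rule not_sym[OF input_not_addr[OF q(1)]])
    let ?s4 = "?s3(4 := ?r)"
    have av: "aval ?s4 (adr 8 (Plus (Times (Reg 4) (Reg 0)) (Reg 3))) = ?c" "aval ?s4 (Plus (Reg 1) (Lit 2)) = q + 2"
      using s by simp_all
    have "sf (fill_inv b) ?Q (Run [?store] ?s4 (Suc (Suc (Suc (Suc d))))) ?m1 {?c} (Suc 0)"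
    proof (rule safe_Store[OF fill_inv_local], unfold av)
      show "q + 2 \<le> W" using q Suc_length by (intro nn_bound) simp
      show "sf (fill_inv b) ?Q (Run [] ?s4 (Suc (Suc (Suc (Suc (Suc d)))))) (?m1(?c := q + 2)) {?c} 0"
        by (rule safe_end) (use s in \<open>auto simp: fill_post_def agree_def\<close>)
    qed simp
    moreover have "{?c} \<union> ?Y = {q} \<union> Y" "{?c} \<inter> ?Y = {}" using cY qc by auto
    moreover have "aval ?s3 (adr 7 (Reg 3)) = ?k" using s by simp
    moreover have "Suc ?r \<le> W" using r n_pos by (intro nn_bound) simp
    ultimately show "aval ?s3 (adr 7 (Reg 3)) \<in> {q} \<union> Y \<and> Suc (m0 (aval ?s3 (adr 7 (Reg 3)))) \<le> W \<and>
      (\<exists>X' c' Y' e'. X' \<union> Y' = {q} \<union> Y \<and> X' \<inter> Y' = {} \<and> c' + e' < 2 + e \<and>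
        fill_inv b (m0(aval ?s3 (adr 7 (Reg 3)) := Suc (m0 (aval ?s3 (adr 7 (Reg 3)))))) Y' e' \<and>
        sf (fill_inv b) ?Q (Run [?store] (?s3(4 := m0 (aval ?s3 (adr 7 (Reg 3))))) (Suc (Suc (Suc (Suc d)))))
          (m0(aval ?s3 (adr 7 (Reg 3)) := Suc (m0 (aval ?s3 (adr 7 (Reg 3)))))) X' c')"
      using kY inv by (intro conjI exI[of _ "{?c}"] exI[of _ "Suc 0"] exI[of _ ?Y] exI[of _ e]) simp_all
  qed
  have "sf (fill_inv b) ?Q (Run (Load 3 (Reg 1) # [Seq (Fetch_Inc 4 (adr 7 (Reg 3))) ?store]) s (Suc d)) m {q} (Suc (Suc 2))"
  proof (rule safe_Load)
    show "aval s (Reg 1) \<in> {q}" using s by simp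
    show "sf (fill_inv b) ?Q (Run [Seq (Fetch_Inc 4 (adr 7 (Reg 3))) ?store] (s(3 := m (aval s (Reg 1)))) (Suc (Suc d))) m {q} (Suc 2)"
      using safe_Seq[OF fetch] s q(2) by simp
  qed
  from safe_Seq[OF this] show ?thesis unfolding fill_com_def by simp
qed

text \<open>In the end the whole memory is divided between threads and invariant. A slot below its
  vertex's counter is not in the invariant's share, so some thread owns it and vouches for its
  contents. Each thread owns one slot, so nothing is listed twice. The order of a list depends on
  the schedule, its set does not.\<close>

lemma fill_result:
  assumes un: "UNIV = (\<Union>q\<in>{0..<2 * length es}. F q) \<union> Y" and d: "(\<Union>q\<in>{0..<2 * length es}. F q) \<inter> Y = {}"
    and post: "\<And>q. q < 2 * length es \<Longrightarrow> fill_post q m (F q)" and I: "fill_inv b m Y c" and v: "v < n"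
  defines "sl \<equiv> \<lambda>i. m (addr n 8 (i * n + v))"
  shows "inj_on sl {..<m (addr n 7 v)}" "sl ` {..<m (addr n 7 v)} = half {v}"
proof -
  let ?D = "m (addr n 7 v)"
  have dm: "(i * n + u) mod n = u" "(i * n + u) div n = i" if "u < n" for i u
    using that by auto
  have Y: "addr n 8 k \<in> Y \<longleftrightarrow> m (addr n 7 (k mod n)) \<le> k div n" for k
    using I input_not_addr[of "addr n 8 k" 8 k] unfolding fill_inv_def rest_cells_def by fastforce
  have hn: "hend (q + 2) < n" if "q < 2 * length es" for q
    by (rule hend_less) (use that Suc_length in auto)
  have key: "\<exists>q<2 * length es. hend (q + 2) = v \<and> sl i = q + 2 \<and> F q = {addr n 8 (i * n + v)}" if i: "i < ?D" for i
  proof -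
    have "addr n 8 (i * n + v) \<notin> Y" unfolding Y using dm[OF v] i by simp
    moreover have "addr n 8 (i * n + v) \<in> (\<Union>q\<in>{0..<2 * length es}. F q) \<union> Y" by (subst un[symmetric]) simp
    ultimately obtain q where q: "q < 2 * length es" "addr n 8 (i * n + v) \<in> F q" by auto
    obtain r where r: "F q = {addr n 8 (r * n + hend (q + 2))}" "m (addr n 8 (r * n + hend (q + 2))) = q + 2"
      using post[OF q(1)] unfolding fill_post_def by blast
    have e: "i * n + v = r * n + hend (q + 2)" using q(2) r(1) by simp
    then have "v = hend (q + 2)" using dm(1)[OF v, of i] dm(1)[OF hn[OF q(1)], of r] by metis
    then show ?thesis using q(1) r e unfolding sl_def by (intro exI[of _ q]) auto
  qed
  show "inj_on sl {..<?D}"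
  proof (rule inj_onI)
    fix i j assume ij: "i \<in> {..<?D}" "j \<in> {..<?D}" "sl i = sl j"
    obtain q q' where "sl i = q + 2" "F q = {addr n 8 (i * n + v)}" "sl j = q' + 2" "F q' = {addr n 8 (j * n + v)}"
      using key[of i] key[of j] ij by auto
    then have "i * n + v = j * n + v" using ij(3) by auto
    then show "i = j" using n_pos by simp
  qed
  show "sl ` {..<?D} = half {v}"
    unfolding half_vertex[OF v]
  proof (intro equalityI subsetI)
    fix a assume "a \<in> sl ` {..<?D}"
    then show "a \<in> {a \<in> {2..<2 * n}. hend a = v}" using key Suc_length by force
  next
    fix a assume a: "a \<in> {a \<in> {2..<2 * n}. hend a = v}"
    have q: "a - 2 < 2 * length es" "a - 2 + 2 = a" using a Suc_length by auto
    obtain r where r: "F (a - 2) = {addr n 8 (r * n + v)}" "m (addr n 8 (r * n + v)) = a"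
      using post[OF q(1)] a q(2) unfolding fill_post_def by auto
    have "addr n 8 (r * n + v) \<in> (\<Union>q\<in>{0..<2 * length es}. F q)"
      by (rule UN_I[of "a - 2"]) (use q(1) r(1) in auto)
    then have "addr n 8 (r * n + v) \<notin> Y" using d by blast
    then have "r < ?D" unfolding Y using dm[OF v] by simp
    then show "a \<in> sl ` {..<?D}" using r(2) by (auto simp: sl_def)
  qed
qed

lemma climb_final:
  assumes un: "UNIV = (\<Union>v\<in>{0..<n}. F v) \<union> Y" and post: "\<And>v. v < n \<Longrightarrow> thread_post m (F v)" and I: "climb_inv m Y c"
    and e: "e < length es"
  shows "m (out n e) = out_value e"
proof (cases "\<exists>v<n. \<not> no_token (F v)")
  case True
  then obtain v x t where c: "cluster_tree m x (F v) t" "sld_parent n es x = None"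
    using post unfolding thread_post_def by blast
  have x: "valid_node x" using c(1) by (simp add: cluster_tree_def)
  have "boundary (cl x) = {}"
    using boundary_min[of "cl x"] sld_parent_Some[OF x] c(2) by (metis option.distinct(1))
  then have "cl x = {..<n}" by (rule boundary_empty[OF x])
  then have "e \<in> internal (cl x)" using e ends by (simp add: internal_def)
  then show ?thesis using c(1) by (simp add: cluster_tree_def)
next
  case False
  obtain z where z: "Y = (\<Union>f\<le>length es. z f)" "disjoint_family_on z {..length es}"
    "\<And>f. f < length es \<Longrightarrow> edge_inv f m (z f)" "no_token (z (length es))"
    using I unfolding climb_inv_def by blast
  have dep: "\<exists>f<length es. \<exists>x t. cluster_tree m x (z f) t \<and> sld_parent n es x = Some f \<and> u \<in> cl x" if u: "u < n" for u
  proof -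
    have "addr n 7 u \<in> (\<Union>v\<in>{0..<n}. F v) \<union> Y" by (subst un[symmetric]) simp
    then have "addr n 7 u \<in> Y" using False u by (auto simp: no_token_def)
    then obtain f where f: "f \<le> length es" "addr n 7 u \<in> z f" using z(1) by blast
    then have "f \<noteq> length es" "\<not> no_token (z f)" using z(4) u by (auto simp: no_token_def)
    then have fl: "f < length es" and "\<exists>x t. cluster_tree m x (z f) t \<and> sld_parent n es x = Some f"
      using f(1) z(3)[of f] unfolding edge_inv_def by auto
    then show ?thesis using f(2) u unfolding cluster_tree_def by blast
  qed
  define P where "P f \<longleftrightarrow> f < length es \<and> (\<exists>x t. cluster_tree m x (z f) t \<and> sld_parent n es x = Some f)" for f
  have "\<exists>f. P f" using dep[of 0] n_pos unfolding P_def by auto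
  then obtain f where f: "P f" "\<And>g. P g \<Longrightarrow> rank es f \<le> rank es g"
    using ex_has_least_nat[of P _ "rank es"] by blast
  obtain x t where c: "cluster_tree m x (z f) t" "sld_parent n es x = Some f" "f < length es" using f(1) by (auto simp: P_def)
  have x: "valid_node x" using c(1) by (simp add: cluster_tree_def)
  have bd: "f \<in> boundary (cl x)" by (rule sld_parent_SomeD(1)[OF x c(2)])
  then obtain u where u: "u < n" "u \<notin> cl x" "u = end1 es f \<or> u = end2 es f"
    using ends by (auto simp: boundary_def)
  \<comment> \<open>The vertex \<open>u\<close> across \<open>f\<close> is in a waiting cluster too.
    Its token lies in \<open>z g\<close> but not in \<open>z f\<close>, so \<open>g\<close> is not
    \<open>f\<close>. As \<open>f\<close> also leaves \<open>cl y\<close>, whose lightest leaving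
    edge is \<open>g\<close>, the edge \<open>g\<close> is lighter than \<open>f\<close>, against
    the choice of \<open>f\<close>.\<close>
  obtain g y t' where g: "g < length es" "cluster_tree m y (z g) t'" "sld_parent n es y = Some g" "u \<in> cl y"
    using dep[OF u(1)] by blast
  have y: "valid_node y" using g(2) by (simp add: cluster_tree_def)
  have "g \<noteq> f" using c(1) g(2,4) u(1,2) by (auto simp: cluster_tree_def)
  then have "z f \<inter> z g = {}" using disjoint_family_onD[OF z(2), of f g] c(3) g(1) by auto
  then have "cl x \<inter> cl y = {}" by (rule cluster_disjoint[OF c(1) g(2)])
  then have "f \<in> boundary (cl y)" using bd u g(4) by (auto simp: boundary_def)
  then have "rank es g < rank es f" using sld_parent_SomeD(5)[OF y g(3)] \<open>g \<noteq> f\<close> by simp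
  then show ?thesis using f(2)[of g] g by (auto simp: P_def)
qed

text \<open>Budget of the second phase: \<open>2 * n\<close> bounds the sum of the degrees,
  \<open>step_cost + 40\<close> is what each vertex starts with, and the rest pays for the loop. The
  invariant of the first phase keeps these credits in store.\<close>

definition late_credits :: nat where
  "late_credits = (90 * lg + 20) * (2 * n) + n * (step_cost + 40) + 12 * n + 8"

section \<open>Initial state and composition of the two phases\<close>

lemma initial_memory:
  "q < 2 * length es \<Longrightarrow> snd (initial n es) q = hend (q + 2)"
  "\<not> c < 2 * length es \<Longrightarrow> snd (initial n es) c = 0"
  by (auto simp: initial_def hend_def edge_of_def)

lemma fill_inv_initial: "fill_inv b (snd (initial n es)) (- {..<2 * length es}) b"
proof -
  let ?m = "snd (initial n es)"
  have z: "?m (addr n j i) = 0" for j i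
    by (rule initial_memory(2)) (use input_not_addr[of "addr n j i" j i] in auto)
  have "- {..<2 * length es} = {} \<union> addr n 7 ` {..<n} \<union> addr n 8 ` {k. ?m (addr n 7 (k mod n)) \<le> k div n} \<union> rest_cells"
    using addr_ge by (auto simp: rest_cells_def z not_less)
  moreover have "?m c = 0" if "c \<in> rest_cells" for c
    by (rule initial_memory(2)) (use that in \<open>simp add: rest_cells_def\<close>)
  ultimately show ?thesis
    unfolding fill_inv_def by (intro conjI exI[of _ "{}"]) (simp_all add: z)
qed

lemma disjoint_vertex_cells: "disjoint_family_on vertex_cells {0..<n}"
  unfolding disjoint_family_on_def
proof (intro ballI impI)
  fix u v assume uv: "u \<in> {0..<n}" "v \<in> {0..<n}" "u \<noteq> v"
  have "i * n + u \<noteq> j * n + v" for i j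
  proof
    assume "i * n + u = j * n + v"
    then have "(i * n + u) mod n = (j * n + v) mod n" by simp
    then show False using uv by simp
  qed
  moreover have "half {u} \<inter> half {v} = {}" using uv(3) by (auto simp: half_def)
  then have "cells n (half {u}) \<inter> cells n (half {v}) = {}" by (rule cells_disjoint)
  ultimately show "vertex_cells u \<inter> vertex_cells v = {}"
    using uv unfolding vertex_cells_def by auto
qed

text \<open>The output cell of an edge is placed next to its counter, so that it is handed to the
  second arrival, the only thread that writes it.\<close>

lemma climb_inv_initial:
  assumes zero: "\<And>c. c \<in> rest_cells \<Longrightarrow> m c = 0"
  shows "climb_inv m (- (\<Union>v\<in>{0..<n}. vertex_cells v)) 0"
proof -
  let ?Y = "- (\<Union>v\<in>{0..<n}. vertex_cells v)"
  define z0 where "z0 f = {addr n 6 (Suc f), out n f}" for f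
  define z where "z f = (if f < length es then z0 f else ?Y - (\<Union>f<length es. z0 f))" for f
  have oa: "out n f \<noteq> addr n j i" if "f < length es" for f j i
    by (rule out_not_addr) (use that Suc_length in simp)
  have ao: "addr n j i \<noteq> out n f" if "f < length es" for f j i
    by (rule not_sym[OF oa[OF that]])
  have Y0: "z0 f \<subseteq> ?Y" if "f < length es" for f
    using oa[OF that] by (auto simp: z0_def vertex_cells_def cells_def)
  have r: "addr n 6 (Suc f) \<in> rest_cells" for f
    using addr_ge by (auto simp: rest_cells_def not_less)
  have cnt: "m (addr n 6 (Suc f)) = 0" for f by (rule zero[OF r])
  have "?Y = (\<Union>f\<le>length es. z f)"
  proof -
    have "(\<Union>f\<le>length es. z f) = (\<Union>f<length es. z0 f) \<union> (?Y - (\<Union>f<length es. z0 f))"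
      unfolding lessThan_Suc_atMost[symmetric] lessThan_Suc by (auto simp: z_def)
    then show ?thesis using Y0 by blast
  qed
  moreover have "disjoint_family_on z {..length es}"
    unfolding disjoint_family_on_def
  proof (intro ballI impI)
    fix f g assume fg: "f \<in> {..length es}" "g \<in> {..length es}" "f \<noteq> g"
    then show "z f \<inter> z g = {}"
      using oa ao by (cases "f < length es"; cases "g < length es") (auto simp: z_def z0_def out_inj)
  qed
  moreover have "edge_inv f m (z f)" if "f < length es" for f
    using that cnt ao[OF that] unfolding edge_inv_def by (auto simp: z_def z0_def no_token_def)
  moreover have "no_token (z (length es))" by (auto simp: z_def no_token_def vertex_cells_def)
  ultimately show ?thesis
    unfolding climb_inv_def using cnt by (intro exI[of _ z] conjI) simp_all
qed

definition final_post :: "nat \<Rightarrow> post" where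
  "final_post D s d m X c \<longleftrightarrow> d \<le> D \<and> (\<forall>e<length es. m (out n e) = out_value e)"

lemma climb_phase:
  assumes L: "n \<le> 2 ^ L" and s: "s 0 = n"
    and un: "UNIV = (\<Union>q\<in>{0..<2 * length es}. F q) \<union> Y" and d: "(\<Union>q\<in>{0..<2 * length es}. F q) \<inter> Y = {}"
    and post: "\<And>q. q < 2 * length es \<Longrightarrow> fill_post q m (F q)" and I: "fill_inv b m Y c'" and c: "late_credits \<le> c"
  shows "sf emp (final_post (dd + 4 + climb_depth + 8 * L + 5))
    (Run [Seq (Assign 1 (Lit 0)) (Seq (Assign 2 (Reg 0)) (Call 2))] s dd) m UNIV c"
proof -
  let ?P = "\<lambda>i m X. thread_post m X"
  let ?D = "dd + 4 + climb_depth + 8 * L + 5"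
  let ?deg = "\<lambda>v. m (addr n 7 v)"
  let ?s = "s(1 := 0, 2 := n)"
  let ?Y = "- (\<Union>v\<in>{0..<n}. vertex_cells v)"
  have zero: "m e = 0" if "e \<in> rest_cells" for e using I that by (simp add: fill_inv_def)
  have rest: "addr n j i \<in> rest_cells" if "j < 16" "j \<noteq> 7" "j \<noteq> 8" for i j
    using that addr_ge by (auto simp: rest_cells_def not_less)
  have degs: "(\<Sum>v\<in>{0..<n}. ?deg v) \<le> 2 * n"
  proof -
    obtain S where "S \<subseteq> {..<2 * length es}" "(\<Sum>v<n. ?deg v) = card S" using I unfolding fill_inv_def by blast
    then have "(\<Sum>v<n. ?deg v) \<le> 2 * length es" using card_mono[of "{..<2 * length es}" S] by simp
    then show ?thesis using Suc_length by (simp add: lessThan_atLeast0)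
  qed
  have par: "sf climb_inv (split_post n ?P {0..<n} (dd + 4 + climb_depth + 8 * L + 5)) (Run [Call 2] ?s (dd + 4)) m
      (\<Union>v\<in>{0..<n}. vertex_cells v) (c - 4)"
  proof (rule safe_par_for[where body = "Seq build_com climb_com" and m = m and cr = "\<lambda>v. (90 * lg + 20) * ?deg v + step_cost + 40"])
    show "2 < length uf_prog" "uf_prog ! 2 = par_for 2 (Seq build_com climb_com)" by (simp_all add: uf_prog_def)
    show "thread_post m' X" if "agree X m m'" "thread_post m X" for m m' X
      using thread_post_cong that by blast
    show "disjoint_family_on vertex_cells {0..<n}" by (rule disjoint_vertex_cells)
    show "n \<le> W" by (intro nn_bound) simp
    show "n - 0 \<le> 2 ^ L" using L by simp
    show "?s 0 = n" "?s 1 = 0" "?s 2 = n" using s by auto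
    have "(\<Sum>v\<in>{0..<n}. (90 * lg + 20) * ?deg v + step_cost + 40) = (90 * lg + 20) * (\<Sum>v\<in>{0..<n}. ?deg v) + n * (step_cost + 40)"
      by (simp add: sum.distrib sum_distrib_left add_mult_distrib2)
    also have "\<dots> \<le> (90 * lg + 20) * (2 * n) + n * (step_cost + 40)"
      using degs by (intro add_mono mult_le_mono2) simp_all
    finally show "(\<Sum>v\<in>{0..<n}. (90 * lg + 20) * ?deg v + step_cost + 40) + (if 0 = n then 4 else 12 * (n - 0) - 8) \<le> c - 4"
      using c unfolding late_credits_def by (auto split: if_splits)
  next
    fix s' :: regs and d m0 v
    assume v: "v \<in> {0..<n}" "s' 0 = n" "s' 1 = v" "agree (vertex_cells v) m m0"
    then have vn: "v < n" by simp
    note fr = fill_result[OF un d post I vn]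
    show "sf climb_inv (\<lambda>s' d' m' X' c'. s' 0 = n \<and> d' \<le> d + climb_depth \<and> thread_post m' X') (Run [Seq build_com climb_com] s' d) m0
      (vertex_cells v) ((90 * lg + 20) * ?deg v + step_cost + 40)"
      by (rule vertex_safe[OF vn fr refl refl _ _ v(4,2,3)]) (use zero rest in auto)
  qed simp_all
  have "sf emp (\<lambda>s d m' X c'. X = UNIV \<and> (\<exists>X' Y' c1 c2. X = X' \<union> Y' \<and> X' \<inter> Y' = {} \<and> c' = c1 + c2 \<and>
      split_post n ?P {0..<n} ?D s d m' X' c1 \<and> climb_inv m' Y' c2)) (Run [Call 2] ?s (dd + 4)) m UNIV (c - 4)"
  proof -
    have "(\<Union>v\<in>{0..<n}. vertex_cells v) \<inter> ?Y = {}" "(\<Union>v\<in>{0..<n}. vertex_cells v) \<union> ?Y = UNIV" by auto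
    with safe_conserve[OF safe_hide[OF par, OF climb_inv_local _ climb_inv_initial[OF zero]]] show ?thesis by simp
  qed
  then have run: "sf emp (final_post ?D) (Run [Call 2] ?s (dd + 4)) m UNIV (c - 4)"
  proof (rule safe_conseq)
    fix s :: regs and d m' X and c' :: nat
    assume "X = UNIV \<and> (\<exists>X' Y' c1 c2. X = X' \<union> Y' \<and> X' \<inter> Y' = {} \<and> c' = c1 + c2 \<and>
      split_post n ?P {0..<n} ?D s d m' X' c1 \<and> climb_inv m' Y' c2)"
    then obtain X' Y' c2 G where "UNIV = X' \<union> Y'" "climb_inv m' Y' c2" "d \<le> ?D"
      "X' = (\<Union>i\<in>{0..<n}. G i)" "\<And>i. i < n \<Longrightarrow> thread_post m' (G i)"
      unfolding split_post_def by auto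
    then show "final_post ?D s d m' X c'"
      unfolding final_post_def using climb_final[of G Y' m' c2] by blast
  qed
  have nW: "n \<le> W" by (intro nn_bound) simp
  have "sf emp (final_post ?D) (Run [Seq (Assign 1 (Lit 0)) (Seq (Assign 2 (Reg 0)) (Call 2))] s dd) m UNIV (c - 4 + 2 + 2)"
  proof (rule safe_Assign_Seq)
    show "sf emp (final_post ?D) (Run [Seq (Assign 2 (Reg 0)) (Call 2)] (s(1 := aval s (Lit 0))) (Suc (Suc dd))) m UNIV (c - 4 + 2)"
      by (rule safe_Assign_Seq) (use run s nW in \<open>simp_all add: numeral_eq_Suc\<close>)
  qed simp
  moreover have "c - 4 + 2 + 2 = c" using c by (simp add: late_credits_def)
  ultimately show ?thesis by simp
qed

definition total_credits :: nat where
  "total_credits = 34 * n + 12 + late_credits"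

text \<open>The exponent \<open>L\<close> bounds the recursion of both loops, over
  \<open>2 * (n - 1)\<close> half-edges and over \<open>n\<close> vertices; at \<open>8\<close> per
  level this gives \<open>16 * L\<close>.\<close>

lemma main_safe:
  assumes L: "2 * n \<le> 2 ^ L"
  shows "sf emp (final_post (30 + climb_depth + 16 * L)) (fst (initial n es)) (snd (initial n es)) UNIV total_credits"
proof -
  let ?M = "2 * length es"
  let ?m = "snd (initial n es)" and ?s = "(\<lambda>_. 0 :: nat)(0 := n)"
  let ?s1 = "?s(2 := ?M)"
  let ?rest = "[Seq (Assign 1 (Lit 0)) (Seq (Assign 2 (Reg 0)) (Call 2))]"
  let ?P = "split_post n fill_post {0..<?M} (4 + 5 + 8 * L + 5)"
  let ?D = "30 + climb_depth + 16 * L"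
  have Mn: "?M \<le> 2 * n" using Suc_length by simp
  have MW: "?M \<le> W" using Mn by (intro nn_bound) simp
  have par: "sf (fill_inv late_credits) ?P (Run [Call 1] ?s1 4) ?m (\<Union>q\<in>{0..<?M}. {q}) (34 * n + 8)"
  proof (rule safe_par_for[where body = fill_com and m = ?m and cr = "\<lambda>_. 5"])
    show "1 < length uf_prog" "uf_prog ! 1 = par_for 1 fill_com" by (simp_all add: uf_prog_def)
    show "fill_post i m' X" if "agree X m m'" "fill_post i m X" for i m m' X
      using fill_post_cong that by blast
    show "disjoint_family_on (\<lambda>q. {q}) {0..<?M}" by (auto simp: disjoint_family_on_def)
    show "?M \<le> W" by fact
    show "?M - 0 \<le> 2 ^ L" using Mn L by simp
    \<comment> \<open>At most \<open>2 * n\<close> half-edges, at \<open>5\<close> credits for the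
      body and \<open>12\<close> for the loop.\<close>
    show "(\<Sum>i\<in>{0..<?M}. 5) + (if 0 = ?M then 4 else 12 * (?M - 0) - 8) \<le> 34 * n + 8" using Mn by (simp; intro impI; linarith)
  next
    fix s :: regs and d m0 q
    assume q: "q \<in> {0..<?M}" "s 0 = n" "s 1 = q" "agree {q} ?m m0"
    have "m0 q = hend (q + 2)" using q(1,4) initial_memory(1)[of q] by (simp add: agree_def)
    then show "sf (fill_inv late_credits) (\<lambda>s' d' m' X' c'. s' 0 = n \<and> d' \<le> d + 5 \<and> fill_post q m' X') (Run [fill_com] s d) m0 {q} 5"
      using q by (intro fill_safe) auto
  qed simp_all
  have "sf emp (\<lambda>s d m' X c'. X = UNIV \<and> (\<exists>X' Y' c1 c2. X = X' \<union> Y' \<and> X' \<inter> Y' = {} \<and> c' = c1 + c2 \<and>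
      ?P s d m' X' c1 \<and> fill_inv late_credits m' Y' c2)) (Run [Call 1] ?s1 4) ?m UNIV (34 * n + 8 + late_credits)"
  proof -
    have "(\<Union>q\<in>{0..<?M}. {q}) \<inter> - {..<?M} = {}" "(\<Union>q\<in>{0..<?M}. {q}) \<union> - {..<?M} = UNIV" by auto
    with safe_conserve[OF safe_hide[OF par, OF fill_inv_local _ fill_inv_initial]] show ?thesis by simp
  qed
  then have "sf emp (final_post ?D) (app_stack (Run [Call 1] ?s1 4) ?rest) ?m UNIV (34 * n + 8 + late_credits)"
  proof (rule safe_bind)
    fix s :: regs and d m' X and c' :: nat
    assume "X = UNIV \<and> (\<exists>X' Y' c1 c2. X = X' \<union> Y' \<and> X' \<inter> Y' = {} \<and> c' = c1 + c2 \<and>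
      ?P s d m' X' c1 \<and> fill_inv late_credits m' Y' c2)"
    then obtain X' Y' c1 c2 G where X: "X = UNIV" and u: "UNIV = X' \<union> Y'" "X' \<inter> Y' = {}" "c' = c1 + c2" "fill_inv late_credits m' Y' c2"
      and d: "d \<le> 4 + 5 + 8 * L + 5" "s 0 = n" and G: "X' = (\<Union>q\<in>{0..<?M}. G q)" "\<And>q. q < ?M \<Longrightarrow> fill_post q m' (G q)"
      unfolding split_post_def by auto
    have lc: "late_credits \<le> c'" using u(3,4) by (simp add: fill_inv_def)
    have nL: "n \<le> 2 ^ L" using L by simp
    have "sf emp (final_post (d + 4 + climb_depth + 8 * L + 5)) (Run ?rest s d) m' UNIV c'"
    proof (rule climb_phase[where F = G and Y = Y' and b = late_credits and c' = c2])
      show "UNIV = (\<Union>q\<in>{0..<?M}. G q) \<union> Y'" "(\<Union>q\<in>{0..<?M}. G q) \<inter> Y' = {}" using u(1,2) G(1) by auto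
    qed (rule nL d(2) G(2) u(4) lc; assumption?)+
    then show "sf emp (final_post ?D) (Run ?rest s d) m' X c'"
      unfolding X by (rule safe_conseq) (use d(1) in \<open>auto simp: final_post_def\<close>)
  qed
  then have call: "sf emp (final_post ?D) (Run (Call 1 # ?rest) ?s1 4) ?m UNIV (34 * n + 8 + late_credits)" by simp
  have "sf emp (final_post ?D) (Run [Seq (Call 1) (Seq (Assign 1 (Lit 0)) (Seq (Assign 2 (Reg 0)) (Call 2)))] ?s1 3) ?m UNIV
      (Suc (34 * n + 8 + late_credits))"
    by (rule safe_Seq) (use call in \<open>simp add: numeral_eq_Suc\<close>)
  then have "sf emp (final_post ?D) (Run [main_com] ?s 1) ?m UNIV (Suc (34 * n + 8 + late_credits) + 2)"
    unfolding main_com_def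
  proof (intro safe_Assign_Seq)
    have "length es = n - 1" using Suc_length by simp
    then have av: "aval ?s (Times (Lit 2) (Minus (Reg 0) (Lit 1))) = ?M" by simp
    show "aval ?s (Times (Lit 2) (Minus (Reg 0) (Lit 1))) \<le> W" unfolding av by (rule MW)
    assume "sf emp (final_post ?D) (Run [Seq (Call 1) (Seq (Assign 1 (Lit 0)) (Seq (Assign 2 (Reg 0)) (Call 2)))] ?s1 3) ?m UNIV
      (Suc (34 * n + 8 + late_credits))"
    then show "sf emp (final_post ?D) (Run [Seq (Call 1) (Seq (Assign 1 (Lit 0)) (Seq (Assign 2 (Reg 0)) (Call 2)))]
       (?s(2 := aval ?s (Times (Lit 2) (Minus (Reg 0) (Lit 1))))) (Suc (Suc 1))) ?m UNIV (Suc (34 * n + 8 + late_credits))"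
      unfolding av by (simp add: numeral_eq_Suc)
  qed
  then have "sf emp (final_post ?D) (Run [Call 0] ?s 0) ?m UNIV (Suc (Suc (34 * n + 8 + late_credits) + 2))"
    by (intro safe_Call) (simp_all add: uf_prog_def)
  moreover have "Suc (Suc (34 * n + 8 + late_credits) + 2) = total_credits" by (simp add: total_credits_def)
  moreover have "fst (initial n es) = Run [Call 0] ?s 0" by (simp add: initial_def)
  ultimately show ?thesis by (simp only:)
qed

section \<open>Arithmetic of the bounds\<close>

lemma lg_le_height: "real lg \<le> 2 * max 1 (log 2 (real H))"
proof (cases "H = 0")
  case False
  have "real lg \<le> log 2 (real (Suc H))" unfolding lg_def by simp
  \<comment> \<open>Doubling \<open>H\<close> adds one to the logarithm, which the factor
    \<open>2\<close> absorbs.\<close>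
  also have "\<dots> \<le> log 2 (2 * real H)" using False by (intro log_mono) auto
  also have "\<dots> = 1 + log 2 (real H)" using False by (simp add: log_mult)
  finally show ?thesis by linarith
qed (simp add: lg_def)

lemma lg_le_size: "real lg \<le> max 1 (log 2 (real n))"
proof -
  have "real lg \<le> log 2 (real (Suc H))" unfolding lg_def by simp
  also have "\<dots> \<le> log 2 (real n)" using H_less by (intro log_mono) auto
  finally show ?thesis by linarith
qed

lemma total_credits_le: "real total_credits \<le> 3000 * (real n * max 1 (log 2 (real H)))"
proof -
  define x where "x = max 1 (log 2 (real H))"
  have x: "real lg \<le> 2 * x" "1 \<le> x" using lg_le_height by (auto simp: x_def)
  \<comment> \<open>Here \<open>450\<close> is \<open>180\<close> for the insertions, at most two
    per vertex on average, plus \<open>270\<close> for one merge per vertex.\<close>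
  have "total_credits = n * (450 * lg + 226) + 20"
    by (simp add: total_credits_def late_credits_def step_cost_def algebra_simps)
  then have "real total_credits = real n * (450 * real lg + 226) + 20" by simp
  also have "\<dots> \<le> real n * (450 * real lg + 246)" using n_pos by (simp add: distrib_left)
  also have "\<dots> \<le> real n * (3000 * x)" using x by (intro mult_left_mono) auto
  finally show ?thesis unfolding x_def by simp
qed

lemma depth_le:
  assumes "real L \<le> log 2 (real n) + 2"
  shows "real (30 + climb_depth + 16 * L) \<le> 3000 * (real (max 1 H) * max 1 (log 2 (real n)))"
proof -
  define x where "x = max 1 (log 2 (real n))"
  define h where "h = real (max 1 H)"
  have x: "real lg \<le> x" "1 \<le> x" "real L \<le> 3 * x" using lg_le_size assms by (auto simp: x_def)
  have h: "1 \<le> h" "real H \<le> h" by (auto simp: h_def)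
  \<comment> \<open>Here \<open>360\<close> is \<open>90\<close> for an insertion plus
    \<open>270\<close> for a merge.\<close>
  have "climb_depth = H * (360 * lg + 140) + 40"
    by (simp add: climb_depth_def step_cost_def algebra_simps)
  then have "real (30 + climb_depth + 16 * L) = real H * (360 * real lg + 140) + 70 + 16 * real L" by simp
  also have "real H * (360 * real lg + 140) \<le> h * (500 * x)"
    using x h by (intro mult_mono) auto
  also have "h * (500 * x) + 70 + 16 * real L \<le> h * (500 * x) + 118 * x" using x by linarith
  also have "118 * x \<le> 118 * (h * x)" using x h by (simp add: mult_le_cancel_right1)
  also have "h * (500 * x) + 118 * (h * x) \<le> 3000 * (h * x)" using x h by simp
  finally show ?thesis unfolding x_def h_def by simp
qed

end

theorem theorem4p3:
  shows "\<exists>(prog :: com list) (c :: nat). \<forall>(n :: nat) (es :: edge_list). weighted_tree n es \<longrightarrow>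
    (\<forall>(k :: nat) (cfg :: config). (step prog (weight es) ^^ k) (initial n es) cfg \<longrightarrow>
        real k \<le> real c * (real n * max 1 (log 2 (real (sld_height n es)))) \<and>
        real (depth cfg) \<le> real c * (real (max 1 (sld_height n es)) * max 1 (log 2 (real n))) \<and>
        (\<forall>x \<in> config_words cfg. x \<le> c * n ^ c) \<and>
        ((\<nexists>cfg'. step prog (weight es) cfg cfg') \<longrightarrow> finished cfg \<and> outputs_sld n es cfg))"
proof -
  \<comment> \<open>One constant for all bounds: as a factor it exceeds the coefficients that arise,
    and as the exponent of the word bound it has to be at least \<open>2\<close>.\<close>
  define c :: nat where "c = 3000"
  show ?thesis
  proof (intro exI[of _ uf_prog] exI[of _ c] allI impI)
    fix n es k cfg
    assume wt: "weighted_tree n es" and run: "(step uf_prog (weight es) ^^ k) (initial n es) cfg"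
    have n: "1 \<le> n" using wt by (simp add: weighted_tree_def)
    have c: "100 \<le> c" "2 \<le> c" by (simp_all add: c_def)
    have "n ^ 2 \<le> n ^ c" using n c(2) by (rule power_increasing[rotated])
    then have "100 * n * n \<le> c * n ^ c"
      using mult_le_mono[OF c(1)] by (simp add: power2_eq_square mult.assoc)
    then interpret tree_run n es "c * n ^ c" using wt by unfold_locales
    \<comment> \<open>The additional \<open>1\<close> is for the first loop, which has up to
      \<open>2 * n\<close> indices.\<close>
    define L where "L = nat \<lceil>log 2 (real n)\<rceil> + 1"
    have "real n \<le> 2 ^ nat \<lceil>log 2 (real n)\<rceil>"
    proof -
      have "real n = 2 powr log 2 (real n)" using n by simp
      also have "\<dots> \<le> 2 powr real (nat \<lceil>log 2 (real n)\<rceil>)" by (intro powr_mono) (linarith, simp)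
      also have "\<dots> = 2 ^ nat \<lceil>log 2 (real n)\<rceil>" by (simp add: powr_realpow)
      finally show ?thesis .
    qed
    then have "real (2 * n) \<le> real (2 ^ L)" by (simp add: L_def)
    then have L: "2 * n \<le> 2 ^ L" by (simp only: of_nat_le_iff)
    have "0 \<le> log 2 (real n)" using n by simp
    then have L2: "real L \<le> log 2 (real n) + 2" unfolding L_def by linarith
    have nW: "n \<le> c * n ^ c" by (intro nn_bound) simp
    have words: "thread_words (fst (initial n es)) \<subseteq> {..c * n ^ c}"
      using nW by (auto simp: initial_def)
    have "snd (initial n es) a \<le> n" for a
    proof (cases "a < 2 * length es")
      case True
      then show ?thesis using initial_memory(1) hend_less[of "a + 2"] Suc_length by auto
    qed (simp add: initial_memory(2))
    then have mem: "range (snd (initial n es)) \<subseteq> {..c * n ^ c}" using nW order_trans by blast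
    note ad = safe_adequate[OF main_safe[OF L] words mem, unfolded prod.collapse, OF run]
    have "real k \<le> real c * (real n * max 1 (log 2 (real H)))"
      using ad(1) total_credits_le by (simp add: c_def)
    moreover have "real (depth cfg) \<le> real c * (real (max 1 H) * max 1 (log 2 (real n)))"
    proof -
      have "depth cfg \<le> 30 + climb_depth + 16 * L" using ad(2) by (auto simp: final_post_def)
      then have "real (depth cfg) \<le> real (30 + climb_depth + 16 * L)" by (rule of_nat_mono)
      also note depth_le[OF L2]
      finally show ?thesis by (simp add: c_def)
    qed
    moreover have "\<forall>x \<in> config_words cfg. x \<le> c * n ^ c" using ad(3) by auto
    moreover have "finished cfg \<and> outputs_sld n es cfg" if stuck: "\<nexists>cfg'. step uf_prog (weight es) cfg cfg'"
    proof -
      have "out n e = 2 * length es + e" for e using Suc_length by (auto simp: out_def)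
      then show ?thesis
        using ad(4)[OF stuck] by (auto simp: final_post_def outputs_sld_def out_value_def)
    qed
    ultimately show "real k \<le> real c * (real n * max 1 (log 2 (real H))) \<and>
        real (depth cfg) \<le> real c * (real (max 1 H) * max 1 (log 2 (real n))) \<and>
        (\<forall>x \<in> config_words cfg. x \<le> c * n ^ c) \<and>
        ((\<nexists>cfg'. step uf_prog (weight es) cfg cfg') \<longrightarrow> finished cfg \<and> outputs_sld n es cfg)"
      by blast
  qed
qed

end
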